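(* Let $d=3$ and $p\in[1,\infty)$. Then $$\lim_{\delta\to0}\|\nabla(\mathcal K^{\mathrm g}_\delta f-f)\|_{\mathbf L^p(D)}=0\quad\forall f\in Z^{\mathrm g,p}(D),$$ $$\lim_{\delta\to0}\|\nabla\times(\mathcal K^{\mathrm c}_\delta\mathbf g-\mathbf g)\|_{\mathbf L^p(D)}=0\quad\forall\mathbf g\in\mathbf Z^{\mathrm c,p}(D),$$ $$\lim_{\delta\to0}\|\nabla\cdot(\mathcal K^{\mathrm d}_\delta\mathbf g-\mathbf g)\|_{L^p(D)}=0\quad\forall\mathbf g\in\mathbf Z^{\mathrm d,p}(D).$$
   Context: $D\subset\mathbb R^d$ is an open, bounded, connected, strongly Lipschitz set; here $d=3$. $\mathbf L^p(D)=L^p(D;\mathbb R^3)$. $B(\mathbf x,\rho)$ denotes the open Euclidean ball and $\|\cdot\|_{\ell^2}$ the Euclidean norm and induced matrix norm. Let $\mathbf j\in C^\infty(\mathbb R^d;\mathbb R^d)$ be a fixed vector field with $\|\mathbf j\|_{\ell^2}=1$ on $\partial D$ that is globally transversal: there is $\gamma>0$ with $\mathbf n\cdot\mathbf j\ge\gamma$ a.e. on $\partial D$, $\mathbf n$ being the outward unit normal. Set $\boldsymbol\varphi_\delta(\mathbf x)=\mathbf x-\delta\,\mathbf j(\mathbf x)$, and let $r>0$ be fixed such that $\boldsymbol\varphi_\delta(D)+B(\mathbf 0,\delta r)\subset D$ for all $\delta\in[0,1]$ (for $\delta=0$ the ball is understood as $\{\mathbf 0\}$). Let $\mathbb J_\delta(\mathbf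 x)$ be the Jacobian matrix of $\boldsymbol\varphi_\delta$ at $\mathbf x$, and let $\delta_0\in(0,1]$ be such that $\|\mathbb J_\delta(\mathbf x)-\mathbb I\|_{\ell^2}\le\frac12$, $\|\mathbb J_\delta^{-1}(\mathbf x)\|_{\ell^2}\le 2$ and $|\det(\mathbb J_\delta^{-1}(\mathbf x))|\le 2^d$ for all $\delta\in[0,\delta_0]$, $\mathbf x\in D$; the limits are taken with $\delta\in(0,\delta_0]$. The kernel is $\rho(\mathbf y)=\eta\exp\left(-\frac{1}{1-\|\mathbf y\|_{\ell^2}^2}\right)$ if $\|\mathbf y\|_{\ell^2}<1$, $\rho(\mathbf y)=0$ otherwise, with $\eta$ such that $\int_{\mathbb R^d}\rho=1$. For $f\in L^1(D)$, $\mathbf g\in L^1(D;\mathbb R^d)$, $\mathbf x\in D$: $$(\mathcal K_\delta^{\mathrm g}f)(\mathbf x)=\int_{B(\mathbf 0,1)}\rho(\mathbf y)f(\boldsymbol\varphi_\delta(\mathbf x)+\delta r\mathbf y)\,d\mathbf y,$$ $$(\mathcal K_\delta^{\mathrm c}\mathbf g)(\mathbf x)=\int_{B(\mathbf 0,1)}\rho(\mathbf y)\mathbb J_\delta^{\mathsf T}(\mathbf x)\mathbf g(\boldsymbol\varphi_\delta(\mathbf x)+\delta r\mathbf y)\,d\mathbf y,$$ $$(\mathcal K_\delta^{\mathrm d}\mathbf g)(\mathbf x)=\int_{B(\mathbf 0,1)}\rho(\mathbf y)\det(\mathbb J_\delta(\mathbf x))\mathbb J_\delta^{-1}(\mathbf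 x)\mathbf g(\boldsymbol\varphi_\delta(\mathbf x)+\delta r\mathbf y)\,d\mathbf y.$$ Spaces (weak derivatives): $Z^{\mathrm g,p}(D)=\{f\in L^p(D):\nabla f\in\mathbf L^p(D)\}$, $\mathbf Z^{\mathrm c,p}(D)=\{\mathbf v\in\mathbf L^p(D):\nabla\times\mathbf v\in\mathbf L^p(D)\}$, $\mathbf Z^{\mathrm d,p}(D)=\{\mathbf v\in\mathbf L^p(D):\nabla\cdot\mathbf v\in L^p(D)\}$. *)

theory Defs
  imports "HOL-Analysis.Analysis"
begin

section \<open>Smooth functions and test functions\<close>

text \<open>On a finite-dimensional space, a function is of class \<open>C\<^sup>k\<^sup>+\<^sup>1\<close> iff it is differentiable and all its
  directional derivatives are of class \<open>C\<^sup>k\<close>.\<close>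

primrec Ck :: "nat \<Rightarrow> ('a::euclidean_space \<Rightarrow> 'b::real_normed_vector) \<Rightarrow> bool" where
  "Ck 0 = (\<lambda>f. continuous_on UNIV f)"
| "Ck (Suc k) = (\<lambda>f. f differentiable_on UNIV \<and> (\<forall>v. Ck k (\<lambda>x. frechet_derivative f (at x) v)))"

definition smooth :: "('a::euclidean_space \<Rightarrow> 'b::real_normed_vector) \<Rightarrow> bool" where
  "smooth f \<longleftrightarrow> (\<forall>k. Ck k f)"

definition test_function :: "'a::euclidean_space set \<Rightarrow> ('a \<Rightarrow> 'b::real_normed_vector) \<Rightarrow> bool" where
  "test_function D \<psi> \<longleftrightarrow>
     smooth \<psi> \<and> compact (closure {x. \<psi> x \<noteq> 0}) \<and> closure {x. \<psi> x \<noteq> 0} \<subseteq> D"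

definition gradient :: "(real^'n \<Rightarrow> real) \<Rightarrow> real^'n \<Rightarrow> real^'n" where
  "gradient \<psi> x = (\<chi> i. frechet_derivative \<psi> (at x) (axis i 1))"

definition curl :: "(real^3 \<Rightarrow> real^3) \<Rightarrow> real^3 \<Rightarrow> real^3" where
  "curl \<psi> x = (let A = jacobian \<psi> (at x) in
     vector [A$3$2 - A$2$3, A$1$3 - A$3$1, A$2$1 - A$1$2])"

section \<open>Lebesgue spaces and weak derivatives\<close>

text \<open>Elements of \<open>L\<^sup>p(D)\<close> are represented by functions on the whole space whose values outside \<open>D\<close> are
  irrelevant.  The definitions are meant for \<open>1 \<le> p < \<infinity>\<close>.\<close>

definition Lp :: "real \<Rightarrow> 'a::euclidean_space set \<Rightarrow> ('a \<Rightarrow> 'b::euclidean_space) set" where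
  "Lp p D = {f. f \<in> borel_measurable (lebesgue_on D) \<and>
                integrable (lebesgue_on D) (\<lambda>x. norm (f x) powr p)}"

definition Lp_norm :: "real \<Rightarrow> 'a::euclidean_space set \<Rightarrow> ('a \<Rightarrow> 'b::euclidean_space) \<Rightarrow> real" where
  "Lp_norm p D f = (LINT x|lebesgue_on D. norm (f x) powr p) powr (1 / p)"

definition locally_integrable :: "'a::euclidean_space set \<Rightarrow> ('a \<Rightarrow> 'b::euclidean_space) \<Rightarrow> bool" where
  "locally_integrable D f \<longleftrightarrow> (\<forall>C. compact C \<and> C \<subseteq> D \<longrightarrow> integrable (lebesgue_on C) f)"

definition has_weak_gradient ::
    "(real^'n) set \<Rightarrow> (real^'n \<Rightarrow> real) \<Rightarrow> (real^'n \<Rightarrow> real^'n) \<Rightarrow> bool" where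
  "has_weak_gradient D f G \<longleftrightarrow> locally_integrable D f \<and> locally_integrable D G \<and>
     (\<forall>\<psi>::real^'n \<Rightarrow> real. test_function D \<psi> \<longrightarrow>
        (\<forall>i. (LINT x|lebesgue_on D. f x * gradient \<psi> x $ i) = - (LINT x|lebesgue_on D. G x $ i * \<psi> x)))"

definition has_weak_curl ::
    "(real^3) set \<Rightarrow> (real^3 \<Rightarrow> real^3) \<Rightarrow> (real^3 \<Rightarrow> real^3) \<Rightarrow> bool" where
  "has_weak_curl D v c \<longleftrightarrow> locally_integrable D v \<and> locally_integrable D c \<and>
     (\<forall>\<psi>::real^3 \<Rightarrow> real^3. test_function D \<psi> \<longrightarrow>
        (LINT x|lebesgue_on D. v x \<bullet> curl \<psi> x) = (LINT x|lebesgue_on D. c x \<bullet> \<psi> x))"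

definition has_weak_div ::
    "(real^'n) set \<Rightarrow> (real^'n \<Rightarrow> real^'n) \<Rightarrow> (real^'n \<Rightarrow> real) \<Rightarrow> bool" where
  "has_weak_div D v h \<longleftrightarrow> locally_integrable D v \<and> locally_integrable D h \<and>
     (\<forall>\<psi>::real^'n \<Rightarrow> real. test_function D \<psi> \<longrightarrow>
        (LINT x|lebesgue_on D. v x \<bullet> gradient \<psi> x) = - (LINT x|lebesgue_on D. h x * \<psi> x))"

text \<open>On an open set, weak derivatives are unique up to null sets, so the \<open>L\<^sup>p\<close> norms of the following
  functions do not depend on the choice as soon as a weak derivative exists.\<close>

definition weak_gradient :: "(real^'n) set \<Rightarrow> (real^'n \<Rightarrow> real) \<Rightarrow> real^'n \<Rightarrow> real^'n" where
  "weak_gradient D f = (SOME G. has_weak_gradient D f G)"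

definition weak_curl :: "(real^3) set \<Rightarrow> (real^3 \<Rightarrow> real^3) \<Rightarrow> real^3 \<Rightarrow> real^3" where
  "weak_curl D v = (SOME c. has_weak_curl D v c)"

definition weak_div :: "(real^'n) set \<Rightarrow> (real^'n \<Rightarrow> real^'n) \<Rightarrow> real^'n \<Rightarrow> real" where
  "weak_div D v = (SOME h. has_weak_div D v h)"

definition Zg :: "real \<Rightarrow> (real^'n) set \<Rightarrow> (real^'n \<Rightarrow> real) set" where
  "Zg p D = {f \<in> Lp p D. \<exists>G \<in> Lp p D. has_weak_gradient D f G}"

definition Zc :: "real \<Rightarrow> (real^3) set \<Rightarrow> (real^3 \<Rightarrow> real^3) set" where
  "Zc p D = {v \<in> Lp p D. \<exists>c \<in> Lp p D. has_weak_curl D v c}"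

definition Zd :: "real \<Rightarrow> (real^'n) set \<Rightarrow> (real^'n \<Rightarrow> real^'n) set" where
  "Zd p D = {v \<in> Lp p D. \<exists>h \<in> Lp p D. has_weak_div D v h}"

section \<open>Strongly Lipschitz sets, outward normal, transversality\<close>

text \<open>A coordinate cylinder near \<open>x\<^sub>0\<close>: points are written \<open>x\<^sub>0 + y + tN\<close> with \<open>N\<close> a unit vector and
  \<open>y\<close> orthogonal to \<open>N\<close>; inside the cylinder, \<open>D\<close> is the part strictly above the graph of a
  Lipschitz function \<open>\<zeta>\<close>.  Hence \<open>N\<close> points into \<open>D\<close>.\<close>

definition lipschitz_chart ::
    "'a::euclidean_space set \<Rightarrow> 'a \<Rightarrow> 'a \<Rightarrow> real \<Rightarrow> real \<Rightarrow> ('a \<Rightarrow> real) \<Rightarrow> bool" where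
  "lipschitz_chart D x\<^sub>0 N b c \<zeta> \<longleftrightarrow>
     norm N = 1 \<and> b > 0 \<and> c > 0 \<and>
     (\<exists>L. L-lipschitz_on {y. y \<bullet> N = 0} \<zeta>) \<and> \<zeta> 0 = 0 \<and>
     (\<forall>y. y \<bullet> N = 0 \<and> norm y \<le> b \<longrightarrow> \<bar>\<zeta> y\<bar> < c) \<and>
     (\<forall>y t. y \<bullet> N = 0 \<and> norm y < b \<and> \<bar>t\<bar> < c \<longrightarrow>
        (x\<^sub>0 + y + t *\<^sub>R N \<in> D \<longleftrightarrow> \<zeta> y < t) \<and>
        (x\<^sub>0 + y + t *\<^sub>R N \<in> frontier D \<longleftrightarrow> t = \<zeta> y) \<and>
        (x\<^sub>0 + y + t *\<^sub>R N \<in> - closure D \<longleftrightarrow> t < \<zeta> y))"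

definition strongly_lipschitz :: "'a::euclidean_space set \<Rightarrow> bool" where
  "strongly_lipschitz D \<longleftrightarrow> open D \<and> compact (frontier D) \<and>
     (\<forall>x\<^sub>0 \<in> frontier D. \<exists>N b c \<zeta>. lipschitz_chart D x\<^sub>0 N b c \<zeta>)"

text \<open>Where \<open>\<zeta>\<close> has gradient \<open>g\<close> (a vector orthogonal to \<open>N\<close>) at the centre of the chart, the
  vector \<open>g - N\<close> is normal to the graph and points out of \<open>D\<close>.\<close>

definition outward_unit_normal :: "'a::euclidean_space set \<Rightarrow> 'a \<Rightarrow> 'a \<Rightarrow> bool" where
  "outward_unit_normal D x n \<longleftrightarrow>
     (\<exists>N b c \<zeta> g. lipschitz_chart D x N b c \<zeta> \<and> g \<bullet> N = 0 \<and>
        (\<zeta> has_derivative (\<lambda>h. g \<bullet> h)) (at 0 within {y. y \<bullet> N = 0}) \<and>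
        n = (g - N) /\<^sub>R norm (g - N))"

text \<open>The \<open>s\<close>-dimensional Hausdorff outer measure, up to the usual normalising constant.\<close>

definition hausdorff_outer :: "nat \<Rightarrow> 'a::euclidean_space set \<Rightarrow> ennreal" where
  "hausdorff_outer s A =
     (SUP \<epsilon> \<in> {0::real<..}.
        INF C \<in> {C :: nat \<Rightarrow> 'a set. A \<subseteq> (\<Union>i. C i) \<and> (\<forall>i. bounded (C i) \<and> diameter (C i) \<le> \<epsilon>)}.
          \<Sum>i. if C i = {} then 0 else ennreal (diameter (C i) ^ s))"

text \<open>Surface measure on the boundary is the Hausdorff measure of codimension one.\<close>

definition globally_transversal :: "'a::euclidean_space set \<Rightarrow> ('a \<Rightarrow> 'a) \<Rightarrow> bool" where
  "globally_transversal D j \<longleftrightarrow>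
     (\<exists>\<gamma>>0. hausdorff_outer (DIM('a) - 1)
        {x \<in> frontier D. \<not> (\<exists>n. outward_unit_normal D x n \<and> n \<bullet> j x \<ge> \<gamma>)} = 0)"

section \<open>Mollification operators\<close>

definition matrix_norm :: "real^'n^'m \<Rightarrow> real" where
  "matrix_norm A = onorm (\<lambda>v. A *v v)"

definition bump :: "'a::euclidean_space \<Rightarrow> real" where
  "bump y = (if norm y < 1 then exp (- 1 / (1 - (norm y)\<^sup>2)) else 0)"

definition kernel_const :: "'a::euclidean_space itself \<Rightarrow> real" where
  "kernel_const _ = 1 / (LINT y|lebesgue. bump (y::'a))"

definition kernel :: "'a::euclidean_space \<Rightarrow> real" where
  "kernel y = kernel_const TYPE('a) * bump y"

definition shrink :: "('a::real_vector \<Rightarrow> 'a) \<Rightarrow> real \<Rightarrow> 'a \<Rightarrow> 'a" where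
  "shrink j \<delta> x = x - \<delta> *\<^sub>R j x"

definition shrink_jac :: "(real^'n \<Rightarrow> real^'n) \<Rightarrow> real \<Rightarrow> real^'n \<Rightarrow> real^'n^'n" where
  "shrink_jac j \<delta> x = jacobian (shrink j \<delta>) (at x)"

definition Kg :: "(real^'n \<Rightarrow> real^'n) \<Rightarrow> real \<Rightarrow> real \<Rightarrow> (real^'n \<Rightarrow> real) \<Rightarrow> real^'n \<Rightarrow> real" where
  "Kg j r \<delta> f x =
     (LINT y|lebesgue_on (ball 0 1). kernel y * f (shrink j \<delta> x + (\<delta> * r) *\<^sub>R y))"

definition Kc :: "(real^'n \<Rightarrow> real^'n) \<Rightarrow> real \<Rightarrow> real \<Rightarrow> (real^'n \<Rightarrow> real^'n) \<Rightarrow> real^'n \<Rightarrow> real^'n" where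
  "Kc j r \<delta> g x =
     (LINT y|lebesgue_on (ball 0 1).
        kernel y *\<^sub>R (transpose (shrink_jac j \<delta> x) *v g (shrink j \<delta> x + (\<delta> * r) *\<^sub>R y)))"

definition Kd :: "(real^'n \<Rightarrow> real^'n) \<Rightarrow> real \<Rightarrow> real \<Rightarrow> (real^'n \<Rightarrow> real^'n) \<Rightarrow> real^'n \<Rightarrow> real^'n" where
  "Kd j r \<delta> g x =
     (LINT y|lebesgue_on (ball 0 1).
        (kernel y * det (shrink_jac j \<delta> x)) *\<^sub>R
          (matrix_inv (shrink_jac j \<delta> x) *v g (shrink j \<delta> x + (\<delta> * r) *\<^sub>R y)))"

text \<open>The constant in the kernel is well defined: the integral of \<open>bump\<close> is finite and nonzero.\<close>

lemma bump_measurable [measurable]: "bump \<in> borel_measurable borel"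
  unfolding bump_def by measurable

lemma bump_bounds: "0 \<le> bump y" "bump y \<le> indicator (ball 0 1) y"
  by (auto simp: bump_def indicator_def power_le_one)

lemma integrable_bump: "integrable lborel (bump :: 'a::euclidean_space \<Rightarrow> real)"
proof (rule Bochner_Integration.integrable_bound)
  show "integrable lborel (indicator (ball 0 1) :: 'a \<Rightarrow> real)"
    using emeasure_lborel_ball_finite[of "0::'a" 1] by (simp add: integrable_indicator_iff)
  show "AE x in lborel. norm (bump x) \<le> norm (indicator (ball 0 1) x :: real)"
    by (intro AE_I2) (simp add: bump_bounds)
qed auto

lemma integral_kernel: "(LINT y|lebesgue. kernel (y::'a::euclidean_space)) = 1"
proof -
  have eq: "(LINT y|lebesgue. bump (y::'a)) = (LINT y|lborel. bump (y::'a))"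
    by (simp add: integral_completion)
  have "(LINT y|lborel. bump (y::'a)) \<noteq> 0"
  proof
    assume "(LINT y|lborel. bump (y::'a)) = 0"
    then have "AE y::'a in lborel. bump y = 0"
      using integral_nonneg_eq_0_iff_AE[OF integrable_bump] bump_bounds by auto
    then have "AE y::'a in lborel. y \<notin> ball 0 1"
      by eventually_elim (auto simp: bump_def)
    then have "emeasure lborel (ball (0::'a) 1) = 0"
      by (subst (asm) AE_iff_measurable[OF _ refl]) (auto simp: ball_def)
    moreover have "measure lborel (ball (0::'a) 1) > 0"
      using content_ball_pos[of 1 "0::'a"] by simp
    ultimately show False by (simp add: measure_def)
  qed
  then show ?thesis by (simp add: kernel_def kernel_const_def eq)
qed

end

theory Submission
  imports Defs
begin

text \<open>On \<open>D\<close> the smoothing operators have the form \<open>x \<mapsto> A\<^sub>\<delta>(x) (\<rho>\<^sub>\<epsilon> * f)(\<phi>\<^sub>\<delta>(x))\<close> with \<open>\<epsilon> = \<delta>r\<close>, where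
  \<open>\<rho>\<^sub>\<epsilon> * f\<close> is a classical mollification of the extension of \<open>f\<close> by zero and \<open>A\<^sub>\<delta>\<close> is \<open>1\<close>, \<open>J\<^sup>T\<close>, or the
  adjugate \<open>det(J) J\<^sup>-\<^sup>1\<close> of \<open>J = J\<^sub>\<delta>(x)\<close>.  Testing the weak derivative of \<open>f\<close> with translates of \<open>\<rho>\<^sub>\<epsilon>\<close>, which are supported
  in \<open>D\<close> around points of \<open>\<phi>\<^sub>\<delta>(D)\<close>, shows that mollification commutes with the derivative there.  The
  chain rule and the symmetry of the second derivatives of \<open>\<phi>\<^sub>\<delta>\<close> (Piola identity) then give
  gradient, curl and divergence of the smoothed fields as \<open>J\<^sup>T\<close>, \<open>det(J) J\<^sup>-\<^sup>1\<close> and \<open>det(J)\<close> applied to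
  the mollified derivative of \<open>f\<close>.  These factors tend to the identity uniformly, so it remains
  to see \<open>(\<rho>\<^sub>\<epsilon> * g) \<circ> \<phi>\<^sub>\<delta> \<longrightarrow> g\<close> in \<open>L\<^sup>p(D)\<close>: the left side is bounded on \<open>L\<^sup>p\<close> uniformly
  in \<open>\<delta>\<close> by Jensen's inequality and the change of variables \<open>\<phi>\<^sub>\<delta>\<close>, and for continuous \<open>g\<close> the
  convergence is uniform.\<close>

subsection \<open>Smoothness of the kernel\<close>

text \<open>Extension by zero destroys regularity at the boundary, yet no boundary term appears: for
  x in D the kernel only sees the ball of radius \<delta>r about \<phi>(x), which lies in D. For the
  same reason a continuous function cut off outside D, although it jumps at the boundary, has
  mollifications converging uniformly on D. Two mismatches shape the proof. Elements of L^p are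
  Lebesgue measurable functions on D with arbitrary values elsewhere, while convolution is done over
  \<open>lborel\<close>; they are therefore replaced by Borel versions vanishing off D. And
  \<open>weak_gradient\<close>, \<open>weak_curl\<close>, \<open>weak_div\<close> are choices, so a
  computed weak derivative determines their norms only through uniqueness almost everywhere, that
  is, through the fundamental lemma of the calculus of variations. The change of variables needs
  \<phi> injective. Bounds on the Jacobian over D do not give this directly, as D need not be
  convex; a mean value estimate on a large ball around D gives it for small \<delta>, which is
  enough for a limit. The constant 8 in the change of variables is the bound 2^3 on the determinant
  of the inverse Jacobian.\<close>

definition flat_exp :: "nat \<Rightarrow> real \<Rightarrow> real" where
  "flat_exp k t = (if t > 0 then inverse t ^ k * exp (- inverse t) else 0)"

lemma flat_exp_tendsto_0: "(flat_exp k \<longlongrightarrow> 0) (at_right 0)"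
proof -
  have "((\<lambda>t::real. inverse t ^ k / exp (inverse t)) \<longlongrightarrow> 0) (at_right 0)"
    by (rule filterlim_compose[OF tendsto_power_div_exp_0 filterlim_inverse_at_top_right])
  moreover have "\<forall>\<^sub>F t in at_right 0. flat_exp k t = inverse t ^ k / exp (inverse t)"
    using eventually_at_right_less[of 0]
    by eventually_elim (simp add: flat_exp_def exp_minus divide_inverse)
  ultimately show ?thesis
    by (simp add: tendsto_cong)
qed

text \<open>The factors t^(-k) are carried along because differentiating exp(-1/t) produces them:
  the derivative is a combination of the members k+1 and k+2. At 0 the difference quotient from the
  right is the member k+1 itself, which tends to 0.\<close>

lemma flat_exp_has_real_derivative:
  "(flat_exp k has_real_derivative (flat_exp (k + 2) t - real k * flat_exp (k + 1) t)) (at t)"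
proof -
  consider "t > 0" | "t < 0" | "t = 0" by linarith
  then show ?thesis
  proof cases
    case 1
    have "((\<lambda>t. inverse t ^ k * exp (- inverse t)) has_real_derivative
        (flat_exp (k + 2) t - real k * flat_exp (k + 1) t)) (at t)"
      using 1
      by (auto intro!: derivative_eq_intros simp: flat_exp_def power2_eq_square algebra_simps
          power_Suc[symmetric] simp del: power_Suc split: nat_diff_split)
        (simp_all add: power_Suc)
    moreover have "\<forall>\<^sub>F s in nhds t. flat_exp k s = inverse s ^ k * exp (- inverse s)"
      using eventually_nhds_in_open[of "{0<..}" t] 1 by (auto simp: flat_exp_def elim: eventually_mono)
    ultimately show ?thesis
      by (simp add: DERIV_cong_ev)
  next
    case 2
    have "\<forall>\<^sub>F s in nhds t. flat_exp k s = 0"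
      using eventually_nhds_in_open[of "{..<0}" t] 2 by (auto simp: flat_exp_def elim: eventually_mono)
    then have "(flat_exp k has_real_derivative 0) (at t)"
      by (subst DERIV_cong_ev[OF refl _ refl]) auto
    with 2 show ?thesis by (simp add: flat_exp_def)
  next
    case 3
    have "((\<lambda>s. flat_exp k s / s) \<longlongrightarrow> 0) (at 0)"
      unfolding filterlim_at_split
    proof
      have "\<forall>\<^sub>F s in at_left 0. flat_exp k s / s = 0"
        unfolding eventually_at_filter by (intro always_eventually) (simp add: flat_exp_def)
      then show "((\<lambda>s. flat_exp k s / s) \<longlongrightarrow> 0) (at_left 0)"
        by (simp add: tendsto_eventually)
      have "\<forall>\<^sub>F s in at_right 0. flat_exp (k + 1) s = flat_exp k s / s"
        unfolding eventually_at_filter by (intro always_eventually) (simp add: flat_exp_def divide_inverse)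
      with flat_exp_tendsto_0[of "k + 1"] show "((\<lambda>s. flat_exp k s / s) \<longlongrightarrow> 0) (at_right 0)"
        by (simp add: tendsto_cong)
    qed
    with 3 show ?thesis by (simp add: DERIV_def flat_exp_def)
  qed
qed

text \<open>\<open>Ck\<close> recurses through all directional derivatives, so a class of
  differentiable functions that contains the directional derivatives of its members satisfies every
  \<open>Ck\<close>, by induction on the order. The class is arbitrary: each use picks one whose
  closure is evident.\<close>

lemma smooth_coinduct:
  fixes X :: "('a::euclidean_space \<Rightarrow> 'b::real_normed_vector) \<Rightarrow> bool"
  assumes "X f"
    and step: "\<And>f. X f \<Longrightarrow> \<exists>f'. (\<forall>x. (f has_derivative f' x) (at x)) \<and> (\<forall>v. X (\<lambda>x. f' x v))"
  shows "smooth f"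
proof -
  have "\<forall>f. X f \<longrightarrow> Ck k f" for k
  proof (induction k)
    case 0
    show ?case
    proof safe
      fix f assume "X f"
      with step obtain f' where "\<forall>x. (f has_derivative f' x) (at x)" by blast
      then show "Ck 0 f"
        by (auto intro!: continuous_at_imp_continuous_on has_derivative_continuous)
    qed
  next
    case (Suc k)
    show ?case
    proof safe
      fix f assume "X f"
      with step obtain f' where f': "\<And>x. (f has_derivative f' x) (at x)" "\<And>v. X (\<lambda>x. f' x v)" by blast
      then have "frechet_derivative f (at x) = f' x" for x
        by (metis frechet_derivative_at)
      with f' Suc show "Ck (Suc k) f"
        by (auto simp: differentiable_on_def differentiable_def)
    qed
  qed
  with \<open>X f\<close> show ?thesis by (auto simp: smooth_def)
qed

text \<open>The algebra generated by the linear forms in x - a and the functions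
  \<open>flat_exp k\<close> of 1 - c|x - a|^2. All indices k are generators since differentiation
  raises k; closure under products absorbs the inner derivative. With c = \<epsilon>^(-2) it
  contains the scaled kernel centred at a.\<close>

inductive bump_algebra :: "real \<Rightarrow> 'a::euclidean_space \<Rightarrow> ('a \<Rightarrow> real) \<Rightarrow> bool" for c a where
  const: "bump_algebra c a (\<lambda>_. k)"
| inner: "bump_algebra c a (\<lambda>x. (x - a) \<bullet> v)"
| flat: "bump_algebra c a (\<lambda>x. flat_exp k (1 - c * ((x - a) \<bullet> (x - a))))"
| add: "bump_algebra c a f \<Longrightarrow> bump_algebra c a g \<Longrightarrow> bump_algebra c a (\<lambda>x. f x + g x)"
| mult: "bump_algebra c a f \<Longrightarrow> bump_algebra c a g \<Longrightarrow> bump_algebra c a (\<lambda>x. f x * g x)"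

lemma bump_algebra_derivative:
  assumes "bump_algebra c a f"
  shows "\<exists>f'. (\<forall>x. (f has_derivative f' x) (at x)) \<and> (\<forall>v. bump_algebra c a (\<lambda>x. f' x v))"
  using assms
proof induction
  case (const k)
  show ?case by (rule exI[of _ "\<lambda>_ _. 0"]) (auto intro: bump_algebra.const)
next
  case (inner v)
  show ?case
    by (rule exI[of _ "\<lambda>_ h. h \<bullet> v"]) (auto intro!: bump_algebra.const derivative_eq_intros)
next
  case (flat k)
  let ?q = "\<lambda>x. 1 - c * ((x - a) \<bullet> (x - a))"
  let ?d = "\<lambda>x v. (flat_exp (k + 2) (?q x) + (- real k) * flat_exp (k + 1) (?q x)) * ((- 2 * c) * ((x - a) \<bullet> v))"
  have "((\<lambda>x. flat_exp k (?q x)) has_derivative ?d x) (at x)" for x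
  proof -
    have "(?q has_derivative (\<lambda>v. (- 2 * c) * ((x - a) \<bullet> v))) (at x)"
      by (auto intro!: derivative_eq_intros ext simp: inner_commute)
    moreover have "(flat_exp k has_derivative (*) (flat_exp (k + 2) (?q x) + (- real k) * flat_exp (k + 1) (?q x))) (at (?q x))"
      using flat_exp_has_real_derivative[of k "?q x"] by (simp add: has_field_derivative_def)
    ultimately show ?thesis
      by (rule has_derivative_compose)
  qed
  moreover have "bump_algebra c a (\<lambda>x. ?d x v)" for v
    by (intro bump_algebra.intros)
  ultimately show ?case
    by (intro exI[of _ ?d]) simp
next
  case (add f g)
  then obtain f' g' where *: "\<And>x. (f has_derivative f' x) (at x)" "\<And>v. bump_algebra c a (\<lambda>x. f' x v)"
    "\<And>x. (g has_derivative g' x) (at x)" "\<And>v. bump_algebra c a (\<lambda>x. g' x v)" by blast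
  show ?case
    by (rule exI[of _ "\<lambda>x v. f' x v + g' x v"]) (auto intro: * bump_algebra.add derivative_intros)
next
  case (mult f g)
  then obtain f' g' where *: "\<And>x. (f has_derivative f' x) (at x)" "\<And>v. bump_algebra c a (\<lambda>x. f' x v)"
    "\<And>x. (g has_derivative g' x) (at x)" "\<And>v. bump_algebra c a (\<lambda>x. g' x v)" by blast
  show ?case
    by (rule exI[of _ "\<lambda>x v. f x * g' x v + f' x v * g x"])
      (auto intro!: * mult.hyps bump_algebra.add bump_algebra.mult has_derivative_mult)
qed

lemma smooth_bump_algebra: "bump_algebra c a f \<Longrightarrow> smooth f"
  by (rule smooth_coinduct[of "bump_algebra c a"]) (auto intro: bump_algebra_derivative)

text \<open>Coinduction with the class of all compositions of T with smooth functions: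
  differentiation commutes with T.\<close>

lemma smooth_bounded_linear:
  assumes T: "bounded_linear T" and "smooth f"
  shows "smooth (\<lambda>x. T (f x))"
proof (rule smooth_coinduct[where X = "\<lambda>g. \<exists>f. smooth f \<and> g = (\<lambda>x. T (f x))"])
  fix g assume "\<exists>f. smooth f \<and> g = (\<lambda>x. T (f x))"
  then obtain f where f: "\<And>k. Ck k f" and g: "g = (\<lambda>x. T (f x))" by (auto simp: smooth_def)
  have "(f has_derivative frechet_derivative f (at x)) (at x)" for x
    using f[of "Suc 0"] by (simp add: differentiable_on_def frechet_derivative_works)
  then have "(g has_derivative (\<lambda>v. T (frechet_derivative f (at x) v))) (at x)" for x
    unfolding g by (rule bounded_linear.has_derivative[OF T])
  moreover have "smooth (\<lambda>x. frechet_derivative f (at x) v)" for v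
    using f[of "Suc k" for k] by (auto simp: smooth_def)
  ultimately show "\<exists>g'. (\<forall>x. (g has_derivative g' x) (at x)) \<and>
      (\<forall>v. \<exists>f. smooth f \<and> (\<lambda>x. g' x v) = (\<lambda>x. T (f x)))"
    by (intro exI[of _ "\<lambda>x v. T (frechet_derivative f (at x) v)"]) blast
qed (use assms in blast)

lemma smooth_scaleR_const: "smooth f \<Longrightarrow> smooth (\<lambda>x. f x *\<^sub>R e)"
  by (rule smooth_bounded_linear[OF bounded_linear_scaleR_left])

lemma smooth_has_derivative: "smooth f \<Longrightarrow> (f has_derivative frechet_derivative f (at x)) (at x)"
  unfolding smooth_def
  by (drule spec[of _ "Suc 0"]) (simp add: differentiable_on_def frechet_derivative_works)

lemma smooth_directional: "smooth f \<Longrightarrow> smooth (\<lambda>x. frechet_derivative f (at x) v)"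
  unfolding smooth_def by (metis Ck.simps(2))

lemma smooth_continuous_on: "smooth f \<Longrightarrow> continuous_on A f"
  unfolding smooth_def by (metis Ck.simps(1) continuous_on_subset subset_UNIV)

section \<open>Integrals over D as integrals over the space; functions of bounded support\<close>

lemma
  fixes f :: "'a::euclidean_space \<Rightarrow> 'b::euclidean_space"
  assumes "D \<in> sets lebesgue"
  shows integral_lebesgue_on_if: "(LINT x|lebesgue_on D. f x) = (LINT x|lebesgue. (if x \<in> D then f x else 0))"
    and integrable_lebesgue_on_if: "integrable (lebesgue_on D) f \<longleftrightarrow> integrable lebesgue (\<lambda>x. if x \<in> D then f x else 0)"
proof -
  have eq: "(\<lambda>x. if x \<in> D then f x else 0) = (\<lambda>x. indicator D x *\<^sub>R f x)"
    by (auto simp: indicator_def)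
  show "(LINT x|lebesgue_on D. f x) = (LINT x|lebesgue. (if x \<in> D then f x else 0))"
    unfolding eq using assms by (subst integral_restrict_space) auto
  show "integrable (lebesgue_on D) f \<longleftrightarrow> integrable lebesgue (\<lambda>x. if x \<in> D then f x else 0)"
    unfolding eq using assms by (subst integrable_restrict_space) auto
qed

text \<open>Completeness of Lebesgue measure carries measurability from g over to f, across the null
  set where they differ.\<close>

lemma
  fixes f g :: "'a::euclidean_space \<Rightarrow> 'b::euclidean_space"
  assumes g: "integrable lborel g" and ae: "AE x in lborel. g x = f x"
  shows integrable_lebesgue_AE: "integrable lebesgue f"
    and integral_lebesgue_AE: "(LINT x|lebesgue. f x) = (LINT x|lborel. g x)"
proof -
  have ae': "AE x in lebesgue. g x = f x" by (rule AE_completion[OF ae])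
  have g': "integrable lebesgue g" using g by (simp add: integrable_completion)
  have m: "f \<in> borel_measurable lebesgue"
    by (rule borel_measurable_AE[OF _ ae']) (use g' in auto)
  show "integrable lebesgue f"
    using ae' m g' integrable_cong_AE[of g lebesgue f] by auto
  have "(LINT x|lebesgue. f x) = (LINT x|lebesgue. g x)"
    using ae' m g' by (intro integral_cong_AE) auto
  then show "(LINT x|lebesgue. f x) = (LINT x|lborel. g x)"
    using g by (simp add: integral_completion)
qed

lemma integrable_continuous_bounded_support:
  fixes g :: "'a::euclidean_space \<Rightarrow> 'b::euclidean_space"
  assumes "continuous_on UNIV g" and "\<And>x. norm x > R \<Longrightarrow> g x = 0"
  shows "integrable lborel g"
proof -
  have "integrable lborel (\<lambda>x. indicator (cball 0 R) x *\<^sub>R g x)"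
    using borel_integrable_compact[of "cball 0 R" g] assms(1) continuous_on_subset
    by (auto simp: set_integrable_def)
  moreover have "(\<lambda>x. indicator (cball 0 R) x *\<^sub>R g x) = g"
    using assms(2) by (auto simp: indicator_def dist_norm fun_eq_iff not_le)
  ultimately show ?thesis by simp
qed

lemma uniformly_continuous_bounded_support:
  fixes g :: "'a::euclidean_space \<Rightarrow> 'b::real_normed_vector"
  assumes cont: "continuous_on UNIV g" and zero: "\<And>x. norm x > R \<Longrightarrow> g x = 0"
  shows "uniformly_continuous_on UNIV g"
  unfolding uniformly_continuous_on_def
proof (intro allI impI)
  fix e :: real assume "e > 0"
  have "uniformly_continuous_on (cball 0 (R + 1)) g"
    using cont by (intro compact_uniformly_continuous) (auto intro: continuous_on_subset)
  with \<open>e > 0\<close> obtain d where d: "d > 0"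
    "\<And>x y. x \<in> cball 0 (R + 1) \<Longrightarrow> y \<in> cball 0 (R + 1) \<Longrightarrow> dist y x < d \<Longrightarrow> dist (g y) (g x) < e"
    unfolding uniformly_continuous_on_def by metis
  \<comment> \<open>A step shorter than 1 does not lead from \<open>cball 0 R\<close> out of
    \<open>cball 0 (R + 1)\<close>: either both points lie in the larger, compact ball, or g
    vanishes at both.\<close>
  show "\<exists>d>0. \<forall>x\<in>UNIV. \<forall>y\<in>UNIV. dist y x < d \<longrightarrow> dist (g y) (g x) < e"
  proof (intro exI[of _ "min d 1"] conjI ballI impI)
    fix x y :: 'a assume xy: "dist y x < min d 1"
    then have "norm x \<le> norm y + 1" "norm y \<le> norm x + 1"
      unfolding dist_norm by norm+
    then show "dist (g y) (g x) < e"
      using xy d(2)[of x y] zero[of x] zero[of y] \<open>e > 0\<close>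
      by (cases "norm x > R \<and> norm y > R") (auto simp: dist_norm)
  qed (use d(1) in auto)
qed

lemma bounded_bounded_support:
  fixes g :: "'a::euclidean_space \<Rightarrow> 'b::real_normed_vector"
  assumes cont: "continuous_on UNIV g" and zero: "\<And>x. norm x > R \<Longrightarrow> g x = 0"
  obtains B where "B > 0" "\<And>x. norm (g x) \<le> B"
proof -
  have "compact (g ` cball 0 R)"
    using cont by (intro compact_continuous_image) (auto intro: continuous_on_subset)
  then obtain B where B: "B > 0" "\<And>x. x \<in> g ` cball 0 R \<Longrightarrow> norm x \<le> B"
    using compact_imp_bounded bounded_pos by metis
  have "norm (g x) \<le> B" for x
    using B zero[of x] by (cases "norm x > R") auto
  with B(1) that show ?thesis by blast
qed

lemma has_derivative_0_open:
  assumes "(f has_derivative f') (at x)" "open S" "x \<in> S" "\<And>y. y \<in> S \<Longrightarrow> f y = 0"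
  shows "f' = (\<lambda>_. 0)"
proof -
  have "((\<lambda>_. 0) has_derivative f') (at x)"
    using assms by (intro has_derivative_transform_within_open[OF assms(1-3)]) auto
  moreover have "((\<lambda>_. 0) has_derivative (\<lambda>_. 0)) (at x)" by simp
  ultimately show ?thesis by (rule has_derivative_unique)
qed

subsection \<open>Convolution with a compactly supported kernel\<close>

lemma convolution_integrable:
  fixes f :: "'a::euclidean_space \<Rightarrow> 'b::euclidean_space" and K :: "'a \<Rightarrow> real"
  assumes K: "continuous_on UNIV K" "\<And>u. \<bar>K u\<bar> \<le> B" and f: "integrable lborel f"
  shows "integrable lborel (\<lambda>w. K (w - z) *\<^sub>R f w)"
proof (rule Bochner_Integration.integrable_bound)
  show "integrable lborel (\<lambda>w. B *\<^sub>R f w)" using f by simp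
  have [measurable]: "K \<in> borel_measurable borel"
    using K(1) by (rule borel_measurable_continuous_onI)
  show "(\<lambda>w. K (w - z) *\<^sub>R f w) \<in> borel_measurable lborel"
    using borel_measurable_integrable[OF f] by measurable
  have "norm (K (w - z) *\<^sub>R f w) \<le> norm (B *\<^sub>R f w)" for w
    using K(2)[of "w - z"] by (simp add: mult_right_mono)
  then show "AE w in lborel. norm (K (w - z) *\<^sub>R f w) \<le> norm (B *\<^sub>R f w)"
    by simp
qed

text \<open>All regularity comes from the kernel: its uniform continuity bounds the difference of
  the integrands by a small multiple of the norm of f, with the same factor for all w.\<close>

lemma convolution_continuous:
  fixes f :: "'a::euclidean_space \<Rightarrow> 'b::euclidean_space" and K :: "'a \<Rightarrow> real"
  assumes K: "continuous_on UNIV K" "\<And>x. norm x > R \<Longrightarrow> K x = 0" and f: "integrable lborel f"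
  shows "continuous_on UNIV (\<lambda>z. LINT w|lborel. K (w - z) *\<^sub>R f w)"
proof -
  obtain B where B: "\<And>x. \<bar>K x\<bar> \<le> B"
    using bounded_bounded_support[OF K] by (metis real_norm_def)
  note int = convolution_integrable[OF K(1) B f]
  \<comment> \<open>Adding 1 keeps I positive and makes the final estimate strict even when f
    vanishes almost everywhere.\<close>
  define I where "I = (LINT w|lborel. norm (f w)) + 1"
  have I: "I > 0" "(LINT w|lborel. norm (f w)) < I"
    by (auto simp: I_def intro: add_nonneg_pos)
  show ?thesis
    unfolding continuous_on_iff
  proof (intro ballI allI impI)
    fix z and e :: real assume "e > 0"
    with uniformly_continuous_bounded_support[OF K] I(1) obtain d where d: "d > 0"
      "\<And>x y. dist y x < d \<Longrightarrow> \<bar>K y - K x\<bar> < e / I"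
      unfolding uniformly_continuous_on_def dist_real_def by (metis UNIV_I divide_pos_pos)
    show "\<exists>d>0. \<forall>z'\<in>UNIV. dist z' z < d \<longrightarrow>
        dist (LINT w|lborel. K (w - z') *\<^sub>R f w) (LINT w|lborel. K (w - z) *\<^sub>R f w) < e"
    proof (intro exI[of _ d] conjI ballI impI d(1))
      fix z' assume z': "dist z' z < d"
      have "dist (LINT w|lborel. K (w - z') *\<^sub>R f w) (LINT w|lborel. K (w - z) *\<^sub>R f w) =
          norm (LINT w|lborel. (K (w - z') - K (w - z)) *\<^sub>R f w)"
        unfolding dist_norm by (subst Bochner_Integration.integral_diff[symmetric, OF int int])
          (simp add: scaleR_diff_left)
      also have "\<dots> \<le> (LINT w|lborel. (e / I) * norm (f w))"
      proof (rule Bochner_Integration.integral_norm_bound_integral)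
        show "integrable lborel (\<lambda>w. (K (w - z') - K (w - z)) *\<^sub>R f w)"
          using int by (simp add: scaleR_diff_left)
        show "integrable lborel (\<lambda>w. (e / I) * norm (f w))"
          using f by simp
        fix w
        have "\<bar>K (w - z') - K (w - z)\<bar> \<le> e / I"
          using d(2)[of "w - z'" "w - z"] z' by (simp add: dist_norm norm_minus_commute)
        then show "norm ((K (w - z') - K (w - z)) *\<^sub>R f w) \<le> (e / I) * norm (f w)"
          unfolding norm_scaleR real_norm_def by (rule mult_right_mono[OF _ norm_ge_zero])
      qed
      also have "\<dots> = (e / I) * (LINT w|lborel. norm (f w))" by simp
      also have "\<dots> < (e / I) * I"
        using I \<open>e > 0\<close> by (intro mult_strict_left_mono) auto
      also have "\<dots> = e" using I by simp
      finally show "dist (LINT w|lborel. K (w - z') *\<^sub>R f w) (LINT w|lborel. K (w - z) *\<^sub>R f w) < e" .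
    qed
  qed
qed

text \<open>Mean value inequality for y \<mapsto> K y - g u \<bullet> y on the ball of radius d
  about u, where the derivative g x - g u has norm at most e. Uniform continuity of g makes d
  independent of u, so that the estimate can be integrated.\<close>

lemma uniform_first_order_expansion:
  fixes K :: "'a::euclidean_space \<Rightarrow> real"
  assumes der: "\<And>u. (K has_derivative (\<lambda>h. g u \<bullet> h)) (at u)"
    and g: "uniformly_continuous_on UNIV g" and "e > 0"
  obtains d where "d > 0" "\<And>u h. norm h < d \<Longrightarrow> \<bar>K (u + h) - K u - g u \<bullet> h\<bar> \<le> e * norm h"
proof -
  from g \<open>e > 0\<close> obtain d where d: "d > 0" "\<And>x y. dist y x < d \<Longrightarrow> norm (g y - g x) < e"
    unfolding uniformly_continuous_on_def dist_norm by (metis UNIV_I)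
  have "\<bar>K (u + h) - K u - g u \<bullet> h\<bar> \<le> e * norm h" if h: "norm h < d" for u h
  proof -
    have "norm ((\<lambda>y. K y - g u \<bullet> y) (u + h) - (\<lambda>y. K y - g u \<bullet> y) u) \<le> e * norm (u + h - u)"
    proof (rule differentiable_bound[where S = "ball u d"])
      fix x assume x: "x \<in> ball u d"
      show "((\<lambda>y. K y - g u \<bullet> y) has_derivative (\<lambda>h. (g x - g u) \<bullet> h)) (at x within ball u d)"
        unfolding inner_diff_left by (intro derivative_intros has_derivative_at_withinI[OF der])
      show "onorm (\<lambda>h. (g x - g u) \<bullet> h) \<le> e"
      proof (rule onorm_bound)
        fix h
        have "norm ((g x - g u) \<bullet> h) \<le> norm (g x - g u) * norm h"
          by (simp add: Cauchy_Schwarz_ineq2)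
        also have "\<dots> \<le> e * norm h"
          using d(2)[of x u] x by (intro mult_right_mono) (auto simp: dist_commute)
        finally show "norm ((g x - g u) \<bullet> h) \<le> e * norm h" .
      qed (use \<open>e > 0\<close> in simp)
    qed (use h d in \<open>auto simp: dist_norm\<close>)
    then show ?thesis by (simp add: inner_add_right algebra_simps)
  qed
  with d(1) that show ?thesis by blast
qed

text \<open>The remainder of K is bounded uniformly in the base point, so it integrates against any
  f in L^1. The minus sign appears because z enters the kernel as w - z.\<close>

lemma convolution_has_derivative:
  fixes f :: "'a::euclidean_space \<Rightarrow> 'b::euclidean_space" and K :: "'a \<Rightarrow> real"
  assumes der: "\<And>u. (K has_derivative (\<lambda>h. g u \<bullet> h)) (at u)"
    and g: "continuous_on UNIV g" "\<And>x. norm x > R \<Longrightarrow> g x = 0"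
    and K: "\<And>x. norm x > R \<Longrightarrow> K x = 0" and f: "integrable lborel f"
  shows "((\<lambda>z. LINT w|lborel. K (w - z) *\<^sub>R f w) has_derivative
          (\<lambda>h. LINT w|lborel. (- (g (w - z) \<bullet> h)) *\<^sub>R f w)) (at z)"
proof -
  have cK: "continuous_on UNIV K"
    by (intro continuous_at_imp_continuous_on ballI has_derivative_continuous[OF der])
  obtain B where B: "\<And>x. \<bar>K x\<bar> \<le> B"
    using bounded_bounded_support[OF cK K] by (metis real_norm_def)
  obtain C where C: "C > 0" "\<And>x. norm (g x) \<le> C"
    using bounded_bounded_support[OF g] by metis
  note iK = convolution_integrable[OF cK B f]
  have ig: "integrable lborel (\<lambda>w. (- (g (w - z) \<bullet> h)) *\<^sub>R f w)" for h
  proof (rule convolution_integrable[where K = "\<lambda>u. - (g u \<bullet> h)" and B = "C * norm h"])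
    show "continuous_on UNIV (\<lambda>u. - (g u \<bullet> h))"
      using g(1) by (intro continuous_intros)
    show "\<bar>- (g u \<bullet> h)\<bar> \<le> C * norm h" for u
      using Cauchy_Schwarz_ineq2[of "g u" h] mult_right_mono[OF C(2)[of u], of "norm h"] by simp
  qed (rule f)
  define L where "L = (\<lambda>h. LINT w|lborel. (- (g (w - z) \<bullet> h)) *\<^sub>R f w)"
  define I where "I = (LINT w|lborel. norm (f w))"
  have I: "I \<ge> 0" by (simp add: I_def)
  have "bounded_linear L"
  proof (rule bounded_linear_intro[where K = "C * I"])
    show "L (x + y) = L x + L y" for x y
      unfolding L_def
      by (subst Bochner_Integration.integral_add[symmetric, OF ig ig])
        (simp add: inner_add_right algebra_simps)
    show "L (a *\<^sub>R x) = a *\<^sub>R L x" for a x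
    proof -
      have "L (a *\<^sub>R x) = (LINT w|lborel. a *\<^sub>R ((- (g (w - z) \<bullet> x)) *\<^sub>R f w))"
        unfolding L_def by simp
      then show ?thesis unfolding L_def by (simp only: integral_scaleR_right)
    qed
    show "norm (L x) \<le> norm x * (C * I)" for x
    proof -
      have "norm (L x) \<le> (LINT w|lborel. (C * norm x) * norm (f w))"
        unfolding L_def
      proof (rule Bochner_Integration.integral_norm_bound_integral[OF ig])
        show "norm ((- (g (w - z) \<bullet> x)) *\<^sub>R f w) \<le> (C * norm x) * norm (f w)" for w
          using Cauchy_Schwarz_ineq2[of "g (w - z)" x] mult_right_mono[OF C(2)[of "w - z"], of "norm x"]
          by (simp add: mult_right_mono)
      qed (use f in simp)
      then show ?thesis by (simp add: I_def mult_ac)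
    qed
  qed
  moreover have "\<exists>d>0. \<forall>y. norm (y - z) < d \<longrightarrow>
      norm ((LINT w|lborel. K (w - y) *\<^sub>R f w) - (LINT w|lborel. K (w - z) *\<^sub>R f w) - L (y - z)) \<le> e * norm (y - z)"
    if "e > 0" for e
  proof -
    \<comment> \<open>I is the L^1 norm of f. The estimate will end with the factor I / (I + 1),
      which is at most 1; the added 1 guards against I = 0.\<close>
    have "e / (I + 1) > 0" using I that by simp
    from uniform_first_order_expansion[OF der uniformly_continuous_bounded_support[OF g] this]
    obtain d where d: "d > 0"
      "\<And>u h. norm h < d \<Longrightarrow> \<bar>K (u + h) - K u - g u \<bullet> h\<bar> \<le> (e / (I + 1)) * norm h" by metis
    have "norm ((LINT w|lborel. K (w - y) *\<^sub>R f w) - (LINT w|lborel. K (w - z) *\<^sub>R f w) - L (y - z))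
        \<le> e * norm (y - z)" if y: "norm (y - z) < d" for y
    proof -
      have "(LINT w|lborel. K (w - y) *\<^sub>R f w) - (LINT w|lborel. K (w - z) *\<^sub>R f w) - L (y - z) =
          (LINT w|lborel. K (w - y) *\<^sub>R f w - K (w - z) *\<^sub>R f w - (- (g (w - z) \<bullet> (y - z))) *\<^sub>R f w)"
        unfolding L_def using iK ig
        by (simp only: Bochner_Integration.integral_diff Bochner_Integration.integrable_diff)
      also have "norm \<dots> \<le> (LINT w|lborel. ((e / (I + 1)) * norm (y - z)) * norm (f w))"
      proof (rule Bochner_Integration.integral_norm_bound_integral)
        show "integrable lborel (\<lambda>w. K (w - y) *\<^sub>R f w - K (w - z) *\<^sub>R f w - (- (g (w - z) \<bullet> (y - z))) *\<^sub>R f w)"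
          by (intro Bochner_Integration.integrable_diff iK ig)
        fix w
        have "\<bar>K ((w - z) + (z - y)) - K (w - z) - g (w - z) \<bullet> (z - y)\<bar> \<le> (e / (I + 1)) * norm (z - y)"
          by (rule d(2)) (use y in \<open>simp add: norm_minus_commute\<close>)
        then have *: "\<bar>K (w - y) - K (w - z) - - (g (w - z) \<bullet> (y - z))\<bar> \<le> (e / (I + 1)) * norm (y - z)"
          by (simp add: norm_minus_commute inner_diff_right)
        have "norm (K (w - y) *\<^sub>R f w - K (w - z) *\<^sub>R f w - (- (g (w - z) \<bullet> (y - z))) *\<^sub>R f w) =
            \<bar>K (w - y) - K (w - z) - - (g (w - z) \<bullet> (y - z))\<bar> * norm (f w)"
          by (simp only: norm_scaleR[symmetric] scaleR_diff_left)
        also have "\<dots> \<le> ((e / (I + 1)) * norm (y - z)) * norm (f w)"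
          by (rule mult_right_mono[OF *]) simp
        finally show "norm (K (w - y) *\<^sub>R f w - K (w - z) *\<^sub>R f w - (- (g (w - z) \<bullet> (y - z))) *\<^sub>R f w)
          \<le> ((e / (I + 1)) * norm (y - z)) * norm (f w)" .
      qed (use f in simp)
      also have "\<dots> = (e * norm (y - z)) * (I / (I + 1))"
        by (simp add: I_def)
      also have "\<dots> \<le> (e * norm (y - z)) * 1"
        using I \<open>e > 0\<close> by (intro mult_left_mono) auto
      finally show ?thesis by simp
    qed
    with d(1) show ?thesis by blast
  qed
  ultimately show ?thesis
    unfolding has_derivative_at_alt L_def by blast
qed

subsection \<open>Integration by parts\<close>

lemma
  fixes f :: "'a::euclidean_space \<Rightarrow> 'b::euclidean_space"
  assumes "c \<noteq> 0"
  shows integrable_lborel_affine_iff: "integrable lborel (\<lambda>x. f (t + c *\<^sub>R x)) \<longleftrightarrow> integrable lborel f"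
    and integral_lborel_affine: "f \<in> borel_measurable borel \<Longrightarrow>
      (LINT x|lborel. f x) = \<bar>c\<bar> ^ DIM('a) *\<^sub>R (LINT x|lborel. f (t + c *\<^sub>R x))"
proof -
  have *: "integrable lborel (\<lambda>x. f (t + c *\<^sub>R x))" if f: "integrable lborel f" and c: "c \<noteq> 0"
    for f :: "'a \<Rightarrow> 'b" and t c
  proof -
    have [measurable]: "f \<in> borel_measurable borel" using f by auto
    have "integrable (density (distr lborel borel (\<lambda>x. t + c *\<^sub>R x)) (\<lambda>_. \<bar>c\<bar> ^ DIM('a))) f"
      using f lborel_affine[OF c, of t] by simp
    then show ?thesis
      using c integrable_scaleR_right[of "inverse (\<bar>c\<bar> ^ DIM('a))" lborel "\<lambda>x. \<bar>c\<bar> ^ DIM('a) *\<^sub>R f (t + c *\<^sub>R x)"]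
      by (simp add: integrable_density integrable_distr_eq)
  qed
  show "integrable lborel (\<lambda>x. f (t + c *\<^sub>R x)) \<longleftrightarrow> integrable lborel f"
  proof
    assume "integrable lborel (\<lambda>x. f (t + c *\<^sub>R x))"
    from *[OF this, of "inverse c" "- inverse c *\<^sub>R t"] assms
    show "integrable lborel f"
      by (simp add: scaleR_diff_right)
  qed (rule *[OF _ assms])
  assume [measurable]: "f \<in> borel_measurable borel"
  have "(LINT x|lborel. f x) = (LINT x|density (distr lborel borel (\<lambda>x. t + c *\<^sub>R x)) (\<lambda>_. \<bar>c\<bar> ^ DIM('a)). f x)"
    using lborel_affine[OF assms, of t] by simp
  then show "(LINT x|lborel. f x) = \<bar>c\<bar> ^ DIM('a) *\<^sub>R (LINT x|lborel. f (t + c *\<^sub>R x))"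
    by (simp add: integral_density integral_distr)
qed

lemma directional_mean_value:
  fixes P :: "'a::real_normed_vector \<Rightarrow> real"
  assumes "\<And>x. (P has_derivative P' x) (at x)" and "t > 0"
  obtains s where "0 < s" "s < t" "P (x + t *\<^sub>R v) - P x = t * P' (x + s *\<^sub>R v) v"
proof -
  have "((\<lambda>s. P (x + s *\<^sub>R v)) has_real_derivative P' (x + s *\<^sub>R v) v) (at s)" for s
  proof -
    have "((\<lambda>s. P (x + s *\<^sub>R v)) has_derivative (\<lambda>h. P' (x + s *\<^sub>R v) (h *\<^sub>R v))) (at s)"
      by (rule has_derivative_compose[OF _ assms(1)]) (auto intro!: derivative_eq_intros)
    moreover have "P' (x + s *\<^sub>R v) (h *\<^sub>R v) = P' (x + s *\<^sub>R v) v * h" for h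
      using linear_cmul[OF has_derivative_linear[OF assms(1)]] by (simp add: mult.commute)
    ultimately show ?thesis by (simp add: has_field_derivative_def)
  qed
  with MVT2[of 0 t "\<lambda>s. P (x + s *\<^sub>R v)" "\<lambda>s. P' (x + s *\<^sub>R v) v"] assms(2)
  obtain s where "0 < s" "s < t" "P (x + t *\<^sub>R v) - P (x + 0 *\<^sub>R v) = (t - 0) * P' (x + s *\<^sub>R v) v"
    by metis
  with that show ?thesis by simp
qed

text \<open>By translation invariance each difference quotient of P integrates to 0, and the
  quotients converge to the derivative. The mean value theorem bounds them by B on one ball that
  contains all translated supports; this is the dominating function.\<close>

lemma integral_directional_derivative_eq_0:
  fixes P :: "'a::euclidean_space \<Rightarrow> real"
  assumes der: "\<And>x. (P has_derivative P' x) (at x)"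
    and cont: "continuous_on UNIV (\<lambda>x. P' x v)"
    and zero: "\<And>x. norm x > R \<Longrightarrow> P x = 0"
  shows "(LINT x|lborel. P' x v) = 0"
proof -
  have "P' x = (\<lambda>_. 0)" if "norm x > R" for x
    by (rule has_derivative_0_open[OF der, of "- cball 0 R"]) (use that zero in auto)
  then obtain B where B: "B > 0" "\<And>x. \<bar>P' x v\<bar> \<le> B"
    using bounded_bounded_support[OF cont, of R] by (metis real_norm_def)
  have cP: "continuous_on UNIV P"
    by (intro continuous_at_imp_continuous_on ballI has_derivative_continuous[OF der])
  have iP: "integrable lborel P"
    using cP zero by (rule integrable_continuous_bounded_support)
  \<comment> \<open>Steps of length at most 1 move the support by at most
    \<open>norm v\<close>.\<close>
  define t where "t n = inverse (real (Suc n))" for n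
  have t: "t n > 0" "t n \<le> 1" for n by (auto simp: t_def field_simps)
  define q where "q n x = (P (x + t n *\<^sub>R v) - P x) / t n" for n x
  have "(\<lambda>n. LINT x|lborel. q n x) \<longlonglongrightarrow> (LINT x|lborel. P' x v)"
  proof (rule integral_dominated_convergence[where w = "\<lambda>x. B * indicator (cball 0 (R + norm v)) x"])
    show "(\<lambda>x. P' x v) \<in> borel_measurable lborel"
      using cont by (simp add: borel_measurable_continuous_onI)
    have [measurable]: "P \<in> borel_measurable borel"
      using cP by (rule borel_measurable_continuous_onI)
    show "q n \<in> borel_measurable lborel" for n
      unfolding q_def by measurable
    show "integrable lborel (\<lambda>x::'a. B * indicator (cball 0 (R + norm v)) x :: real)"
      using emeasure_lborel_cball_finite[of "0::'a" "R + norm v"] by (simp add: integrable_indicator_iff)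
    show "AE x in lborel. (\<lambda>n. q n x) \<longlonglongrightarrow> P' x v"
    proof (rule AE_I2)
      fix x
      have "((\<lambda>s. P (x + s *\<^sub>R v)) has_derivative (\<lambda>h. P' (x + 0 *\<^sub>R v) (h *\<^sub>R v))) (at 0)"
        by (rule has_derivative_compose[OF _ der]) (auto intro!: derivative_eq_intros)
      moreover have "P' x (h *\<^sub>R v) = P' x v * h" for h
        using linear_cmul[OF has_derivative_linear[OF der]] by (simp add: mult.commute)
      ultimately have "((\<lambda>s. P (x + s *\<^sub>R v)) has_real_derivative P' x v) (at 0)"
        by (simp add: has_field_derivative_def)
      then have "((\<lambda>s. (P (x + s *\<^sub>R v) - P x) / s) \<longlongrightarrow> P' x v) (at 0)"
        by (simp add: DERIV_def)
      moreover have "filterlim t (at 0) sequentially"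
        unfolding filterlim_at t_def using LIMSEQ_inverse_real_of_nat by simp
      ultimately show "(\<lambda>n. q n x) \<longlonglongrightarrow> P' x v"
        unfolding q_def by (rule filterlim_compose)
    qed
    show "AE x in lborel. norm (q n x) \<le> B * indicator (cball 0 (R + norm v)) x" for n
    proof (rule AE_I2)
      fix x
      obtain s where s: "P (x + t n *\<^sub>R v) - P x = t n * P' (x + s *\<^sub>R v) v"
        using directional_mean_value[OF der t(1)] by metis
      have "P (x + t n *\<^sub>R v) = 0 \<and> P x = 0" if "norm x > R + norm v"
      proof -
        have "norm (x + t n *\<^sub>R v) \<ge> norm x - norm (t n *\<^sub>R v)"
          by (rule norm_diff_ineq)
        moreover have "norm (t n *\<^sub>R v) \<le> norm v"
          using t[of n] by (simp add: mult_left_le_one_le)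
        ultimately show ?thesis
          using that by (intro conjI zero) (use norm_ge_zero[of v] in linarith)+
      qed
      with s B t[of n] show "norm (q n x) \<le> B * indicator (cball 0 (R + norm v)) x"
        by (cases "norm x > R + norm v") (auto simp: q_def indicator_def)
    qed
  qed
  moreover have "(LINT x|lborel. q n x) = 0" for n
  proof -
    have "integrable lborel (\<lambda>x. P (x + t n *\<^sub>R v))"
      using integrable_lborel_affine_iff[of 1 P "t n *\<^sub>R v"] iP by (simp add: add.commute)
    moreover have "(LINT x|lborel. P (x + t n *\<^sub>R v)) = (LINT x|lborel. P x)"
      using integral_lborel_affine[of 1 P "t n *\<^sub>R v"] iP by (simp add: add.commute)
    ultimately show ?thesis
      using iP by (simp add: q_def)
  qed
  ultimately show ?thesis
    by (simp add: LIMSEQ_const_iff)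
qed

text \<open>Continuity is checked on the open cover consisting of D and the complement of K; on the
  latter the function is 0.\<close>

lemma continuous_on_extend_by_0:
  fixes a :: "'a::topological_space \<Rightarrow> 'b::real_normed_vector"
  assumes "open D" "continuous_on D a" "closed K" "K \<subseteq> D" "\<And>x. x \<in> D - K \<Longrightarrow> a x = 0"
  shows "continuous_on UNIV (\<lambda>x. if x \<in> D then a x else 0)"
proof -
  have "continuous_on (D \<union> - K) (\<lambda>x. if x \<in> D then a x else 0)"
  proof (rule continuous_on_open_Un)
    show "continuous_on D (\<lambda>x. if x \<in> D then a x else 0)"
      using assms(2) by (simp cong: continuous_on_cong_simp)
    show "continuous_on (- K) (\<lambda>x. if x \<in> D then a x else 0)"
      using assms(5) by (subst continuous_on_cong[OF refl, where g = "\<lambda>_. 0"]) auto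
  qed (use assms in auto)
  moreover have "D \<union> - K = UNIV" using assms(4) by auto
  ultimately show ?thesis by simp
qed

lemma integral_lebesgue_on_continuous:
  fixes a :: "'a::euclidean_space \<Rightarrow> real"
  assumes "open D" "continuous_on D a" "compact K" "K \<subseteq> D" "\<And>x. x \<in> D - K \<Longrightarrow> a x = 0"
  shows "integrable lborel (\<lambda>x. if x \<in> D then a x else 0)"
    and "integrable (lebesgue_on D) a"
    and "(LINT x|lebesgue_on D. a x) = (LINT x|lborel. (if x \<in> D then a x else 0))"
proof -
  let ?a = "\<lambda>x. if x \<in> D then a x else 0"
  have cont: "continuous_on UNIV ?a"
    using assms compact_imp_closed by (intro continuous_on_extend_by_0) auto
  obtain R where R: "\<And>x. x \<in> K \<Longrightarrow> norm x \<le> R"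
    using compact_imp_bounded[OF \<open>compact K\<close>] by (auto simp: bounded_iff)
  show int: "integrable lborel ?a"
    using cont by (rule integrable_continuous_bounded_support[where R = R]) (use R assms(4,5) in force)
  then have m: "?a \<in> borel_measurable lborel" by auto
  have D: "D \<in> sets lebesgue" using \<open>open D\<close> by auto
  show "integrable (lebesgue_on D) a"
    unfolding integrable_lebesgue_on_if[OF D] using int m by (simp add: integrable_completion)
  show "(LINT x|lebesgue_on D. a x) = (LINT x|lborel. ?a x)"
    unfolding integral_lebesgue_on_if[OF D] using m by (simp add: integral_completion)
qed

text \<open>U is differentiable only on D, but the product of U and \<psi>, extended by zero, is
  differentiable everywhere, since D and the complement of the support of \<psi> cover the space.
  Its directional derivative is given by the product rule and has integral 0.\<close>

lemma integration_by_parts: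
  fixes U \<psi> :: "'a::euclidean_space \<Rightarrow> real"
  assumes "open D"
    and U: "\<And>x. x \<in> D \<Longrightarrow> (U has_derivative U' x) (at x)" "continuous_on D (\<lambda>x. U' x v)"
    and \<psi>: "\<And>x. (\<psi> has_derivative \<psi>' x) (at x)" "continuous_on UNIV (\<lambda>x. \<psi>' x v)"
    and K: "compact (closure {x. \<psi> x \<noteq> 0})" "closure {x. \<psi> x \<noteq> 0} \<subseteq> D"
  shows "integrable (lebesgue_on D) (\<lambda>x. U x * \<psi>' x v)"
    and "integrable (lebesgue_on D) (\<lambda>x. U' x v * \<psi> x)"
    and "(LINT x|lebesgue_on D. U x * \<psi>' x v) = - (LINT x|lebesgue_on D. U' x v * \<psi> x)"
proof -
  define K where "K = closure {x. \<psi> x \<noteq> 0}"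
  note K = K[folded K_def]
  have "closed K" by (simp add: K_def)
  have \<psi>0: "\<psi> x = 0" if "x \<notin> K" for x
    using that closure_subset[of "{x. \<psi> x \<noteq> 0}"] by (auto simp: K_def)
  have \<psi>'0: "\<psi>' x = (\<lambda>_. 0)" if "x \<notin> K" for x
    by (rule has_derivative_0_open[OF \<psi>(1), of "- K"]) (use that \<psi>0 \<open>closed K\<close> in auto)
  have cU: "continuous_on D U"
    by (intro continuous_at_imp_continuous_on ballI has_derivative_continuous[OF U(1)])
  have c\<psi>: "continuous_on D \<psi>"
    by (intro continuous_at_imp_continuous_on ballI has_derivative_continuous[OF \<psi>(1)])
  have c\<psi>': "continuous_on D (\<lambda>x. \<psi>' x v)"
    using \<psi>(2) continuous_on_subset by blast
  have c1: "continuous_on D (\<lambda>x. U x * \<psi>' x v)" and c2: "continuous_on D (\<lambda>x. U' x v * \<psi> x)"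
    using U(2) cU c\<psi> c\<psi>' by (auto intro: continuous_intros)
  note 1 = integral_lebesgue_on_continuous[OF \<open>open D\<close> c1 K] and
    2 = integral_lebesgue_on_continuous[OF \<open>open D\<close> c2 K]
  show "integrable (lebesgue_on D) (\<lambda>x. U x * \<psi>' x v)" by (rule 1) (simp add: \<psi>'0)
  show "integrable (lebesgue_on D) (\<lambda>x. U' x v * \<psi> x)" by (rule 2) (simp add: \<psi>0)
  define P where "P x = (if x \<in> D then U x * \<psi> x else 0)" for x
  define P' where "P' x h = (if x \<in> D then U x * \<psi>' x h + U' x h * \<psi> x else 0)" for x h
  have der: "(P has_derivative P' x) (at x)" for x
  proof (cases "x \<in> D")
    case True
    have "((\<lambda>x. U x * \<psi> x) has_derivative P' x) (at x)"
      unfolding P'_def using True by (simp add: has_derivative_mult[OF U(1) \<psi>(1)])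
    then show ?thesis
      by (rule has_derivative_transform_within_open[OF _ \<open>open D\<close> True]) (simp add: P_def)
  next
    case False
    then have "x \<in> - K" using K(2) by auto
    have "((\<lambda>_. 0) has_derivative P' x) (at x)"
      unfolding P'_def using False by simp
    then show ?thesis
      by (rule has_derivative_transform_within_open[OF _ _ \<open>x \<in> - K\<close>]) (use \<open>closed K\<close> in \<open>auto simp: P_def \<psi>0\<close>)
  qed
  have P'_eq: "P' x v = (if x \<in> D then U x * \<psi>' x v else 0) + (if x \<in> D then U' x v * \<psi> x else 0)" for x
    by (simp add: P'_def)
  have "continuous_on UNIV (\<lambda>x. P' x v)"
    unfolding P'_eq using \<psi>0 \<psi>'0 K
    by (intro continuous_on_add continuous_on_extend_by_0[OF \<open>open D\<close> _ \<open>closed K\<close>])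
      (auto intro: c1 c2)
  moreover obtain R where R: "\<And>x. x \<in> K \<Longrightarrow> norm x \<le> R"
    using compact_imp_bounded[OF K(1)] by (auto simp: bounded_iff)
  have "P x = 0" if "norm x > R" for x
    using \<psi>0[of x] R[of x] that by (auto simp: P_def)
  ultimately have "(LINT x|lborel. P' x v) = 0"
    using integral_directional_derivative_eq_0[of P P' v R] der by blast
  then have "(LINT x|lborel. (if x \<in> D then U x * \<psi>' x v else 0)) +
      (LINT x|lborel. (if x \<in> D then U' x v * \<psi> x else 0)) = 0"
    unfolding P'_eq
    by (subst (asm) Bochner_Integration.integral_add) (auto intro!: 1 2 simp: \<psi>0 \<psi>'0)
  then show "(LINT x|lebesgue_on D. U x * \<psi>' x v) = - (LINT x|lebesgue_on D. U' x v * \<psi> x)"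
    using 1(3) 2(3) by (simp add: \<psi>0 \<psi>'0)
qed

subsection \<open>Mollification\<close>

definition mol_kernel :: "real \<Rightarrow> 'a::euclidean_space \<Rightarrow> real" where
  "mol_kernel \<epsilon> u = kernel (u /\<^sub>R \<epsilon>) / \<epsilon> ^ DIM('a)"

text \<open>The centre z is the parameter and w the integration variable, so that a value of
  \<open>mol\<close> reads as f tested against a translate of the kernel. The kernel being even,
  this is the usual convolution.\<close>

definition mol :: "real \<Rightarrow> ('a::euclidean_space \<Rightarrow> 'b::euclidean_space) \<Rightarrow> 'a \<Rightarrow> 'b" where
  "mol \<epsilon> f z = (LINT w|lborel. mol_kernel \<epsilon> (w - z) *\<^sub>R f w)"

lemma kernel_const_pos: "kernel_const TYPE('a::euclidean_space) > 0"
proof -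
  have "kernel_const TYPE('a) \<noteq> 0"
    using integral_kernel[where 'a = 'a] by (auto simp: kernel_def)
  moreover have "kernel_const TYPE('a) \<ge> 0"
    by (auto simp: kernel_const_def bump_bounds)
  ultimately show ?thesis by simp
qed

lemma kernel_nonneg: "kernel y \<ge> 0"
  by (simp add: kernel_def bump_bounds less_imp_le[OF kernel_const_pos])

lemma kernel_eq_0_iff: "kernel (y :: 'a::euclidean_space) = 0 \<longleftrightarrow> norm y \<ge> 1"
  using kernel_const_pos[where 'a = 'a] by (auto simp: kernel_def bump_def)

lemma kernel_measurable [measurable]: "kernel \<in> borel_measurable borel"
  unfolding kernel_def by measurable

context
  fixes \<epsilon> :: real
  assumes \<epsilon>: "\<epsilon> > 0"
begin

lemma mol_kernel_nonneg: "mol_kernel \<epsilon> u \<ge> 0"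
  using \<epsilon> by (simp add: mol_kernel_def kernel_nonneg)

lemma mol_kernel_eq_0_iff: "mol_kernel \<epsilon> u = 0 \<longleftrightarrow> norm u \<ge> \<epsilon>"
  using \<epsilon> by (simp add: mol_kernel_def kernel_eq_0_iff field_simps)

lemma mol_kernel_commute: "mol_kernel \<epsilon> (x - y) = mol_kernel \<epsilon> (y - x)"
  using \<epsilon> by (simp add: mol_kernel_def kernel_def bump_def norm_minus_commute)

text \<open>Both descriptions switch off at the same place: norm y < 1 in \<open>bump\<close> is
  positivity of the argument 1 - |y|^2 of \<open>flat_exp 0\<close>.\<close>

lemma bump_algebra_mol_kernel:
  "bump_algebra (inverse \<epsilon> ^ 2) a (\<lambda>w :: 'a::euclidean_space. mol_kernel \<epsilon> (w - a))"
proof -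
  have "bump ((w - a) /\<^sub>R \<epsilon>) = flat_exp 0 (1 - inverse \<epsilon> ^ 2 * ((w - a) \<bullet> (w - a)))" for w :: 'a
  proof -
    have *: "(norm ((w - a) /\<^sub>R \<epsilon>))\<^sup>2 = inverse \<epsilon> ^ 2 * ((w - a) \<bullet> (w - a))"
      by (simp add: power_mult_distrib power2_norm_eq_inner power_inverse)
    have "norm ((w - a) /\<^sub>R \<epsilon>) < 1 \<longleftrightarrow> 0 < 1 - (norm ((w - a) /\<^sub>R \<epsilon>))\<^sup>2"
      by (metis abs_norm_cancel abs_square_less_1 diff_gt_0_iff_gt)
    then show ?thesis
      unfolding *[symmetric] by (simp only: bump_def flat_exp_def) (simp add: divide_inverse)
  qed
  then have "(\<lambda>w. mol_kernel \<epsilon> (w - a)) = (\<lambda>w. (kernel_const TYPE('a) / \<epsilon> ^ DIM('a)) *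
      flat_exp 0 (1 - inverse \<epsilon> ^ 2 * ((w - a) \<bullet> (w - a))))"
    by (auto simp: mol_kernel_def kernel_def)
  moreover have "bump_algebra (inverse \<epsilon> ^ 2) a \<dots>"
    by (intro bump_algebra.intros)
  ultimately show ?thesis by simp
qed

lemma smooth_mol_kernel: "smooth (\<lambda>w. mol_kernel \<epsilon> (w - a))"
  by (rule smooth_bump_algebra[OF bump_algebra_mol_kernel])

lemma mol_kernel_measurable [measurable]: "mol_kernel \<epsilon> \<in> borel_measurable borel"
  unfolding mol_kernel_def by measurable

lemma mol_kernel_continuous: "continuous_on UNIV (mol_kernel \<epsilon>)"
  using smooth_continuous_on[OF smooth_mol_kernel[of 0]] by simp

lemma mol_kernel_bounded:
  obtains B where "B > 0" "\<And>u :: 'a::euclidean_space. \<bar>mol_kernel \<epsilon> u\<bar> \<le> B"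
proof -
  have "mol_kernel \<epsilon> u = 0" if "norm u > \<epsilon>" for u :: 'a
    using that by (simp add: mol_kernel_eq_0_iff)
  from bounded_bounded_support[OF mol_kernel_continuous this] that show ?thesis
    by (metis real_norm_def)
qed

text \<open>The kernel is positive on the open ball only, but the support of a test function is a
  closure: this is why closed balls have to fit into D.\<close>

lemma test_function_mol_kernel:
  assumes "cball a \<epsilon> \<subseteq> D"
  shows "test_function D (\<lambda>w. mol_kernel \<epsilon> (w - a) *\<^sub>R e)"
proof -
  have "{w. mol_kernel \<epsilon> (w - a) *\<^sub>R e \<noteq> 0} \<subseteq> cball a \<epsilon>"
    by (auto simp: mol_kernel_eq_0_iff dist_norm norm_minus_commute)
  then have "closure {w. mol_kernel \<epsilon> (w - a) *\<^sub>R e \<noteq> 0} \<subseteq> cball a \<epsilon>"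
    and "compact (closure {w. mol_kernel \<epsilon> (w - a) *\<^sub>R e \<noteq> 0})"
    by (simp_all only: closure_minimal closed_cball compact_closure bounded_subset[OF bounded_cball])
  with assms smooth_scaleR_const[OF smooth_mol_kernel] show ?thesis
    unfolding test_function_def by blast
qed

text \<open>The gradient of the kernel as a vector, giving its derivative the inner product form in
  which \<open>convolution_has_derivative\<close> takes it.\<close>

definition mol_grad :: "'a::euclidean_space \<Rightarrow> 'a" where
  "mol_grad u = (\<Sum>b\<in>Basis. frechet_derivative (mol_kernel \<epsilon>) (at u) b *\<^sub>R b)"

lemma smooth_mol_kernel_0: "smooth (mol_kernel \<epsilon>)"
  using smooth_mol_kernel[of 0] by simp

lemma mol_kernel_has_derivative: "(mol_kernel \<epsilon> has_derivative (\<lambda>h. mol_grad u \<bullet> h)) (at u)"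
proof -
  let ?F = "frechet_derivative (mol_kernel \<epsilon>) (at u)"
  have F: "(mol_kernel \<epsilon> has_derivative ?F) (at u)"
    by (rule smooth_has_derivative[OF smooth_mol_kernel_0])
  have "?F h = mol_grad u \<bullet> h" for h
  proof -
    note F' = has_derivative_linear[OF F]
    have "?F h = ?F (\<Sum>b\<in>Basis. (h \<bullet> b) *\<^sub>R b)" by (simp add: euclidean_representation)
    also have "\<dots> = (\<Sum>b\<in>Basis. (h \<bullet> b) * ?F b)"
      by (simp only: linear_sum[OF F'] linear_scale[OF F'] real_scaleR_def)
    also have "\<dots> = mol_grad u \<bullet> h"
      by (simp add: mol_grad_def inner_sum_left inner_commute[of h] mult.commute)
    finally show ?thesis .
  qed
  then have "?F = (\<lambda>h. mol_grad u \<bullet> h)" by (rule ext)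
  with F show ?thesis by metis
qed

lemma mol_grad_continuous: "continuous_on UNIV mol_grad"
  unfolding mol_grad_def
  by (intro continuous_on_sum continuous_on_scaleR continuous_on_const
      smooth_continuous_on smooth_directional smooth_mol_kernel_0)

lemma mol_grad_eq_0: "norm u > \<epsilon> \<Longrightarrow> mol_grad u = 0"
  using has_derivative_0_open[OF mol_kernel_has_derivative, of "- cball 0 \<epsilon>" u]
  by (auto simp: mol_kernel_eq_0_iff fun_eq_iff not_le)

lemma mol_integrable:
  fixes f :: "'a::euclidean_space \<Rightarrow> 'b::euclidean_space"
  shows "integrable lborel f \<Longrightarrow> integrable lborel (\<lambda>w. mol_kernel \<epsilon> (w - z) *\<^sub>R f w)"
  by (metis convolution_integrable mol_kernel_bounded mol_kernel_continuous)

lemma mol_has_derivative: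
  fixes f :: "'a::euclidean_space \<Rightarrow> 'b::euclidean_space"
  shows "integrable lborel f \<Longrightarrow>
    (mol \<epsilon> f has_derivative (\<lambda>h. LINT w|lborel. (- (mol_grad (w - z) \<bullet> h)) *\<^sub>R f w)) (at z)"
  unfolding mol_def[abs_def]
  by (rule convolution_has_derivative[OF mol_kernel_has_derivative mol_grad_continuous, of \<epsilon>])
    (auto simp: mol_grad_eq_0 mol_kernel_eq_0_iff)

lemma mol_derivative_continuous:
  fixes f :: "'a::euclidean_space \<Rightarrow> 'b::euclidean_space"
  shows "integrable lborel f \<Longrightarrow>
    continuous_on UNIV (\<lambda>z. LINT w|lborel. (- (mol_grad (w - z) \<bullet> h)) *\<^sub>R f w)"
  by (rule convolution_continuous[where K = "\<lambda>u. - (mol_grad u \<bullet> h)" and R = \<epsilon>])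
    (auto intro!: continuous_intros mol_grad_continuous simp: mol_grad_eq_0)

lemma mol_continuous:
  fixes f :: "'a::euclidean_space \<Rightarrow> 'b::euclidean_space"
  shows "integrable lborel f \<Longrightarrow> continuous_on UNIV (mol \<epsilon> f)"
  by (intro continuous_at_imp_continuous_on ballI has_derivative_continuous[OF mol_has_derivative])

lemma has_bochner_integral_mol_kernel:
  "has_bochner_integral lborel (\<lambda>w :: 'a::euclidean_space. mol_kernel \<epsilon> (w - z)) 1"
proof -
  have "(LINT w|lborel. mol_kernel \<epsilon> (w - z)) = \<bar>\<epsilon>\<bar> ^ DIM('a) *\<^sub>R (LINT y|lborel. mol_kernel \<epsilon> (z + \<epsilon> *\<^sub>R y - z))"
    using \<epsilon> by (intro integral_lborel_affine) auto
  also have "\<dots> = (LINT y|lborel. kernel (y :: 'a))"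
    using \<epsilon> by (simp add: mol_kernel_def)
  also have "\<dots> = 1"
    using integral_kernel[where 'a = 'a] by (simp add: integral_completion)
  finally have "(LINT w|lborel. mol_kernel \<epsilon> (w - z)) = 1" .
  \<comment> \<open>A non-integrable function has integral 0 by convention, so the value 1 forces
    integrability.\<close>
  then show ?thesis
    by (metis has_bochner_integral_iff not_integrable_integral_eq zero_neq_one)
qed

text \<open>Substitution w = z + \<epsilon>y. For y in the unit ball the argument stays in D, where
  h and f agree up to a null set; for other y the kernel is 0, so the integrals over the ball and
  over the space coincide.\<close>

lemma
  fixes f h :: "'a::euclidean_space \<Rightarrow> 'b::euclidean_space"
  assumes h: "integrable lborel h" and ae: "AE w in lborel. w \<in> D \<longrightarrow> h w = f w" and D: "ball z \<epsilon> \<subseteq> D"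
  shows kernel_integral_eq_mol: "(LINT y|lebesgue_on (ball 0 1). kernel y *\<^sub>R f (z + \<epsilon> *\<^sub>R y)) = mol \<epsilon> h z"
    and kernel_integrable: "integrable (lebesgue_on (ball 0 1)) (\<lambda>y. kernel y *\<^sub>R f (z + \<epsilon> *\<^sub>R y))"
proof -
  let ?g = "\<lambda>y. kernel y *\<^sub>R h (z + \<epsilon> *\<^sub>R y)"
  let ?f = "\<lambda>y. if y \<in> ball 0 1 then kernel y *\<^sub>R f (z + \<epsilon> *\<^sub>R y) else 0"
  have [measurable]: "h \<in> borel_measurable borel" using h by auto
  have eq: "mol_kernel \<epsilon> (z + \<epsilon> *\<^sub>R y - z) *\<^sub>R h (z + \<epsilon> *\<^sub>R y) = inverse (\<epsilon> ^ DIM('a)) *\<^sub>R ?g y" for y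
    using \<epsilon> by (simp add: mol_kernel_def divide_inverse mult.commute)
  have "integrable lborel (\<lambda>y. mol_kernel \<epsilon> (z + \<epsilon> *\<^sub>R y - z) *\<^sub>R h (z + \<epsilon> *\<^sub>R y))"
    using integrable_lborel_affine_iff[of \<epsilon> "\<lambda>w. mol_kernel \<epsilon> (w - z) *\<^sub>R h w" z] \<epsilon> mol_integrable[OF h] by simp
  then have "integrable lborel (\<lambda>y. \<epsilon> ^ DIM('a) *\<^sub>R (inverse (\<epsilon> ^ DIM('a)) *\<^sub>R ?g y))"
    unfolding eq by (rule integrable_scaleR_right)
  then have int: "integrable lborel ?g" using \<epsilon> by (simp add: mult.assoc[symmetric])
  have "mol \<epsilon> h z = \<bar>\<epsilon>\<bar> ^ DIM('a) *\<^sub>R (LINT y|lborel. mol_kernel \<epsilon> (z + \<epsilon> *\<^sub>R y - z) *\<^sub>R h (z + \<epsilon> *\<^sub>R y))"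
    unfolding mol_def using \<epsilon> by (intro integral_lborel_affine) auto
  also have "\<dots> = (LINT y|lborel. ?g y)"
    unfolding eq integral_scaleR_right using \<epsilon> by simp
  finally have mol: "mol \<epsilon> h z = (LINT y|lborel. ?g y)" .
  \<comment> \<open>Writing \<open>lborel\<close> as a scaled image of itself under y \<mapsto> z +
    \<epsilon>y transports the exceptional null set from w to y.\<close>
  have "AE w in density (distr lborel borel (\<lambda>x. z + \<epsilon> *\<^sub>R x)) (\<lambda>_. \<bar>\<epsilon>\<bar> ^ DIM('a)). w \<in> D \<longrightarrow> h w = f w"
    using ae \<epsilon> by (subst lborel_affine[of \<epsilon> z, symmetric]) auto
  then have "AE w in distr lborel borel (\<lambda>x. z + \<epsilon> *\<^sub>R x). w \<in> D \<longrightarrow> h w = f w"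
    using \<epsilon> by (subst (asm) AE_density) auto
  then have "AE y in lborel. z + \<epsilon> *\<^sub>R y \<in> D \<longrightarrow> h (z + \<epsilon> *\<^sub>R y) = f (z + \<epsilon> *\<^sub>R y)"
    by (rule AE_distrD[rotated]) measurable
  moreover have "z + \<epsilon> *\<^sub>R y \<in> D" if "y \<in> ball 0 1" for y
    using that D \<epsilon> by (auto simp: dist_norm)
  ultimately have "AE y in lborel. ?g y = ?f y"
    by (auto elim!: eventually_mono simp: kernel_eq_0_iff)
  note f = integrable_lebesgue_AE[OF int this] integral_lebesgue_AE[OF int this]
  show "(LINT y|lebesgue_on (ball 0 1). kernel y *\<^sub>R f (z + \<epsilon> *\<^sub>R y)) = mol \<epsilon> h z"
    unfolding mol using f(2) by (subst integral_lebesgue_on_if) auto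
  show "integrable (lebesgue_on (ball 0 1)) (\<lambda>y. kernel y *\<^sub>R f (z + \<epsilon> *\<^sub>R y))"
    using f(1) by (subst integrable_lebesgue_on_if) auto
qed

end

text \<open>A real Lebesgue measurable function agrees with a Borel one off a null set. The
  coordinates are treated one by one, and the union of finitely many null sets is null.\<close>

lemma borel_representative:
  fixes f :: "'a::euclidean_space \<Rightarrow> 'b::euclidean_space"
  assumes D: "D \<in> sets borel" and f: "f \<in> borel_measurable (lebesgue_on D)"
  obtains h where "h \<in> borel_measurable borel" "AE x in lborel. x \<in> D \<longrightarrow> h x = f x" "\<And>x. x \<notin> D \<Longrightarrow> h x = 0"
proof -
  note D[measurable]
  let ?f = "\<lambda>x. if x \<in> D then f x else 0"
  have m: "?f \<in> borel_measurable lebesgue"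
    using D f by (intro borel_measurable_if_I) auto
  have "\<exists>g. g \<in> borel_measurable lborel \<and> (AE x in lborel. ?f x \<bullet> b = g x)" for b
    using completion_ex_borel_measurable_real[of "\<lambda>x. ?f x \<bullet> b" lborel] m by auto
  then have "\<forall>b. \<exists>g. g \<in> borel_measurable lborel \<and> (AE x in lborel. ?f x \<bullet> b = g x)" by blast
  from choice[OF this]
  obtain g where g: "\<And>b. g b \<in> borel_measurable borel" "\<And>b. AE x in lborel. ?f x \<bullet> b = g b x"
    by auto
  note g(1)[measurable]
  define h where "h x = (if x \<in> D then \<Sum>b\<in>Basis. g b x *\<^sub>R b else 0)" for x
  show ?thesis
  proof
    show "h \<in> borel_measurable borel" unfolding h_def by measurable
    have "AE x in lborel. \<forall>b\<in>Basis. ?f x \<bullet> b = g b x"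
      using g(2) by (intro AE_finite_allI) auto
    then show "AE x in lborel. x \<in> D \<longrightarrow> h x = f x"
    proof eventually_elim
      case (elim x)
      show ?case
      proof
        assume "x \<in> D"
        with elim have "(\<Sum>b\<in>Basis. g b x *\<^sub>R b) = (\<Sum>b\<in>Basis. (f x \<bullet> b) *\<^sub>R b)"
          by (intro sum.cong) auto
        with \<open>x \<in> D\<close> show "h x = f x" by (simp add: h_def euclidean_representation)
      qed
    qed
  qed (simp add: h_def)
qed

subsection \<open>Convergence of mollifications in \<open>L\<^sup>p\<close>\<close>

text \<open>Convexity of t \<mapsto> t^p places the graph above its tangents on the open half-line.
  The endpoint is separate; for a = 0 the convention that \<open>0 powr 0\<close> is 0 makes the
  left side vanish, also when p = 1.\<close>

lemma powr_ge_tangent: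
  fixes a t p :: real
  assumes "a \<ge> 0" "t \<ge> 0" "p \<ge> 1"
  shows "a powr p + p * a powr (p - 1) * (t - a) \<le> t powr p"
proof (cases "a = 0 \<or> t = 0")
  case True
  then show ?thesis
  proof
    assume "t = 0"
    have "a powr (p - 1) * a = a powr p"
      using powr_mult_base[of a "p - 1"] assms by (simp add: mult.commute)
    then have "a powr p + p * a powr (p - 1) * (0 - a) = (1 - p) * a powr p"
      by (simp add: algebra_simps)
    also have "\<dots> \<le> 0" using assms by (simp add: mult_nonpos_nonneg)
    finally show ?thesis using \<open>t = 0\<close> by simp
  qed auto
next
  case False
  then have pos: "a > 0" "t > 0" using assms by auto
  have "t powr p - a powr p \<ge> (p * a powr (p - 1)) * (t - a)"
    using pos powr_convex[OF \<open>p \<ge> 1\<close>]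
    by (intro convex_on_imp_above_tangent[where A = "{0<..}"])
      (auto intro!: derivative_eq_intros simp: interior_open)
  then show ?thesis by simp
qed

lemma norm_add_powr_le:
  fixes a b :: "'a::real_normed_vector"
  assumes "p \<ge> 0"
  shows "norm (a + b) powr p \<le> 2 powr p * (norm a powr p + norm b powr p)"
proof -
  have "norm (a + b) powr p \<le> (2 * max (norm a) (norm b)) powr p"
    using assms norm_triangle_ineq[of a b] by (intro powr_mono2) auto
  also have "\<dots> = 2 powr p * max (norm a) (norm b) powr p"
    by (simp add: powr_mult)
  also have "max (norm a) (norm b) powr p \<le> norm a powr p + norm b powr p"
    by (auto simp: max_def)
  finally show ?thesis by simp
qed

lemma add3_powr_le:
  fixes a b c p :: real
  assumes "p \<ge> 0" "a \<ge> 0" "b \<ge> 0" "c \<ge> 0"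
  shows "(a + b + c) powr p \<le> 3 powr p * (a powr p + b powr p + c powr p)"
proof -
  have "(a + b + c) powr p \<le> (3 * max a (max b c)) powr p"
    using assms by (intro powr_mono2) auto
  also have "\<dots> = 3 powr p * max a (max b c) powr p"
    using assms by (simp add: powr_mult)
  also have "max a (max b c) powr p \<le> a powr p + b powr p + c powr p"
    by (auto simp: max_def)
  finally show ?thesis by simp
qed

section \<open>Jensen's inequality and the total mass of a mollification\<close>

lemma mol_norm_le:
  fixes f :: "'a::euclidean_space \<Rightarrow> 'b::euclidean_space"
  assumes "\<epsilon> > 0" "integrable lborel f"
  shows "norm (mol \<epsilon> f z) \<le> mol \<epsilon> (\<lambda>w. norm (f w)) z"
  unfolding mol_def
  using mol_integrable[OF assms, of z] mol_integrable[OF assms(1), of "\<lambda>w. norm (f w)" z] assms(2)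
  by (intro Bochner_Integration.integral_norm_bound_integral) (auto simp: mol_kernel_nonneg[OF assms(1)])

text \<open>The tangent to t^p at the average a of |f| is integrated against the kernel, a
  probability density: the linear term averages to 0 and a^p remains below the average of
  |f|^p.\<close>

lemma mol_jensen:
  fixes f :: "'a::euclidean_space \<Rightarrow> 'b::euclidean_space"
  assumes \<epsilon>: "\<epsilon> > 0" and f: "integrable lborel f" and fp: "integrable lborel (\<lambda>w. norm (f w) powr p)"
    and p: "p \<ge> 1"
  shows "norm (mol \<epsilon> f z) powr p \<le> mol \<epsilon> (\<lambda>w. norm (f w) powr p) z"
proof -
  let ?k = "\<lambda>w. mol_kernel \<epsilon> (w - z)"
  define a where "a = mol \<epsilon> (\<lambda>w. norm (f w)) z"
  have nf: "integrable lborel (\<lambda>w. norm (f w))" using f by simp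
  have i1: "integrable lborel (\<lambda>w. ?k w * norm (f w))"
    using mol_integrable[OF \<epsilon> nf] by simp
  have i2: "integrable lborel (\<lambda>w. ?k w * norm (f w) powr p)"
    using mol_integrable[OF \<epsilon> fp] by simp
  have k: "integrable lborel ?k" "(LINT w|lborel. ?k w) = 1"
    using has_bochner_integral_mol_kernel[OF \<epsilon>, of z] by (auto simp: has_bochner_integral_iff)
  have a: "norm (mol \<epsilon> f z) \<le> a"
    unfolding a_def by (rule mol_norm_le[OF \<epsilon> f])
  then have a0: "a \<ge> 0" using norm_ge_zero order_trans by blast
  define c where "c = p * a powr (p - 1)"
  have "a powr p = (LINT w|lborel. (a powr p - c * a) * ?k w + c * (?k w * norm (f w)))"
    using i1 k by (simp add: a_def mol_def algebra_simps)
  also have "\<dots> \<le> (LINT w|lborel. ?k w * norm (f w) powr p)"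
  proof (rule integral_mono)
    show "integrable lborel (\<lambda>w. (a powr p - c * a) * ?k w + c * (?k w * norm (f w)))"
      using i1 k(1) by simp
    fix w
    have "?k w * (a powr p + c * (norm (f w) - a)) \<le> ?k w * norm (f w) powr p"
      unfolding c_def using a0 p mol_kernel_nonneg[OF \<epsilon>]
      by (intro mult_left_mono powr_ge_tangent) auto
    then show "(a powr p - c * a) * ?k w + c * (?k w * norm (f w)) \<le> ?k w * norm (f w) powr p"
      by (simp add: algebra_simps)
  qed (rule i2)
  also have "\<dots> = mol \<epsilon> (\<lambda>w. norm (f w) powr p) z"
    by (simp add: mol_def)
  finally have "a powr p \<le> mol \<epsilon> (\<lambda>w. norm (f w) powr p) z" .
  moreover have "norm (mol \<epsilon> f z) powr p \<le> a powr p"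
    using a p by (intro powr_mono2) auto
  ultimately show ?thesis by simp
qed

lemma mol_nonneg: "\<epsilon> > 0 \<Longrightarrow> (\<And>w. f w \<ge> 0) \<Longrightarrow> mol \<epsilon> f z \<ge> (0::real)"
  unfolding mol_def by (intro Bochner_Integration.integral_nonneg) (simp add: mol_kernel_nonneg)

text \<open>Tonelli. The inner integral then runs over the centre z, and evenness of the kernel
  turns it into the total mass 1.\<close>

lemma nn_integral_mol:
  fixes H :: "'a::euclidean_space \<Rightarrow> real"
  assumes \<epsilon>: "\<epsilon> > 0" and H: "integrable lborel H" "\<And>w. H w \<ge> 0"
  shows "(\<integral>\<^sup>+z. ennreal (mol \<epsilon> H z) \<partial>lborel) = (\<integral>\<^sup>+w. ennreal (H w) \<partial>lborel)"
proof -
  note [measurable] = mol_kernel_measurable[OF \<epsilon>]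
  have [measurable]: "H \<in> borel_measurable borel" using H(1) by auto
  have "(\<integral>\<^sup>+z. ennreal (mol \<epsilon> H z) \<partial>lborel) = (\<integral>\<^sup>+z. \<integral>\<^sup>+w. ennreal (mol_kernel \<epsilon> (w - z)) * ennreal (H w) \<partial>lborel \<partial>lborel)"
  proof (rule nn_integral_cong)
    fix z :: 'a
    have "(\<integral>\<^sup>+w. ennreal (mol_kernel \<epsilon> (w - z) *\<^sub>R H w) \<partial>lborel) = ennreal (mol \<epsilon> H z)"
      unfolding mol_def
      by (rule nn_integral_eq_integral[OF mol_integrable[OF \<epsilon> H(1)]]) (simp add: mol_kernel_nonneg[OF \<epsilon>] H(2))
    then show "ennreal (mol \<epsilon> H z) = (\<integral>\<^sup>+w. ennreal (mol_kernel \<epsilon> (w - z)) * ennreal (H w) \<partial>lborel)"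
      by (simp add: ennreal_mult mol_kernel_nonneg[OF \<epsilon>] H(2))
  qed
  also have "\<dots> = (\<integral>\<^sup>+w. \<integral>\<^sup>+z. ennreal (mol_kernel \<epsilon> (w - z)) * ennreal (H w) \<partial>lborel \<partial>lborel)"
    by (rule lborel_pair.Fubini') measurable
  also have "\<dots> = (\<integral>\<^sup>+w. ennreal (H w) \<partial>lborel)"
  proof (rule nn_integral_cong)
    fix w :: 'a
    have "(\<integral>\<^sup>+z. ennreal (mol_kernel \<epsilon> (w - z)) \<partial>lborel) = (\<integral>\<^sup>+z. ennreal (mol_kernel \<epsilon> (z - w)) \<partial>lborel)"
      by (simp only: mol_kernel_commute[OF \<epsilon>])
    also have "\<dots> = ennreal (LINT z|lborel. mol_kernel \<epsilon> (z - w))"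
      using has_bochner_integral_mol_kernel[OF \<epsilon>, of w]
      by (intro nn_integral_eq_integral) (auto simp: has_bochner_integral_iff mol_kernel_nonneg[OF \<epsilon>])
    also have "\<dots> = 1"
      using has_bochner_integral_mol_kernel[OF \<epsilon>, of w] by (simp add: has_bochner_integral_iff)
    finally show "(\<integral>\<^sup>+z. ennreal (mol_kernel \<epsilon> (w - z)) * ennreal (H w) \<partial>lborel) = ennreal (H w)"
      by (simp add: nn_integral_multc)
  qed
  finally show ?thesis .
qed

text \<open>Clipping the values of f makes it bounded, with an error dominated by |f|^p. Continuous
  functions converging to f almost everywhere are then clipped at the same level, so that dominated
  convergence applies on E, a set of finite measure. The indicator stays in the conclusion because g
  may be nonzero off E.\<close>

lemma Lp_dense_continuous:
  fixes f :: "'a::euclidean_space \<Rightarrow> 'b::euclidean_space"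
  assumes E: "E \<in> sets borel" "bounded E" and f: "f \<in> borel_measurable borel" "\<And>x. x \<notin> E \<Longrightarrow> f x = 0"
    and fp: "integrable lborel (\<lambda>x. norm (f x) powr p)" and p: "p \<ge> 1" and "e > 0"
  obtains g M where "continuous_on UNIV g" "\<And>x. norm (g x) \<le> M"
    "integrable lborel (\<lambda>x. norm (f x - indicator E x *\<^sub>R g x) powr p)"
    "(LINT x|lborel. norm (f x - indicator E x *\<^sub>R g x) powr p) < e"
proof -
  \<comment> \<open>\<open>clip n\<close> is the nearest point retraction onto the ball of radius n:
    continuous, the identity inside, and \<open>clip n y\<close> is no further from y than 0
    is.\<close>
  note [measurable] = E(1) f(1)
  define clip where "clip n = closest_point (cball (0::'b) (real n))" for n
  have ne: "cball (0::'b) (real n) \<noteq> {}" for n by simp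
  have clip_le: "norm (clip n y) \<le> real n" for n y
    using closest_point_in_set[OF closed_cball ne, of n y] by (simp add: clip_def)
  have clip_self: "clip n y = y" if "norm y \<le> real n" for n y
    using that by (simp add: clip_def closest_point_self)
  have clip_dist: "norm (y - clip n y) \<le> norm y" for n y
    using closest_point_le[OF closed_cball, of 0 0 "real n" y] by (simp add: clip_def dist_norm)
  have clip_cont: "continuous_on A (clip n)" for A n
    unfolding clip_def by (rule continuous_on_closest_point) auto
  have [measurable]: "clip n \<in> borel_measurable borel" for n
    by (rule borel_measurable_continuous_onI[OF clip_cont])
  \<comment> \<open>Half of e for each of the two approximations, divided by the constant 2 powr p
    of \<open>norm_add_powr_le\<close>.\<close>
  define e' where "e' = e / (2 * 2 powr p)"
  have "e' > 0" using \<open>e > 0\<close> by (simp add: e'_def)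
  have "(\<lambda>n. LINT x|lborel. norm (f x - clip n (f x)) powr p) \<longlonglongrightarrow> (LINT (x::'a)|lborel. 0 :: real)"
  proof (rule integral_dominated_convergence[OF _ _ fp])
    show "AE x in lborel. (\<lambda>n. norm (f x - clip n (f x)) powr p) \<longlonglongrightarrow> 0"
    proof (rule AE_I2)
      fix x
      have "\<forall>\<^sub>F n in sequentially. norm (f x - clip n (f x)) powr p = 0"
        using eventually_ge_at_top[of "nat \<lceil>norm (f x)\<rceil>"]
        by eventually_elim (simp add: clip_self nat_ceiling_le_eq)
      then show "(\<lambda>n. norm (f x - clip n (f x)) powr p) \<longlonglongrightarrow> 0"
        by (rule tendsto_eventually)
    qed
    show "AE x in lborel. norm (norm (f x - clip n (f x)) powr p) \<le> norm (f x) powr p" for n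
      using clip_dist p by (auto intro!: AE_I2 powr_mono2)
  qed auto
  then have "\<forall>\<^sub>F n in sequentially. (LINT x|lborel. norm (f x - clip n (f x)) powr p) < e'"
    using \<open>e' > 0\<close> by (simp add: order_tendsto_iff)
  then obtain n where n: "(LINT x|lborel. norm (f x - clip n (f x)) powr p) < e'"
    by (meson eventually_happens sequentially_bot)
  have i1: "integrable lborel (\<lambda>x. norm (f x - clip n (f x)) powr p)"
    using clip_dist p by (intro Bochner_Integration.integrable_bound[OF fp]) (auto intro!: AE_I2 powr_mono2)
  \<comment> \<open>This notion of measurability supplies continuous functions converging to f off a
    negligible set.\<close>
  have "f measurable_on UNIV"
    using f(1) by (intro lebesgue_measurable_imp_measurable_on measurable_completion) auto
  then obtain N g where g: "negligible N" "\<And>k. continuous_on UNIV (g k)" "\<And>x. x \<notin> N \<Longrightarrow> (\<lambda>k. g k x) \<longlonglongrightarrow> f x"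
    unfolding measurable_on_def by auto
  have [measurable]: "g k \<in> borel_measurable borel" for k
    by (rule borel_measurable_continuous_onI[OF g(2)])
  have aeN: "AE x in lborel. x \<notin> N"
    using g(1) AE_completion_iff[of "\<lambda>x. x \<notin> N" lborel]
    by (simp add: negligible_iff_null_sets AE_not_in)
  let ?d = "\<lambda>k x. norm (indicator E x *\<^sub>R (clip n (f x) - clip n (g k x))) powr p"
  have bound: "norm (?d k x) \<le> (2 * real n) powr p * indicator E x" for k x
  proof (cases "x \<in> E")
    case True
    have "norm (clip n (f x) - clip n (g k x)) \<le> 2 * real n"
      using clip_le[of n "f x"] clip_le[of n "g k x"] norm_triangle_ineq4[of "clip n (f x)" "clip n (g k x)"] by linarith
    then show ?thesis using True p by (auto intro!: powr_mono2)
  qed simp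
  have iw: "integrable lborel (\<lambda>x. (2 * real n) powr p * indicator E x :: real)"
    using emeasure_bounded_finite[OF E(2)] by (simp add: integrable_indicator_iff)
  have i2: "integrable lborel (?d k)" for k
    using bound by (intro Bochner_Integration.integrable_bound[OF iw]) (auto intro!: AE_I2)
  have "(\<lambda>k. LINT x|lborel. ?d k x) \<longlonglongrightarrow> (LINT (x::'a)|lborel. 0 :: real)"
  proof (rule integral_dominated_convergence[OF _ _ iw])
    show "AE x in lborel. (\<lambda>k. ?d k x) \<longlonglongrightarrow> 0"
      using aeN
    proof eventually_elim
      case (elim x)
      have "(\<lambda>k. clip n (g k x)) \<longlonglongrightarrow> clip n (f x)"
        by (rule continuous_on_tendsto_compose[OF clip_cont[of UNIV n] g(3)[OF elim]]) auto
      then have "(\<lambda>k. norm (indicator E x *\<^sub>R (clip n (f x) - clip n (g k x)))) \<longlonglongrightarrow> norm (indicator E x *\<^sub>R (clip n (f x) - clip n (f x)))"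
        by (intro tendsto_intros)
      then have "(\<lambda>k. norm (indicator E x *\<^sub>R (clip n (f x) - clip n (g k x)))) \<longlonglongrightarrow> 0" by simp
      then show "(\<lambda>k. ?d k x) \<longlonglongrightarrow> 0"
        using p by (intro tendsto_zero_powrI[where b = p]) auto
    qed
    show "AE x in lborel. norm (?d k x) \<le> (2 * real n) powr p * indicator E x" for k
      by (intro AE_I2 bound)
  qed auto
  then have "\<forall>\<^sub>F k in sequentially. (LINT x|lborel. ?d k x) < e'"
    using \<open>e' > 0\<close> by (simp add: order_tendsto_iff)
  then obtain k where k: "(LINT x|lborel. ?d k x) < e'"
    by (meson eventually_happens sequentially_bot)
  let ?G = "\<lambda>x. clip n (g k x)"
  have le: "norm (f x - indicator E x *\<^sub>R ?G x) powr p \<le> 2 powr p * (norm (f x - clip n (f x)) powr p + ?d k x)" for x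
  proof -
    have "clip n 0 = 0" by (rule clip_self) simp
    then have eq: "f x - indicator E x *\<^sub>R ?G x = (f x - clip n (f x)) + indicator E x *\<^sub>R (clip n (f x) - ?G x)"
      using f(2)[of x] by (cases "x \<in> E") (auto simp: indicator_def)
    show ?thesis
      unfolding eq by (rule norm_add_powr_le) (use p in simp)
  qed
  have i3: "integrable lborel (\<lambda>x. 2 powr p * (norm (f x - clip n (f x)) powr p + ?d k x))"
    using i1 i2 by (intro integrable_mult_right Bochner_Integration.integrable_add)
  have i4: "integrable lborel (\<lambda>x. norm (f x - indicator E x *\<^sub>R ?G x) powr p)"
    using le by (intro Bochner_Integration.integrable_bound[OF i3]) (auto intro!: AE_I2 intro: order_trans)
  have "(LINT x|lborel. norm (f x - indicator E x *\<^sub>R ?G x) powr p) \<le> (LINT x|lborel. 2 powr p * (norm (f x - clip n (f x)) powr p + ?d k x))"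
    using le by (intro integral_mono i3 i4)
  also have "\<dots> = 2 powr p * ((LINT x|lborel. norm (f x - clip n (f x)) powr p) + (LINT x|lborel. ?d k x))"
    by (simp only: integral_mult_right_zero Bochner_Integration.integral_add[OF i1 i2])
  also have "\<dots> < 2 powr p * (e' + e')"
    using n k by (intro mult_strict_left_mono add_strict_mono) auto
  also have "\<dots> = e" by (simp add: e'_def)
  finally have "(LINT x|lborel. norm (f x - indicator E x *\<^sub>R ?G x) powr p) < e" .
  moreover have "continuous_on UNIV ?G"
    using continuous_on_compose2[OF clip_cont g(2)] by blast
  ultimately show ?thesis
    using that[of ?G "real n"] clip_le i4 by blast
qed

text \<open>On E, which has finite measure, |f| is at most 1 + |f|^p.\<close>

lemma integrable_if_powr_integrable:
  fixes f :: "'a::euclidean_space \<Rightarrow> 'b::euclidean_space"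
  assumes E: "E \<in> sets borel" "bounded E" and f: "f \<in> borel_measurable borel" "\<And>x. x \<notin> E \<Longrightarrow> f x = 0"
    and fp: "integrable lborel (\<lambda>x. norm (f x) powr p)" and p: "p \<ge> 1"
  shows "integrable lborel f"
proof (rule Bochner_Integration.integrable_bound)
  have "integrable lborel (indicator E :: 'a \<Rightarrow> real)"
    using E emeasure_bounded_finite[OF E(2)] by (simp add: integrable_indicator_iff)
  with fp show "integrable lborel (\<lambda>x. indicator E x + norm (f x) powr p)"
    by (rule Bochner_Integration.integrable_add[rotated])
  have "norm (f x) \<le> indicator E x + norm (f x) powr p" for x
  proof (cases "x \<in> E")
    case True
    have "norm (f x) \<le> 1 + norm (f x) powr p"
    proof (cases "norm (f x) \<le> 1")
      case False
      then have "norm (f x) powr 1 \<le> norm (f x) powr p" using p by (intro powr_mono) auto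
      with False show ?thesis by simp
    qed (simp add: add_increasing2)
    with True show ?thesis by simp
  qed (simp add: f(2))
  then show "AE x in lborel. norm (f x) \<le> norm (indicator E x + norm (f x) powr p)"
    by (intro AE_I2) (smt (verit) real_norm_def)
qed (use f(1) in simp)

lemma mol_dist_le:
  fixes f :: "'a::euclidean_space \<Rightarrow> 'b::euclidean_space"
  assumes \<epsilon>: "\<epsilon> > 0" and f: "integrable lborel f" and le: "\<And>w. w \<in> ball z \<epsilon> \<Longrightarrow> norm (f w - c) \<le> \<eta>"
  shows "norm (mol \<epsilon> f z - c) \<le> \<eta>"
proof -
  let ?k = "\<lambda>w. mol_kernel \<epsilon> (w - z)"
  have k: "integrable lborel ?k" "(LINT w|lborel. ?k w) = 1"
    using has_bochner_integral_mol_kernel[OF \<epsilon>, of z] by (auto simp: has_bochner_integral_iff)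
  have ik: "integrable lborel (\<lambda>w. ?k w *\<^sub>R f w)" by (rule mol_integrable[OF \<epsilon> f])
  have "mol \<epsilon> f z - c = (LINT w|lborel. ?k w *\<^sub>R f w) - (LINT w|lborel. ?k w *\<^sub>R c)"
    using k by (simp add: mol_def)
  also have "\<dots> = (LINT w|lborel. ?k w *\<^sub>R f w - ?k w *\<^sub>R c)"
    using ik k by (intro Bochner_Integration.integral_diff[symmetric]) auto
  also have "norm \<dots> \<le> (LINT w|lborel. \<eta> * ?k w)"
  proof (rule Bochner_Integration.integral_norm_bound_integral)
    show "integrable lborel (\<lambda>w. ?k w *\<^sub>R f w - ?k w *\<^sub>R c)"
      using ik k by (intro Bochner_Integration.integrable_diff) auto
    fix w
    have "?k w * norm (f w - c) \<le> ?k w * \<eta>"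
    proof (cases "w \<in> ball z \<epsilon>")
      case True
      then show ?thesis using le mol_kernel_nonneg[OF \<epsilon>] by (intro mult_left_mono) auto
    next
      case False
      then have "?k w = 0"
        by (subst mol_kernel_eq_0_iff[OF \<epsilon>]) (simp add: dist_norm norm_minus_commute)
      then show ?thesis by simp
    qed
    then show "norm (?k w *\<^sub>R f w - ?k w *\<^sub>R c) \<le> \<eta> * ?k w"
      by (simp add: scaleR_diff_right[symmetric] mult.commute mol_kernel_nonneg[OF \<epsilon>])
  qed (use k in simp)
  also have "\<dots> = \<eta>" using k by simp
  finally show ?thesis .
qed

lemma mol_diff:
  fixes f g :: "'a::euclidean_space \<Rightarrow> 'b::euclidean_space"
  assumes "\<epsilon> > 0" "integrable lborel f" "integrable lborel g"
  shows "mol \<epsilon> (\<lambda>x. f x - g x) z = mol \<epsilon> f z - mol \<epsilon> g z"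
  unfolding mol_def using assms
  by (simp add: scaleR_diff_right Bochner_Integration.integral_diff mol_integrable)

text \<open>Write h as k plus g cut off to E, with k small in L^p and g continuous. Jensen,
  \<open>nn_integral_mol\<close> and \<open>cov\<close> control the mollified k. For x in S the ball
  about \<phi> x lies in E, so the other part is g there, and uniform continuity applies. With
  \<phi>, S and E general, the statement serves both the identity map, in the fundamental lemma, and
  \<open>shrink j \<delta>\<close> on D. \<open>cov\<close> speaks of continuous H because it is
  applied to a mollification.\<close>

lemma mol_compose_tendsto:
  fixes h :: "'a::euclidean_space \<Rightarrow> 'b::euclidean_space" and \<phi> :: "real \<Rightarrow> 'a \<Rightarrow> 'a"
  assumes p: "p \<ge> 1" and r: "r > 0"
    and E: "E \<in> sets borel" "bounded E" and S: "S \<in> sets borel" "S \<subseteq> E"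
    and h: "h \<in> borel_measurable borel" "\<And>x. x \<notin> E \<Longrightarrow> h x = 0"
    and hp: "integrable lborel (\<lambda>x. norm (h x) powr p)"
    and sub: "\<forall>\<^sub>F \<delta> in at_right 0. \<forall>x\<in>S. ball (\<phi> \<delta> x) (\<delta> * r) \<subseteq> E"
    and close: "\<And>\<delta> x. 0 < \<delta> \<Longrightarrow> x \<in> S \<Longrightarrow> dist (\<phi> \<delta> x) x \<le> C * \<delta>"
    and cont: "\<And>\<delta>. continuous_on UNIV (\<phi> \<delta>)"
    and cov: "\<forall>\<^sub>F \<delta> in at_right 0. \<forall>H :: 'a \<Rightarrow> real. continuous_on UNIV H \<longrightarrow> (\<forall>x. H x \<ge> 0) \<longrightarrow> integrable lborel H \<longrightarrow>
       (\<integral>\<^sup>+x. indicator S x * ennreal (H (\<phi> \<delta> x)) \<partial>lborel) \<le> ennreal c * (\<integral>\<^sup>+x. ennreal (H x) \<partial>lborel)"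
    and c: "c \<ge> 0"
  shows "((\<lambda>\<delta>. \<integral>\<^sup>+x. indicator S x * ennreal (norm (mol (\<delta> * r) h (\<phi> \<delta> x) - h x) powr p) \<partial>lborel) \<longlongrightarrow> 0) (at_right 0)"
proof (rule tendsto_zero_ennreal)
  fix e0 :: real assume "e0 > 0"
  define e where "e = e0 / 2"
  have "e > 0" "e < e0" using \<open>e0 > 0\<close> by (auto simp: e_def)
  note [measurable] = E(1) S(1) h(1)
  define T where "T = (3::real) powr p"
  have T: "T > 0" by (simp add: T_def)
  define m where "m = measure lborel E"
  have m: "m \<ge> 0" "emeasure lborel E = ennreal m"
    using emeasure_bounded_finite[OF E(2)] by (auto simp: m_def emeasure_eq_ennreal_measure)
  \<comment> \<open>Two error terms contain k: its mollification, with the factor c, and k itself;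
    hence c + 1.\<close>
  define e1 where "e1 = e / (2 * T * (c + 1))"
  have "c + 1 > 0" using c by simp
  then have e1: "e1 > 0" "T * ((c + 1) * e1) = e / 2"
    using \<open>e > 0\<close> T by (auto simp: e1_def)
  \<comment> \<open>Chosen so that T \<eta>^p m \<le> e / 2 with m the measure of E; m + 1 avoids
    division by 0.\<close>
  define \<eta> where "\<eta> = (e / (2 * T * (m + 1))) powr (1 / p)"
  have "e / (2 * T * (m + 1)) > 0" using \<open>e > 0\<close> T m(1) by simp
  then have \<eta>: "\<eta> > 0" "\<eta> powr p = e / (2 * T * (m + 1))"
    using p \<open>e > 0\<close> T m(1) by (auto simp: \<eta>_def powr_powr abs_mult)
  have "\<eta> powr p * m \<le> \<eta> powr p * (m + 1)" by (intro mult_left_mono) auto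
  then have "T * (\<eta> powr p * m) \<le> T * (\<eta> powr p * (m + 1))" using T by simp
  also have "\<dots> = e / 2" using T add_nonneg_pos[OF m(1), of 1] unfolding \<eta>(2) by simp
  finally have \<eta>m: "T * (\<eta> powr p * m) \<le> e / 2" .

  obtain g M where g: "continuous_on UNIV g" "\<And>x. norm (g x) \<le> M"
    and ik: "integrable lborel (\<lambda>x. norm (h x - indicator E x *\<^sub>R g x) powr p)"
    and kle: "(LINT x|lborel. norm (h x - indicator E x *\<^sub>R g x) powr p) < e1"
    using Lp_dense_continuous[OF E h hp p e1(1)] by blast
  have [measurable]: "g \<in> borel_measurable borel" by (rule borel_measurable_continuous_onI[OF g(1)])
  define gE where "gE x = indicator E x *\<^sub>R g x" for x
  define k where "k x = h x - gE x" for x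
  have [measurable]: "k \<in> borel_measurable borel" "gE \<in> borel_measurable borel"
    unfolding k_def gE_def by measurable
  have k0: "k x = 0" if "x \<notin> E" for x using that h(2) by (simp add: k_def gE_def)
  have kp: "integrable lborel (\<lambda>x. norm (k x) powr p)" using ik by (simp add: k_def gE_def)
  define I where "I = (LINT x|lborel. norm (k x) powr p)"
  have I: "I \<ge> 0" "I < e1" using kle by (auto simp: I_def k_def gE_def)
  have nnI: "(\<integral>\<^sup>+x. ennreal (norm (k x) powr p) \<partial>lborel) = ennreal I"
    unfolding I_def by (rule nn_integral_eq_integral[OF kp]) simp
  have k_int: "integrable lborel k"
    by (rule integrable_if_powr_integrable[OF E _ k0 kp p]) measurable
  have h_int: "integrable lborel h"
    by (rule integrable_if_powr_integrable[OF E h hp p])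
  have gE_int: "integrable lborel gE"
    using Bochner_Integration.integrable_diff[OF h_int k_int] by (simp add: k_def)

  have "compact (closure E)" using E(2) by (simp add: compact_closure)
  then have "uniformly_continuous_on (closure E) g"
    using g(1) by (intro compact_uniformly_continuous) (auto intro: continuous_on_subset)
  then obtain d where d: "d > 0" "\<And>x y. x \<in> closure E \<Longrightarrow> y \<in> closure E \<Longrightarrow> dist y x < d \<Longrightarrow> dist (g y) (g x) < \<eta>"
    unfolding uniformly_continuous_on_def using \<eta>(1) by metis
  have "((\<lambda>\<delta>. C * \<delta> + \<delta> * r) \<longlongrightarrow> C * 0 + 0 * r) (at_right 0)"
    by (intro tendsto_intros)
  then have "\<forall>\<^sub>F \<delta> in at_right 0. C * \<delta> + \<delta> * r < d"
    using d(1) by (simp add: order_tendsto_iff)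
  with sub cov eventually_at_right_less[of 0]
  show "\<forall>\<^sub>F \<delta> in at_right 0. (\<integral>\<^sup>+x. indicator S x * ennreal (norm (mol (\<delta> * r) h (\<phi> \<delta> x) - h x) powr p) \<partial>lborel) < ennreal e0"
  proof eventually_elim
    case (elim \<delta>)
    define \<epsilon> where "\<epsilon> = \<delta> * r"
    have \<epsilon>: "\<epsilon> > 0" using elim r by (simp add: \<epsilon>_def)
    define H where "H = mol \<epsilon> (\<lambda>w. norm (k w) powr p)"
    have H0: "H z \<ge> 0" for z unfolding H_def by (rule mol_nonneg[OF \<epsilon>]) simp
    have Hcont: "continuous_on UNIV H" unfolding H_def by (rule mol_continuous[OF \<epsilon> kp])
    have nnH: "(\<integral>\<^sup>+z. ennreal (H z) \<partial>lborel) = ennreal I"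
      unfolding H_def nnI[symmetric] by (rule nn_integral_mol[OF \<epsilon> kp]) simp
    have [measurable]: "H \<in> borel_measurable borel" by (rule borel_measurable_continuous_onI[OF Hcont])
    have [measurable]: "\<phi> \<delta> \<in> borel_measurable borel" by (rule borel_measurable_continuous_onI[OF cont])
    have Hint: "integrable lborel H"
      using nnH H0 by (intro integrableI_nonneg) auto
    have pw: "norm (mol \<epsilon> h (\<phi> \<delta> x) - h x) powr p \<le> T * (H (\<phi> \<delta> x) + \<eta> powr p + norm (k x) powr p)"
      if x: "x \<in> S" for x
    proof -
      have sub': "ball (\<phi> \<delta> x) \<epsilon> \<subseteq> E" using elim x by (auto simp: \<epsilon>_def)
      have xE: "x \<in> E" using x S(2) by auto
      \<comment> \<open>The jump of \<open>gE\<close> at the boundary of E is invisible here: all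
        points w seen by the kernel lie in E.\<close>
      have "norm (mol \<epsilon> gE (\<phi> \<delta> x) - g x) \<le> \<eta>"
      proof (rule mol_dist_le[OF \<epsilon> gE_int])
        fix w assume w: "w \<in> ball (\<phi> \<delta> x) \<epsilon>"
        then have "w \<in> E" using sub' by auto
        have "dist w x \<le> dist w (\<phi> \<delta> x) + dist (\<phi> \<delta> x) x" by (rule dist_triangle)
        also have "\<dots> < \<epsilon> + C * \<delta>" using w close[OF _ x, of \<delta>] elim by (simp add: dist_commute)
        also have "\<dots> < d" using elim by (simp add: \<epsilon>_def add.commute)
        finally have "dist (g w) (g x) < \<eta>"
          using d(2) \<open>w \<in> E\<close> xE closure_subset by blast
        then show "norm (gE w - g x) \<le> \<eta>" using \<open>w \<in> E\<close> by (simp add: gE_def dist_norm)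
      qed
      moreover have eq: "mol \<epsilon> h (\<phi> \<delta> x) - h x = mol \<epsilon> k (\<phi> \<delta> x) + (mol \<epsilon> gE (\<phi> \<delta> x) - g x) - k x"
        using mol_diff[OF \<epsilon> h_int gE_int, of "\<phi> \<delta> x"] xE by (simp add: k_def[abs_def] gE_def)
      ultimately have "norm (mol \<epsilon> h (\<phi> \<delta> x) - h x) \<le> norm (mol \<epsilon> k (\<phi> \<delta> x)) + \<eta> + norm (k x)"
        unfolding eq
        using norm_triangle_ineq4[of "mol \<epsilon> k (\<phi> \<delta> x) + (mol \<epsilon> gE (\<phi> \<delta> x) - g x)" "k x"]
          norm_triangle_ineq[of "mol \<epsilon> k (\<phi> \<delta> x)" "mol \<epsilon> gE (\<phi> \<delta> x) - g x"] by linarith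
      then have "norm (mol \<epsilon> h (\<phi> \<delta> x) - h x) powr p \<le> (norm (mol \<epsilon> k (\<phi> \<delta> x)) + \<eta> + norm (k x)) powr p"
        using p by (intro powr_mono2) auto
      also have "\<dots> \<le> T * (norm (mol \<epsilon> k (\<phi> \<delta> x)) powr p + \<eta> powr p + norm (k x) powr p)"
        unfolding T_def using p \<eta>(1) by (intro add3_powr_le) auto
      also have "\<dots> \<le> T * (H (\<phi> \<delta> x) + \<eta> powr p + norm (k x) powr p)"
        unfolding H_def using T mol_jensen[OF \<epsilon> k_int kp p, of "\<phi> \<delta> x"] by (intro mult_left_mono) auto
      finally show ?thesis .
    qed
    have "(\<integral>\<^sup>+x. indicator S x * ennreal (norm (mol \<epsilon> h (\<phi> \<delta> x) - h x) powr p) \<partial>lborel) \<le>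
      (\<integral>\<^sup>+x. ennreal T * (indicator S x * ennreal (H (\<phi> \<delta> x)) + ennreal (\<eta> powr p) * indicator E x + ennreal (norm (k x) powr p)) \<partial>lborel)"
    proof (rule nn_integral_mono)
      fix x :: 'a
      show "indicator S x * ennreal (norm (mol \<epsilon> h (\<phi> \<delta> x) - h x) powr p) \<le>
        ennreal T * (indicator S x * ennreal (H (\<phi> \<delta> x)) + ennreal (\<eta> powr p) * indicator E x + ennreal (norm (k x) powr p))"
      proof (cases "x \<in> S")
        case True
        then have "x \<in> E" using S(2) by auto
        have "ennreal (norm (mol \<epsilon> h (\<phi> \<delta> x) - h x) powr p) \<le> ennreal (T * (H (\<phi> \<delta> x) + \<eta> powr p + norm (k x) powr p))"
          by (rule ennreal_leI[OF pw[OF True]])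
        also have "\<dots> = ennreal T * (ennreal (H (\<phi> \<delta> x)) + ennreal (\<eta> powr p) + ennreal (norm (k x) powr p))"
          using T H0 by (simp add: ennreal_mult ennreal_plus[symmetric] del: ennreal_plus)
        finally show ?thesis using True \<open>x \<in> E\<close> by simp
      qed simp
    qed
    also have "\<dots> = ennreal T * ((\<integral>\<^sup>+x. indicator S x * ennreal (H (\<phi> \<delta> x)) \<partial>lborel) + ennreal (\<eta> powr p) * emeasure lborel E + ennreal I)"
      unfolding nnI[symmetric] by (simp add: nn_integral_cmult nn_integral_add nn_integral_cmult_indicator)
    also have "\<dots> \<le> ennreal T * (ennreal c * ennreal I + ennreal (\<eta> powr p) * ennreal m + ennreal I)"
      unfolding m(2)[symmetric] nnH[symmetric] using elim Hcont H0 Hint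
      by (intro mult_left_mono add_mono) auto
    also have "\<dots> = ennreal (T * (c * I + \<eta> powr p * m + I))"
      using T I c m(1) by (simp add: ennreal_mult)
    also have "\<dots> \<le> ennreal e"
    proof (rule ennreal_leI)
      have "T * (c * I + \<eta> powr p * m + I) = T * ((c + 1) * I) + T * (\<eta> powr p * m)"
        by (simp add: algebra_simps)
      also have "\<dots> \<le> T * ((c + 1) * e1) + e / 2"
        using \<eta>m I T c by (intro add_mono mult_left_mono) auto
      also have "\<dots> = e" using e1 by simp
      finally show "T * (c * I + \<eta> powr p * m + I) \<le> e" .
    qed
    also have "\<dots> < ennreal e0"
      using \<open>e < e0\<close> \<open>e > 0\<close> by (simp add: ennreal_less_iff)
    finally show ?case unfolding \<epsilon>_def .
  qed
qed

subsection \<open>Uniqueness of weak derivatives\<close>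

lemma locally_integrable_diff:
  "locally_integrable D f \<Longrightarrow> locally_integrable D g \<Longrightarrow> locally_integrable D (\<lambda>x. f x - g x)"
  by (auto simp: locally_integrable_def)

text \<open>On the compact support of \<psi> the function f is integrable and \<psi> is bounded;
  elsewhere the product is 0.\<close>

lemma locally_integrable_test_function:
  fixes f :: "'a::euclidean_space \<Rightarrow> real"
  assumes D: "open D" and f: "locally_integrable D f" and \<psi>: "test_function D \<psi>"
  shows "integrable (lebesgue_on D) (\<lambda>x. f x * \<psi> x)"
proof -
  define K where "K = closure {x. \<psi> x \<noteq> 0}"
  have K: "compact K" "K \<subseteq> D" and sm: "smooth \<psi>"
    using \<psi> by (auto simp: test_function_def K_def)
  have \<psi>0: "\<psi> x = 0" if "x \<notin> K" for x
    using that closure_subset[of "{x. \<psi> x \<noteq> 0}"] by (auto simp: K_def)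
  have Ks: "K \<in> sets lebesgue" and Ds: "D \<in> sets lebesgue" using fmeasurableD[OF lmeasurable_compact[OF K(1)]] D by auto
  have c: "continuous_on UNIV \<psi>" by (rule smooth_continuous_on[OF sm])
  obtain R where R: "\<And>x. x \<in> K \<Longrightarrow> norm x \<le> R"
    using compact_imp_bounded[OF K(1)] by (auto simp: bounded_iff)
  have \<psi>R: "\<psi> x = 0" if "norm x > R" for x
    using R[of x] \<psi>0[of x] that by force
  obtain B where B: "\<And>x. norm (\<psi> x) \<le> B"
    using bounded_bounded_support[OF c \<psi>R] by metis
  have i: "integrable lebesgue (\<lambda>x. if x \<in> K then f x else 0)"
    using f K integrable_lebesgue_on_if[OF Ks, of f] by (auto simp: locally_integrable_def)
  have [measurable]: "\<psi> \<in> borel_measurable lebesgue"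
    using borel_measurable_continuous_onI[OF c] by (intro measurable_completion) auto
  have [measurable]: "(\<lambda>x. if x \<in> K then f x else 0) \<in> borel_measurable lebesgue" using i by auto
  have "integrable lebesgue (\<lambda>x. (if x \<in> K then f x else 0) * \<psi> x)"
  proof (rule Bochner_Integration.integrable_bound)
    show "integrable lebesgue (\<lambda>x. B * (if x \<in> K then f x else 0))"
      using i by (rule integrable_mult_right)
    show "AE x in lebesgue. norm ((if x \<in> K then f x else 0) * \<psi> x) \<le> norm (B * (if x \<in> K then f x else 0))"
    proof (rule AE_I2)
      fix x
      have "\<bar>\<psi> x\<bar> \<le> \<bar>B\<bar>" using B[of x] by simp
      then show "norm ((if x \<in> K then f x else 0) * \<psi> x) \<le> norm (B * (if x \<in> K then f x else 0))"
        by (simp add: abs_mult mult.commute mult_right_mono)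
    qed
  qed measurable
  moreover have "(\<lambda>x. (if x \<in> K then f x else 0) * \<psi> x) = (\<lambda>x. if x \<in> D then f x * \<psi> x else 0)"
  proof
    show "(if x \<in> K then f x else 0) * \<psi> x = (if x \<in> D then f x * \<psi> x else 0)" for x
      using \<psi>0[of x] K(2) by (cases "x \<in> K") auto
  qed
  ultimately show ?thesis
    using integrable_lebesgue_on_if[OF Ds, of "\<lambda>x. f x * \<psi> x"] by simp
qed

text \<open>On a small ball the mollification of f at x is f tested against a translate of the
  kernel, hence 0. Since mollifications converge to f in L^1 there, f vanishes almost everywhere on
  the ball, and countably many such balls cover D by Lindelof's theorem.\<close>

lemma fundamental_lemma_calculus_of_variations:
  fixes f :: "'a::euclidean_space \<Rightarrow> real"
  assumes D: "open D" and f: "locally_integrable D f"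
    and 0: "\<And>\<psi>. test_function D \<psi> \<Longrightarrow> (LINT x|lebesgue_on D. f x * \<psi> x) = 0"
  shows "AE x in lborel. x \<in> D \<longrightarrow> f x = 0"
proof -
  have Ds: "D \<in> sets lebesgue" using D by auto
  have loc: "AE x in lborel. x \<in> ball a s \<longrightarrow> f x = 0" if s: "s > 0" "cball a (2 * s) \<subseteq> D" for a s
  proof -
    let ?E = "cball a (2 * s)" and ?S = "ball a s"
    have Es: "?E \<in> sets lebesgue" by auto
    have iE: "integrable (lebesgue_on ?E) f" using f s by (auto simp: locally_integrable_def)
    obtain h where h: "h \<in> borel_measurable borel" "AE x in lborel. x \<in> ?E \<longrightarrow> h x = f x" "\<And>x. x \<notin> ?E \<Longrightarrow> h x = 0"
      by (rule borel_representative[of ?E f]) (use iE in auto)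
    have ae: "AE x in lborel. (if x \<in> ?E then f x else 0) = h x"
      using h(2) by eventually_elim (use h(3) in auto)
    have "integrable lebesgue (\<lambda>x. if x \<in> ?E then f x else 0)"
      using iE integrable_lebesgue_on_if[OF Es, of f] by simp
    then have "integrable lebesgue h"
      using h(1) AE_completion[OF ae] by (subst integrable_cong_AE[symmetric, OF _ _ AE_completion[OF ae]]) (auto intro: measurable_completion)
    then have hi: "integrable lborel h" using h(1) by (simp add: integrable_completion)
    have mol0: "mol \<delta> h x = 0" if \<delta>: "0 < \<delta>" "\<delta> < s" and x: "x \<in> ?S" for \<delta> x
    proof -
      let ?\<psi> = "\<lambda>w. mol_kernel \<delta> (w - x)"
      have sub: "cball x \<delta> \<subseteq> ?E"
      proof
        fix y assume "y \<in> cball x \<delta>"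
        then show "y \<in> ?E" using x \<delta> dist_triangle[of a y x] by simp
      qed
      then have "test_function D (\<lambda>w. ?\<psi> w *\<^sub>R (1::real))"
        using s by (intro test_function_mol_kernel \<delta>) auto
      then have "(LINT w|lebesgue_on D. f w * ?\<psi> w) = 0" by (intro 0) simp
      then have "(LINT w|lebesgue. (if w \<in> D then f w * ?\<psi> w else 0)) = 0"
        using integral_lebesgue_on_if[OF Ds, of "\<lambda>w. f w * ?\<psi> w"] by simp
      moreover have "AE w in lborel. ?\<psi> w *\<^sub>R h w = (if w \<in> D then f w * ?\<psi> w else 0)"
        using h(2)
      proof eventually_elim
        case (elim w)
        have "w \<in> ?E" if "?\<psi> w \<noteq> 0"
        proof -
          have "w \<in> cball x \<delta>"
            using that by (simp add: mol_kernel_eq_0_iff[OF \<delta>(1)] dist_norm norm_minus_commute)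
          with sub show ?thesis by blast
        qed
        then show ?case using elim s by (cases "?\<psi> w = 0") auto
      qed
      ultimately show ?thesis
        using integral_lebesgue_AE[OF mol_integrable[OF \<delta>(1) hi, of x]] by (simp add: mol_def)
    qed
    have "((\<lambda>\<delta>. \<integral>\<^sup>+x. indicator ?S x * ennreal (norm (mol (\<delta> * 1) h x - h x) powr 1) \<partial>lborel) \<longlongrightarrow> 0) (at_right 0)"
    \<comment> \<open>The case p = 1, r = 1 with \<phi> the identity. From \<open>ball a s\<close> a
      kernel of radius below s does not reach beyond \<open>cball a (2 * s)\<close>.\<close>
    proof (rule mol_compose_tendsto[where E = ?E and C = 0 and c = 1 and \<phi> = "\<lambda>_ x. x"])
      have "\<forall>\<^sub>F \<delta> in at_right 0. \<delta> < s" 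
        using eventually_at_rightI[of 0 s "\<lambda>\<delta>. \<delta> < s"] s by simp
      then show "\<forall>\<^sub>F \<delta> in at_right 0. \<forall>x\<in>?S. ball x (\<delta> * 1) \<subseteq> ?E"
      proof eventually_elim
        case (elim \<delta>)
        show ?case
        proof clarify
          fix x y assume xy: "x \<in> ball a s" "y \<in> ball x (\<delta> * 1)"
          then show "y \<in> ?E" using elim dist_triangle[of a y x] by auto
        qed
      qed
      show "\<forall>\<^sub>F \<delta> in at_right 0. \<forall>H :: 'a \<Rightarrow> real. continuous_on UNIV H \<longrightarrow> (\<forall>x. H x \<ge> 0) \<longrightarrow> integrable lborel H \<longrightarrow>
       (\<integral>\<^sup>+x. indicator ?S x * ennreal (H x) \<partial>lborel) \<le> ennreal 1 * (\<integral>\<^sup>+x. ennreal (H x) \<partial>lborel)"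
        by (auto intro!: always_eventually nn_integral_mono simp: indicator_def)
      show "integrable lborel (\<lambda>x. norm (h x) powr 1)" using hi by simp
      show "?S \<subseteq> ?E" using s by auto
    qed (use h in auto)
    moreover have "\<forall>\<^sub>F \<delta> in at_right 0. (\<integral>\<^sup>+x. indicator ?S x * ennreal (norm (mol (\<delta> * 1) h x - h x) powr 1) \<partial>lborel)
        = (\<integral>\<^sup>+x. indicator ?S x * ennreal (norm (h x)) \<partial>lborel)"
    proof -
      have "\<forall>\<^sub>F \<delta> in at_right 0. \<delta> < s" 
        using eventually_at_rightI[of 0 s "\<lambda>\<delta>. \<delta> < s"] s by simp
      with eventually_at_right_less[of 0] show ?thesis
      proof eventually_elim
        case (elim \<delta>)
        show ?case
          by (rule nn_integral_cong) (use mol0 elim in \<open>simp add: indicator_def\<close>)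
      qed
    qed
    ultimately have "((\<lambda>\<delta>::real. \<integral>\<^sup>+x. indicator ?S x * ennreal (norm (h x)) \<partial>lborel) \<longlongrightarrow> 0) (at_right 0)"
      by (simp add: tendsto_cong)
    then have "(\<integral>\<^sup>+x. indicator ?S x * ennreal (norm (h x)) \<partial>lborel) = 0"
      by (simp add: tendsto_const_iff)
    moreover have "(\<lambda>x. indicator ?S x * ennreal (norm (h x))) \<in> borel_measurable lborel"
    proof -
      note h(1)[measurable]
      have [measurable]: "?S \<in> sets borel" by simp
      show ?thesis by measurable
    qed
    ultimately have "AE x in lborel. indicator ?S x * ennreal (norm (h x)) = 0"
      by (simp only: nn_integral_0_iff_AE)
    with h(2) show ?thesis
    proof eventually_elim
      case (elim x)
      have "x \<in> ?S \<Longrightarrow> x \<in> ?E" using s by auto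
      then show ?case using elim by (auto simp: indicator_def split: if_splits)
    qed
  qed
  define F where "F = {ball a s | a s. s > 0 \<and> cball a (2 * s) \<subseteq> D}"
  have "\<And>S. S \<in> F \<Longrightarrow> open S" by (auto simp: F_def)
  then obtain F' where F': "F' \<subseteq> F" "countable F'" "\<Union>F' = \<Union>F" by (rule Lindelof)
  have "D \<subseteq> \<Union>F"
  proof
    fix x assume "x \<in> D"
    with D obtain e where "e > 0" "cball x e \<subseteq> D" by (meson open_contains_cball)
    then have "ball x (e / 2) \<in> F" "x \<in> ball x (e / 2)"
      by (auto simp: F_def intro!: exI[of _ x] exI[of _ "e / 2"])
    then show "x \<in> \<Union>F" by blast
  qed
  have "AE x in lborel. \<forall>S\<in>F'. x \<in> S \<longrightarrow> f x = 0"
    unfolding AE_ball_countable[OF F'(2)] using F'(1) loc by (auto simp: F_def)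
  then show ?thesis
  proof eventually_elim
    case (elim x)
    show ?case
    proof
      assume "x \<in> D"
      with \<open>D \<subseteq> \<Union>F\<close> F'(3) have "x \<in> \<Union>F'" by (metis subsetD)
      with elim show "f x = 0" by auto
    qed
  qed
qed

subsection \<open>Change of variables and local invertibility\<close>

text \<open>By \<open>det\<close> the integrand is at most c times |det| H(\<phi> x), whose integral
  over S is that of H over the image of S. As H is nonnegative, the image may be enlarged to the
  whole space.\<close>

lemma nn_integral_compose_le:
  fixes \<phi> :: "real^'n::{finite,wellorder} \<Rightarrow> real^'n::_" and H :: "real^'n::_ \<Rightarrow> real"
  assumes S: "S \<in> sets borel" and der: "\<And>x. x \<in> S \<Longrightarrow> (\<phi> has_derivative \<phi>' x) (at x)"
    and inj: "inj_on \<phi> S" and det: "\<And>x. x \<in> S \<Longrightarrow> 1 \<le> c * \<bar>det (matrix (\<phi>' x))\<bar>" and c: "c \<ge> 0"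
    and H: "integrable lborel H" "\<And>x. H x \<ge> 0"
  shows "(\<integral>\<^sup>+x. indicator S x * ennreal (H (\<phi> x)) \<partial>lborel) \<le> ennreal c * (\<integral>\<^sup>+x. ennreal (H x) \<partial>lborel)"
proof -
  have Sl: "S \<in> sets lebesgue" using S by auto
  have der': "(\<phi> has_derivative \<phi>' x) (at x within S)" if "x \<in> S" for x
    using der[OF that] by (rule has_derivative_at_withinI)
  have im: "\<phi> ` S \<in> sets lebesgue"
    using der' by (intro differentiable_image_in_sets_lebesgue Sl) (auto simp: differentiable_on_def differentiable_def)
  have Hl: "integrable lebesgue H" using H(1) by (simp add: integrable_completion)
  have "set_integrable lebesgue (\<phi> ` S) H"
    unfolding set_integrable_def using im Hl by (intro integrable_mult_indicator)
  \<comment> \<open>The change of variables formula concerns vector-valued integrands; H enters it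
    as a function into \<open>real^1\<close>.\<close>
  then have abs: "(\<lambda>x. vec (H x) :: real^1) absolutely_integrable_on (\<phi> ` S)"
    by (simp add: absolutely_integrable_on_1_iff)
  let ?G = "\<lambda>x. \<bar>det (matrix (\<phi>' x))\<bar> * H (\<phi> x)"
  from has_absolute_integral_change_of_variables[OF Sl der' inj, of "\<lambda>x. vec (H x) :: real^1" "integral (\<phi> ` S) (\<lambda>x. vec (H x))"] abs
  have G: "set_integrable lebesgue S ?G" "integral S ?G = integral (\<phi> ` S) H"
    by (auto simp: absolutely_integrable_on_1_iff integral_on_1_eq vec_eq_iff)
  have "(\<integral>\<^sup>+x. indicator S x * ennreal (H (\<phi> x)) \<partial>lborel) = (\<integral>\<^sup>+x. indicator S x * ennreal (H (\<phi> x)) \<partial>lebesgue)"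
    by (simp add: nn_integral_completion)
  also have "\<dots> \<le> (\<integral>\<^sup>+x. ennreal c * ennreal (indicator S x *\<^sub>R ?G x) \<partial>lebesgue)"
  proof (rule nn_integral_mono)
    fix x
    show "indicator S x * ennreal (H (\<phi> x)) \<le> ennreal c * ennreal (indicator S x *\<^sub>R ?G x)"
    proof (cases "x \<in> S")
      case True
      have "1 * H (\<phi> x) \<le> (c * \<bar>det (matrix (\<phi>' x))\<bar>) * H (\<phi> x)"
        by (rule mult_right_mono[OF det[OF True] H(2)])
      then have "H (\<phi> x) \<le> c * ?G x" by (simp add: mult.assoc)
      then show ?thesis using True c H(2) by (simp add: ennreal_mult[symmetric] ennreal_leI)
    qed simp
  qed
  also have "\<dots> = ennreal c * (\<integral>\<^sup>+x. ennreal (indicator S x *\<^sub>R ?G x) \<partial>lebesgue)"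
    using G(1) by (intro nn_integral_cmult) (auto simp: set_integrable_def)
  also have "(\<integral>\<^sup>+x. ennreal (indicator S x *\<^sub>R ?G x) \<partial>lebesgue) = ennreal (LINT x|lebesgue. indicator S x *\<^sub>R ?G x)"
    using G(1) H(2) by (intro nn_integral_eq_integral) (auto simp: set_integrable_def)
  also have "(LINT x|lebesgue. indicator S x *\<^sub>R ?G x) = integral (\<phi> ` S) H"
    using set_lebesgue_integral_eq_integral(2)[OF G(1)] G(2) by (simp add: set_lebesgue_integral_def)
  also have "\<dots> = (LINT x|lebesgue. indicator (\<phi> ` S) x *\<^sub>R H x)"
    using set_lebesgue_integral_eq_integral(2)[OF \<open>set_integrable lebesgue (\<phi> ` S) H\<close>] by (simp add: set_lebesgue_integral_def)
  also have "ennreal c * ennreal \<dots> \<le> ennreal c * ennreal (LINT x|lebesgue. H x)"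
    using im Hl H(2)
    by (intro mult_left_mono ennreal_leI integral_mono integrable_mult_indicator) (auto simp: indicator_def)
  also have "(LINT x|lebesgue. H x) = (LINT x|lborel. H x)" using H(1) by (simp add: integral_completion)
  also have "ennreal \<dots> = (\<integral>\<^sup>+x. ennreal (H x) \<partial>lborel)"
    by (rule nn_integral_eq_integral[symmetric]) (use H in auto)
  finally show ?thesis .
qed

section \<open>Inverse matrices, open images and closed balls\<close>

lemma
  fixes A :: "real^'n^'n"
  assumes "invertible A"
  shows matrix_inv_right: "A ** matrix_inv A = mat 1" and matrix_inv_left: "matrix_inv A ** A = mat 1"
proof -
  have "A ** matrix_inv A = mat 1 \<and> matrix_inv A ** A = mat 1"
    using assms unfolding invertible_def matrix_inv_def by (rule someI_ex)
  then show "A ** matrix_inv A = mat 1" "matrix_inv A ** A = mat 1" by auto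
qed

text \<open>Sussmann's open mapping theorem: a continuous map whose derivative at x has a right
  inverse maps neighbourhoods of x onto neighbourhoods of the image point.\<close>

lemma open_image_invertible_derivative:
  fixes \<phi> :: "real^'n \<Rightarrow> real^'n"
  assumes "open S" and der: "\<And>x. x \<in> S \<Longrightarrow> (\<phi> has_derivative (\<lambda>v. A x *v v)) (at x)"
    and inv: "\<And>x. x \<in> S \<Longrightarrow> invertible (A x)"
  shows "open (\<phi> ` S)"
proof -
  have "\<phi> x \<in> interior (\<phi> ` S)" if x: "x \<in> S" for x
  proof (rule sussmann_open_mapping[OF \<open>open S\<close> _ x der[OF x]])
    show "continuous_on S \<phi>"
      by (intro continuous_at_imp_continuous_on ballI has_derivative_continuous[OF der])
    show "bounded_linear (\<lambda>v. matrix_inv (A x) *v v)" by (rule matrix_vector_mul_bounded_linear)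
    show "(\<lambda>v. A x *v v) \<circ> (\<lambda>v. matrix_inv (A x) *v v) = id"
      using matrix_inv_right[OF inv[OF x]] by (auto simp: matrix_vector_mul_assoc)
  qed (use \<open>open S\<close> x in \<open>auto simp: interior_open\<close>)
  then have "\<phi> ` S \<subseteq> interior (\<phi> ` S)" by blast
  then show ?thesis by (metis interior_subset open_interior subset_antisym)
qed

text \<open>Move the centre slightly towards z: it stays in the open set C, and z lies in the open
  ball about the new centre.\<close>

lemma cball_subset_of_open_centres:
  fixes D :: "'a::real_normed_vector set"
  assumes "open C" "\<And>c. c \<in> C \<Longrightarrow> ball c \<epsilon> \<subseteq> D" "\<epsilon> > 0" "c \<in> C"
  shows "cball c \<epsilon> \<subseteq> D"
proof
  fix z assume z: "z \<in> cball c \<epsilon>"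
  obtain e where e: "e > 0" "ball c e \<subseteq> C" using assms(1,4) by (meson open_contains_ball)
  \<comment> \<open>t > 0 brings z strictly within \<epsilon> of the new centre, and t \<epsilon> <
    e keeps that centre in C.\<close>
  define t where "t = min 1 (e / (2 * \<epsilon>))"
  have t: "0 < t" "t \<le> 1" "t * \<epsilon> < e"
    using e(1) \<open>\<epsilon> > 0\<close> by (auto simp: t_def min_def field_simps)
  define y where "y = c + t *\<^sub>R (z - c)"
  have zc: "norm (z - c) \<le> \<epsilon>" using z by (simp add: dist_norm norm_minus_commute)
  have "dist c y = t * norm (z - c)" using t by (simp add: y_def dist_norm)
  also have "\<dots> \<le> t * \<epsilon>" using t zc by (intro mult_left_mono) auto
  finally have "y \<in> C" using t e by auto
  have "y - z = (1 - t) *\<^sub>R (c - z)" by (simp add: y_def algebra_simps)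
  then have "dist y z = (1 - t) * norm (z - c)" using t by (simp add: dist_norm norm_minus_commute)
  also have "\<dots> \<le> (1 - t) * \<epsilon>" using t zc by (intro mult_left_mono) auto
  also have "\<dots> < \<epsilon>" using t \<open>\<epsilon> > 0\<close> by simp
  finally show "z \<in> D" using assms(2)[OF \<open>y \<in> C\<close>] by auto
qed

subsection \<open>Symmetry of second derivatives\<close>

text \<open>The second difference of f along u and v is symmetric in u and v. Two applications of
  the mean value theorem, in either order, express it as s^2 times a mixed derivative at a nearby
  point, and continuity lets s tend to 0.\<close>

lemma symmetric_second_derivative:
  fixes f :: "'a::real_normed_vector \<Rightarrow> real"
  assumes f: "\<And>x. (f has_derivative F x) (at x)"
    and u: "\<And>x. ((\<lambda>x. F x u) has_derivative Hu x) (at x)" and v: "\<And>x. ((\<lambda>x. F x v) has_derivative Hv x) (at x)"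
    and cu: "continuous_on UNIV (\<lambda>x. Hu x v)" and cv: "continuous_on UNIV (\<lambda>x. Hv x u)"
  shows "Hu x v = Hv x u"
proof -
  have quot: "\<exists>a b. 0 \<le> a \<and> a \<le> s \<and> 0 \<le> b \<and> b \<le> s \<and>
      f (x + s *\<^sub>R u + s *\<^sub>R v) - f (x + s *\<^sub>R u) - f (x + s *\<^sub>R v) + f x = s * (s * G (x + a *\<^sub>R u + b *\<^sub>R v) v)"
    if s: "s > 0" and G: "\<And>x. ((\<lambda>x. F x u) has_derivative G x) (at x)" for s u v G
  proof -
    define P where "P y = f (y + s *\<^sub>R v) - f y" for y
    have "(P has_derivative (\<lambda>h. F (y + s *\<^sub>R v) h - F y h)) (at y)" for y
    proof -
      have "((\<lambda>y. f (y + s *\<^sub>R v)) has_derivative (\<lambda>h. F (y + s *\<^sub>R v) h)) (at y)"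
        by (rule has_derivative_compose[OF _ f]) (auto intro!: derivative_eq_intros)
      then show ?thesis unfolding P_def by (intro has_derivative_diff f)
    qed
    from directional_mean_value[OF this s, of x u] obtain a where
      a: "0 < a" "a < s" "P (x + s *\<^sub>R u) - P x = s * (F (x + a *\<^sub>R u + s *\<^sub>R v) u - F (x + a *\<^sub>R u) u)"
      by metis
    from directional_mean_value[OF G s, of "x + a *\<^sub>R u" v] obtain b where
      b: "0 < b" "b < s" "F (x + a *\<^sub>R u + s *\<^sub>R v) u - F (x + a *\<^sub>R u) u = s * G (x + a *\<^sub>R u + b *\<^sub>R v) v"
      by metis
    show ?thesis
      by (rule exI[of _ a], rule exI[of _ b]) (use a b in \<open>auto simp: P_def add_ac\<close>)
  qed
  show ?thesis
  proof (rule ccontr)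
    assume ne: "Hu x v \<noteq> Hv x u"
    define e where "e = \<bar>Hu x v - Hv x u\<bar> / 2"
    have "e > 0" using ne by (simp add: e_def)
    with cu cv obtain d1 d2 where d: "d1 > 0" "\<And>y. dist y x < d1 \<Longrightarrow> \<bar>Hu y v - Hu x v\<bar> < e"
      "d2 > 0" "\<And>y. dist y x < d2 \<Longrightarrow> \<bar>Hv y u - Hv x u\<bar> < e"
      unfolding continuous_on_iff dist_real_def by (metis UNIV_I)
    define N where "N = norm u + norm v + 1"
    \<comment> \<open>Points with both parameters at most s are closer to x than 2 s N, which is
      \<open>min d1 d2\<close>; the 1 in N prevents division by 0.\<close>
    define s where "s = min d1 d2 / (2 * N)"
    have pos: "N > 0" by (simp add: N_def add_nonneg_pos)
    have s: "s > 0" using d pos by (simp add: s_def)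
    have near: "dist (x + a *\<^sub>R u + b *\<^sub>R v) x < min d1 d2" if "0 \<le> a" "a \<le> s" "0 \<le> b" "b \<le> s" for a b
    proof -
      have "dist (x + a *\<^sub>R u + b *\<^sub>R v) x = norm (a *\<^sub>R u + b *\<^sub>R v)" by (simp add: dist_norm)
      also have "\<dots> \<le> a * norm u + b * norm v" using norm_triangle_ineq[of "a *\<^sub>R u" "b *\<^sub>R v"] that by simp
      also have "\<dots> \<le> s * norm u + s * norm v" using that by (intro add_mono mult_right_mono) auto
      also have "\<dots> < 2 * (s * N)"
        using s mult_nonneg_nonneg[OF less_imp_le[OF s] norm_ge_zero[of u]]
          mult_nonneg_nonneg[OF less_imp_le[OF s] norm_ge_zero[of v]]
        unfolding N_def distrib_left by linarith
      also have "\<dots> = min d1 d2" using pos by (simp add: s_def)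
      finally show ?thesis .
    qed
    from quot[OF s u, of v] obtain a b where ab: "0 \<le> a" "a \<le> s" "0 \<le> b" "b \<le> s"
      "f (x + s *\<^sub>R u + s *\<^sub>R v) - f (x + s *\<^sub>R u) - f (x + s *\<^sub>R v) + f x = s * (s * Hu (x + a *\<^sub>R u + b *\<^sub>R v) v)"
      by blast
    from quot[OF s v, of u] obtain a' b' where ab': "0 \<le> a'" "a' \<le> s" "0 \<le> b'" "b' \<le> s"
      "f (x + s *\<^sub>R v + s *\<^sub>R u) - f (x + s *\<^sub>R v) - f (x + s *\<^sub>R u) + f x = s * (s * Hv (x + a' *\<^sub>R v + b' *\<^sub>R u) u)"
      by blast
    have "s * (s * Hu (x + a *\<^sub>R u + b *\<^sub>R v) v) = s * (s * Hv (x + a' *\<^sub>R v + b' *\<^sub>R u) u)"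
    proof -
      have comm: "x + s *\<^sub>R u + s *\<^sub>R v = x + s *\<^sub>R v + s *\<^sub>R u" by (simp add: add_ac)
      show ?thesis using ab(5)[unfolded comm] ab'(5) by linarith
    qed
    then have "Hu (x + a *\<^sub>R u + b *\<^sub>R v) v = Hv (x + b' *\<^sub>R u + a' *\<^sub>R v) u"
      using s by (simp add: add_ac)
    moreover have "\<bar>Hu (x + a *\<^sub>R u + b *\<^sub>R v) v - Hu x v\<bar> < e"
      using near[OF ab(1-4)] by (intro d(2)) simp
    moreover have "\<bar>Hv (x + b' *\<^sub>R u + a' *\<^sub>R v) u - Hv x u\<bar> < e"
      using near[OF ab'(3,4,1,2)] by (intro d(4)) simp
    moreover have "\<bar>Hu x v - Hv x u\<bar> = 2 * e" by (simp add: e_def)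
    ultimately show False by linarith
  qed
qed

subsection \<open>Representatives of \<open>L\<^sup>p\<close> functions\<close>

text \<open>The extension of f by zero, in a Borel version: integrability over \<open>lborel\<close>
  includes Borel measurability, whereas f is only Lebesgue measurable on D with meaningless values
  outside.\<close>

definition represents :: "'a::euclidean_space set \<Rightarrow> ('a \<Rightarrow> 'b::euclidean_space) \<Rightarrow> ('a \<Rightarrow> 'b) \<Rightarrow> bool" where
  "represents D h f \<longleftrightarrow> (AE w in lborel. w \<in> D \<longrightarrow> h w = f w) \<and> (\<forall>w. w \<notin> D \<longrightarrow> h w = 0) \<and> integrable lborel h"

lemma representsD:
  assumes "represents D h f"
  shows "AE w in lborel. w \<in> D \<longrightarrow> h w = f w" "integrable lborel h" "w \<notin> D \<Longrightarrow> h w = 0"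
  using assms by (auto simp: represents_def)

text \<open>A general integrand B covers products, inner products and components alike;
  \<open>B w 0 = 0\<close> makes it vanish off D together with h.\<close>

lemma integral_on_representative:
  fixes B :: "'a::euclidean_space \<Rightarrow> 'b::euclidean_space \<Rightarrow> 'c::euclidean_space"
  assumes D: "D \<in> sets lebesgue" and h: "represents D h f" and B: "\<And>w. B w 0 = 0" and int: "integrable lborel (\<lambda>w. B w (h w))"
  shows "integrable (lebesgue_on D) (\<lambda>w. B w (f w))"
    and "(LINT w|lebesgue_on D. B w (f w)) = (LINT w|lborel. B w (h w))"
proof -
  have "AE w in lborel. B w (h w) = (if w \<in> D then B w (f w) else 0)"
    using representsD(1)[OF h] by eventually_elim (auto simp: representsD(3)[OF h] B)
  note * = integrable_lebesgue_AE[OF int this] integral_lebesgue_AE[OF int this]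
  show "integrable (lebesgue_on D) (\<lambda>w. B w (f w))"
    using *(1) by (simp add: integrable_lebesgue_on_if[OF D])
  show "(LINT w|lebesgue_on D. B w (f w)) = (LINT w|lborel. B w (h w))"
    using *(2) by (simp add: integral_lebesgue_on_if[OF D])
qed

lemma Lp_representative:
  fixes f :: "'a::euclidean_space \<Rightarrow> 'b::euclidean_space"
  assumes f: "f \<in> Lp p D" and D: "open D" "bounded D" and p: "p \<ge> 1"
  obtains h where "represents D h f" "integrable lborel (\<lambda>w. norm (h w) powr p)"
proof -
  have Ds: "D \<in> sets borel" and Dl: "D \<in> sets lebesgue" using D by auto
  have fm: "f \<in> borel_measurable (lebesgue_on D)" and fi: "integrable (lebesgue_on D) (\<lambda>x. norm (f x) powr p)"
    using f by (auto simp: Lp_def)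
  obtain h where h: "h \<in> borel_measurable borel" "AE w in lborel. w \<in> D \<longrightarrow> h w = f w" "\<And>w. w \<notin> D \<Longrightarrow> h w = 0"
    using borel_representative[OF Ds fm] by metis
  have i1: "integrable lebesgue (\<lambda>x. if x \<in> D then norm (f x) powr p else 0)"
    using fi integrable_lebesgue_on_if[OF Dl, of "\<lambda>x. norm (f x) powr p"] by simp
  have "AE x in lborel. (if x \<in> D then norm (f x) powr p else 0) = norm (h x) powr p"
    using h(2) by eventually_elim (auto simp: h(3))
  then have ae: "AE x in lebesgue. (if x \<in> D then norm (f x) powr p else 0) = norm (h x) powr p"
    by (rule AE_completion)
  have m: "(\<lambda>x. norm (h x) powr p) \<in> borel_measurable borel" using h(1) by measurable
  have "integrable lebesgue (\<lambda>x. norm (h x) powr p)"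
    using m by (intro integrable_cong_AE_imp[OF i1 _ ae] measurable_completion) simp
  then have hp: "integrable lborel (\<lambda>x. norm (h x) powr p)"
    using m by (simp add: integrable_completion)
  show ?thesis
    using that hp h integrable_if_powr_integrable[OF Ds D(2) h(1,3) hp p] unfolding represents_def by blast
qed

lemma Lp_locally_integrable:
  fixes f :: "'a::euclidean_space \<Rightarrow> 'b::euclidean_space"
  assumes f: "f \<in> Lp p D" and D: "open D" "bounded D" and p: "p \<ge> 1"
  shows "locally_integrable D f"
proof -
  obtain h where h: "represents D h f"
    using Lp_representative[OF assms] by metis
  have Dl: "D \<in> sets lebesgue" using D by auto
  have "integrable (lebesgue_on D) f"
    by (rule integral_on_representative(1)[OF Dl h, of "\<lambda>_ x. x"]) (simp_all add: representsD(2)[OF h])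
  then have i: "integrable lebesgue (\<lambda>x. if x \<in> D then f x else 0)"
    by (simp add: integrable_lebesgue_on_if[OF Dl])
  show ?thesis
    unfolding locally_integrable_def
  proof safe
    fix C assume C: "compact C" "C \<subseteq> D"
    have Cl: "C \<in> sets lebesgue" using fmeasurableD[OF lmeasurable_compact[OF C(1)]] .
    have "integrable lebesgue (\<lambda>x. indicator C x *\<^sub>R (if x \<in> D then f x else 0))"
      by (rule integrable_mult_indicator[OF Cl i])
    also have "(\<lambda>x. indicator C x *\<^sub>R (if x \<in> D then f x else 0)) = (\<lambda>x. if x \<in> C then f x else 0)"
      by (intro ext) (use C(2) in \<open>auto simp: indicator_def\<close>)
    finally show "integrable (lebesgue_on C) f"
      by (simp add: integrable_lebesgue_on_if[OF Cl])
  qed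
qed

lemma Lp_diff:
  fixes f g :: "'a::euclidean_space \<Rightarrow> 'b::euclidean_space"
  assumes "f \<in> Lp p D" "g \<in> Lp p D" "p \<ge> 1"
  shows "(\<lambda>x. f x - g x) \<in> Lp p D"
proof -
  have m: "f \<in> borel_measurable (lebesgue_on D)" "g \<in> borel_measurable (lebesgue_on D)"
    and i: "integrable (lebesgue_on D) (\<lambda>x. norm (f x) powr p)" "integrable (lebesgue_on D) (\<lambda>x. norm (g x) powr p)"
    using assms by (auto simp: Lp_def)
  have "integrable (lebesgue_on D) (\<lambda>x. norm (f x - g x) powr p)"
  proof (rule Bochner_Integration.integrable_bound)
    show "integrable (lebesgue_on D) (\<lambda>x. 2 powr p * (norm (f x) powr p + norm (g x) powr p))"
      using i by (intro integrable_mult_right Bochner_Integration.integrable_add)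
    show "AE x in lebesgue_on D. norm (norm (f x - g x) powr p) \<le> norm (2 powr p * (norm (f x) powr p + norm (g x) powr p))"
    proof (rule AE_I2)
      fix x
      show "norm (norm (f x - g x) powr p) \<le> norm (2 powr p * (norm (f x) powr p + norm (g x) powr p))"
        using norm_add_powr_le[of p "f x" "- g x"] \<open>p \<ge> 1\<close> by simp
    qed
  qed (use m in measurable)
  with m show ?thesis by (simp add: Lp_def)
qed

lemma Lp_bounded_continuous:
  fixes f :: "'a::euclidean_space \<Rightarrow> 'b::euclidean_space"
  assumes D: "open D" "bounded D" and f: "continuous_on (closure D) f" and g: "\<And>x. x \<in> D \<Longrightarrow> g x = f x" and p: "p \<ge> 1"
  shows "g \<in> Lp p D"
proof -
  have Dl: "D \<in> sets lebesgue" and Db: "D \<in> sets borel" using D by auto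
  have "compact (f ` closure D)" using f D by (intro compact_continuous_image) auto
  from compact_imp_bounded[OF this] obtain B where "\<forall>y\<in>f ` closure D. norm y \<le> B"
    unfolding bounded_pos by blast
  then have B: "norm (f x) \<le> B" if "x \<in> D" for x
    using that closure_subset[of D] by blast
  have m: "f \<in> borel_measurable (lebesgue_on D)"
    by (rule continuous_imp_measurable_on_sets_lebesgue[OF continuous_on_subset[OF f closure_subset] Dl])
  have fi: "integrable (lebesgue_on D) (\<lambda>x. norm (f x) powr p)"
  proof (rule Bochner_Integration.integrable_bound)
    show "integrable (lebesgue_on D) (\<lambda>x. B powr p)"
      by (rule finite_measure.integrable_const[OF finite_measure_lebesgue_on[OF bounded_set_imp_lmeasurable[OF D(2) Dl]]])
    show "AE x in lebesgue_on D. norm (norm (f x) powr p) \<le> norm (B powr p)"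
      using B p by (intro AE_I2) (auto intro!: powr_mono2)
  qed (use m in measurable)
  have "g \<in> borel_measurable (lebesgue_on D) \<longleftrightarrow> f \<in> borel_measurable (lebesgue_on D)"
    by (rule measurable_cong) (simp add: g)
  moreover have "integrable (lebesgue_on D) (\<lambda>x. norm (g x) powr p) \<longleftrightarrow> integrable (lebesgue_on D) (\<lambda>x. norm (f x) powr p)"
    by (rule Bochner_Integration.integrable_cong[OF refl]) (simp add: g)
  ultimately show ?thesis
    using m fi by (simp add: Lp_def)
qed

text \<open>g will be a weak derivative picked by choice; completeness of Lebesgue measure gives it
  the measurability of f.\<close>

lemma Lp_norm_cong_AE:
  fixes f g :: "'a::euclidean_space \<Rightarrow> 'b::euclidean_space"
  assumes D: "open D" and f: "f \<in> Lp p D" and ae: "AE x in lborel. x \<in> D \<longrightarrow> f x = g x"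
  shows "Lp_norm p D f = Lp_norm p D g"
proof -
  have Dl: "D \<in> sets lebesgue" using D by auto
  let ?f = "\<lambda>x. if x \<in> D then norm (f x) powr p else 0"
  let ?g = "\<lambda>x. if x \<in> D then norm (g x) powr p else 0"
  have "AE x in lborel. ?f x = ?g x" using ae by eventually_elim auto
  then have ae': "AE x in lebesgue. ?f x = ?g x" by (rule AE_completion)
  have "integrable lebesgue ?f"
    using f integrable_lebesgue_on_if[OF Dl, of "\<lambda>x. norm (f x) powr p"] by (simp add: Lp_def)
  then have m: "?f \<in> borel_measurable lebesgue" by auto
  have "integral\<^sup>L lebesgue ?f = integral\<^sup>L lebesgue ?g"
    by (rule integral_cong_AE[OF m borel_measurable_AE[OF m ae'] ae'])
  then show ?thesis
    unfolding Lp_norm_def integral_lebesgue_on_if[OF Dl] by simp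
qed

subsection \<open>Weak derivatives of mollifications\<close>

text \<open>The derivative of \<open>mol \<epsilon> h\<close> at z along v, kept as an integral to
  be compared with h tested against a derivative of the kernel.\<close>

definition mol_partial :: "real \<Rightarrow> 'a::euclidean_space \<Rightarrow> ('a \<Rightarrow> 'b::euclidean_space) \<Rightarrow> 'a \<Rightarrow> 'b" where
  "mol_partial \<epsilon> v h z = (LINT w|lborel. (- (mol_grad \<epsilon> (w - z) \<bullet> v)) *\<^sub>R h w)"

lemma mol_has_derivative_partial:
  fixes h :: "'a::euclidean_space \<Rightarrow> 'b::euclidean_space"
  assumes "\<epsilon> > 0" "integrable lborel h"
  shows "(mol \<epsilon> h has_derivative (\<lambda>v. mol_partial \<epsilon> v h z)) (at z)"
  unfolding mol_partial_def by (rule mol_has_derivative[OF assms])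

lemma mol_partial_continuous:
  fixes h :: "'a::euclidean_space \<Rightarrow> 'b::euclidean_space"
  assumes "\<epsilon> > 0" "integrable lborel h"
  shows "continuous_on UNIV (mol_partial \<epsilon> v h)"
  unfolding mol_partial_def[abs_def] by (rule mol_derivative_continuous[OF assms])

lemma mol_partial_expand:
  fixes h :: "real^'n \<Rightarrow> 'b::euclidean_space"
  assumes "\<epsilon> > 0" "integrable lborel h"
  shows "mol_partial \<epsilon> v h z = (\<Sum>l\<in>UNIV. v $ l *\<^sub>R mol_partial \<epsilon> (axis l 1) h z)"
proof -
  have lin: "linear (\<lambda>v. mol_partial \<epsilon> v h z)"
    by (rule has_derivative_linear[OF mol_has_derivative_partial[OF assms]])
  have "mol_partial \<epsilon> v h z = mol_partial \<epsilon> (\<Sum>l\<in>UNIV. (v $ l) *\<^sub>R axis l 1) h z"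
    by (simp add: basis_expansion[of v, unfolded scalar_mult_eq_scaleR])
  also have "\<dots> = (\<Sum>l\<in>UNIV. v $ l *\<^sub>R mol_partial \<epsilon> (axis l 1) h z)"
    by (simp add: linear_sum[OF lin] linear_scale[OF lin])
  finally show ?thesis .
qed

lemma mol_grad_integrable:
  fixes h :: "'a::euclidean_space \<Rightarrow> 'b::euclidean_space"
  assumes \<epsilon>: "\<epsilon> > 0" and h: "integrable lborel h"
  shows "integrable lborel (\<lambda>w. (mol_grad \<epsilon> (w - z) \<bullet> v) *\<^sub>R h w)"
proof -
  have c: "continuous_on UNIV (\<lambda>u. mol_grad \<epsilon> u \<bullet> v)"
    by (intro continuous_intros mol_grad_continuous[OF \<epsilon>])
  have z: "mol_grad \<epsilon> u \<bullet> v = 0" if "norm u > \<epsilon>" for u :: 'a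
    using that by (simp add: mol_grad_eq_0[OF \<epsilon>])
  obtain B where "\<And>u. norm (mol_grad \<epsilon> u \<bullet> v) \<le> B"
    using bounded_bounded_support[OF c z] by metis
  then show ?thesis
    by (intro convolution_integrable[OF c _ h, of B]) auto
qed

lemma mol_partial_minus:
  fixes h :: "'a::euclidean_space \<Rightarrow> 'b::euclidean_space"
  assumes \<epsilon>: "\<epsilon> > 0"
  shows "(LINT w|lborel. (mol_grad \<epsilon> (w - z) \<bullet> v) *\<^sub>R h w) = - mol_partial \<epsilon> v h z"
  unfolding mol_partial_def by simp

lemma mol_kernel_scaleR_has_derivative:
  assumes \<epsilon>: "\<epsilon> > 0"
  shows "((\<lambda>w. mol_kernel \<epsilon> (w - z) *\<^sub>R e) has_derivative (\<lambda>v. (mol_grad \<epsilon> (w - z) \<bullet> v) *\<^sub>R e)) (at w)"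
proof (rule has_derivative_scaleR_left)
  show "((\<lambda>w. mol_kernel \<epsilon> (w - z)) has_derivative (\<lambda>v. mol_grad \<epsilon> (w - z) \<bullet> v)) (at w)"
    by (rule has_derivative_compose[OF _ mol_kernel_has_derivative[OF \<epsilon>]]) (auto intro!: derivative_eq_intros)
qed

lemma gradient_eqI: "(f has_derivative (\<lambda>v. g \<bullet> v)) (at x) \<Longrightarrow> gradient f x = g"
  by (simp add: gradient_def frechet_derivative_at[symmetric] vec_eq_iff inner_axis)

text \<open>The test function is the kernel centred at z. Its gradient in w is minus the gradient in
  z, and this sign cancels the one in the definition of the weak gradient.\<close>

lemma mol_weak_gradient:
  fixes f :: "real^'n \<Rightarrow> real"
  assumes \<epsilon>: "\<epsilon> > 0" and D: "open D" "cball z \<epsilon> \<subseteq> D" and w: "has_weak_gradient D f G"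
    and f: "represents D hf f" and G: "represents D hG G"
  shows "mol_partial \<epsilon> v hf z = mol \<epsilon> hG z \<bullet> v"
proof -
  have Dl: "D \<in> sets lebesgue" using D by auto
  let ?\<psi> = "\<lambda>w. mol_kernel \<epsilon> (w - z) *\<^sub>R (1::real)"
  have grad: "gradient ?\<psi> w = mol_grad \<epsilon> (w - z)" for w
    by (rule gradient_eqI) (use mol_kernel_scaleR_has_derivative[OF \<epsilon>, of z "1::real" w] in simp)
  have t: "test_function D ?\<psi>" by (rule test_function_mol_kernel[OF \<epsilon> D(2)])
  have comp: "mol_partial \<epsilon> (axis i 1) hf z = mol \<epsilon> hG z $ i" for i
  proof -
    have "(LINT w|lebesgue_on D. f w * gradient ?\<psi> w $ i) = (LINT w|lborel. hf w * mol_grad \<epsilon> (w - z) $ i)"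
      unfolding grad using mol_grad_integrable[OF \<epsilon> representsD(2)[OF f], of z "axis i 1"]
      by (intro integral_on_representative(2)[OF Dl f, of "\<lambda>w y. y * mol_grad \<epsilon> (w - z) $ i"])
        (auto simp: inner_axis mult.commute)
    also have "\<dots> = - mol_partial \<epsilon> (axis i 1) hf z"
      using mol_partial_minus[OF \<epsilon>, of z "axis i 1" hf] by (simp add: inner_axis mult.commute)
    finally have 1: "(LINT w|lebesgue_on D. f w * gradient ?\<psi> w $ i) = - mol_partial \<epsilon> (axis i 1) hf z" .
    have "(LINT w|lebesgue_on D. G w $ i * ?\<psi> w) = (LINT w|lborel. hG w $ i * ?\<psi> w)"
      using integrable_inner_left[OF mol_integrable[OF \<epsilon> representsD(2)[OF G], of z], of "axis i 1"]
      by (intro integral_on_representative(2)[OF Dl G, of "\<lambda>w y. y $ i * ?\<psi> w"])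
        (auto simp: inner_axis mult.commute)
    also have "\<dots> = mol \<epsilon> hG z $ i"
      using integral_inner_left[OF mol_integrable[OF \<epsilon> representsD(2)[OF G], of z], of "axis i 1"]
      by (simp add: mol_def inner_axis mult.commute)
    finally have 2: "(LINT w|lebesgue_on D. G w $ i * ?\<psi> w) = mol \<epsilon> hG z $ i" .
    have "(LINT w|lebesgue_on D. f w * gradient ?\<psi> w $ i) = - (LINT w|lebesgue_on D. G w $ i * ?\<psi> w)"
      using w t unfolding has_weak_gradient_def by blast
    then show ?thesis unfolding 1 2 by simp
  qed
  show ?thesis
    unfolding mol_partial_expand[OF \<epsilon> representsD(2)[OF f], of v] by (simp add: comp inner_vec_def mult.commute)
qed

lemma mol_weak_div:
  fixes f :: "real^'n \<Rightarrow> real^'n"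
  assumes \<epsilon>: "\<epsilon> > 0" and D: "open D" "cball z \<epsilon> \<subseteq> D" and w: "has_weak_div D f G"
    and f: "represents D hf f" and G: "represents D hG G"
  shows "(\<Sum>i\<in>UNIV. mol_partial \<epsilon> (axis i 1) hf z $ i) = mol \<epsilon> hG z"
proof -
  have Dl: "D \<in> sets lebesgue" using D by auto
  let ?\<psi> = "\<lambda>w. mol_kernel \<epsilon> (w - z) *\<^sub>R (1::real)"
  have grad: "gradient ?\<psi> w = mol_grad \<epsilon> (w - z)" for w
    by (rule gradient_eqI) (use mol_kernel_scaleR_has_derivative[OF \<epsilon>, of z "1::real" w] in simp)
  have t: "test_function D ?\<psi>" by (rule test_function_mol_kernel[OF \<epsilon> D(2)])
  have ii: "integrable lborel (\<lambda>w. hf w $ i * mol_grad \<epsilon> (w - z) $ i)" for i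
    using integrable_inner_left[OF mol_grad_integrable[OF \<epsilon> representsD(2)[OF f], of z "axis i 1"], of "axis i 1"]
    by (simp add: inner_axis mult.commute)
  have eq: "y \<bullet> mol_grad \<epsilon> (w - z) = (\<Sum>i\<in>UNIV. y $ i * mol_grad \<epsilon> (w - z) $ i)" for y w
    by (simp add: inner_vec_def)
  have "(LINT w|lebesgue_on D. f w \<bullet> gradient ?\<psi> w) = (LINT w|lborel. hf w \<bullet> mol_grad \<epsilon> (w - z))"
    unfolding grad using ii
    by (intro integral_on_representative(2)[OF Dl f, of "\<lambda>w y. y \<bullet> mol_grad \<epsilon> (w - z)"])
      (auto simp: eq)
  also have "\<dots> = (\<Sum>i\<in>UNIV. LINT w|lborel. hf w $ i * mol_grad \<epsilon> (w - z) $ i)"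
    unfolding eq by (rule Bochner_Integration.integral_sum) (rule ii)
  also have "\<dots> = (\<Sum>i\<in>UNIV. - mol_partial \<epsilon> (axis i 1) hf z $ i)"
  proof (rule sum.cong[OF refl])
    fix i
    show "(LINT w|lborel. hf w $ i * mol_grad \<epsilon> (w - z) $ i) = - mol_partial \<epsilon> (axis i 1) hf z $ i"
      using integral_inner_left[OF mol_grad_integrable[OF \<epsilon> representsD(2)[OF f], of z "axis i 1"], of "axis i 1"]
        mol_partial_minus[OF \<epsilon>, of z "axis i 1" hf]
      by (simp add: inner_axis mult.commute)
  qed
  finally have 1: "(LINT w|lebesgue_on D. f w \<bullet> gradient ?\<psi> w) = - (\<Sum>i\<in>UNIV. mol_partial \<epsilon> (axis i 1) hf z $ i)"
    by (simp add: sum_negf)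
  have "(LINT w|lebesgue_on D. G w * ?\<psi> w) = (LINT w|lborel. hG w * ?\<psi> w)"
    using mol_integrable[OF \<epsilon> representsD(2)[OF G], of z]
    by (intro integral_on_representative(2)[OF Dl G, of "\<lambda>w y. y * ?\<psi> w"]) (auto simp: mult.commute)
  also have "\<dots> = mol \<epsilon> hG z" by (simp add: mol_def mult.commute)
  finally have 2: "(LINT w|lebesgue_on D. G w * ?\<psi> w) = mol \<epsilon> hG z" .
  have "(LINT w|lebesgue_on D. f w \<bullet> gradient ?\<psi> w) = - (LINT w|lebesgue_on D. G w * ?\<psi> w)"
    using w t unfolding has_weak_div_def by blast
  then show ?thesis unfolding 1 2 by simp
qed

text \<open>The curl read off from the derivative L as a linear map: component k of L applied to
  \<open>axis l 1\<close> is the l-th partial derivative of the k-th component.\<close>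

definition curl_of :: "(real^3 \<Rightarrow> real^3) \<Rightarrow> real^3" where
  "curl_of L = vector [L (axis 2 1) $ 3 - L (axis 3 1) $ 2, L (axis 3 1) $ 1 - L (axis 1 1) $ 3, L (axis 1 1) $ 2 - L (axis 2 1) $ 1]"

lemma curl_eqI: "(f has_derivative f') (at x) \<Longrightarrow> curl f x = curl_of f'"
  by (simp add: curl_def curl_of_def jacobian_def matrix_def frechet_derivative_at[symmetric] Let_def)

text \<open>Testing with the kernel times the k-th unit vector isolates component k; the curl of
  that field is the cross product of the kernel's gradient with the unit vector. The sign from
  differentiating in w instead of z is absorbed by antisymmetry of the cross product, matching a
  weak curl defined without a minus.\<close>

lemma mol_weak_curl:
  fixes f :: "real^3 \<Rightarrow> real^3"
  assumes \<epsilon>: "\<epsilon> > 0" and D: "open D" "cball z \<epsilon> \<subseteq> D" and w: "has_weak_curl D f G"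
    and f: "represents D hf f" and G: "represents D hG G"
  shows "curl_of (\<lambda>v. mol_partial \<epsilon> v hf z) = mol \<epsilon> hG z"
proof -
  have Dl: "D \<in> sets lebesgue" using D by auto
  let ?g = "\<lambda>w. mol_grad \<epsilon> (w - z)"
  have ii: "integrable lborel (\<lambda>w. hf w $ i * ?g w $ k)" for i k
    using integrable_inner_left[OF mol_grad_integrable[OF \<epsilon> representsD(2)[OF f], of z "axis k 1"], of "axis i 1"]
    by (simp add: inner_axis mult.commute)
  have mp: "(LINT w|lborel. hf w $ i * ?g w $ k) = - mol_partial \<epsilon> (axis k 1) hf z $ i" for i k
    using integral_inner_left[OF mol_grad_integrable[OF \<epsilon> representsD(2)[OF f], of z "axis k 1"], of "axis i 1"]
      mol_partial_minus[OF \<epsilon>, of z "axis k 1" hf]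
    by (simp add: inner_axis mult.commute)
  have "curl_of (\<lambda>v. mol_partial \<epsilon> v hf z) $ k = mol \<epsilon> hG z $ k" for k :: 3
  proof -
    let ?\<psi> = "\<lambda>w. mol_kernel \<epsilon> (w - z) *\<^sub>R (axis k 1 :: real^3)"
    have curl: "curl ?\<psi> w = curl_of (\<lambda>v. (?g w \<bullet> v) *\<^sub>R axis k 1)" for w
      by (rule curl_eqI[OF mol_kernel_scaleR_has_derivative[OF \<epsilon>]])
    have t: "test_function D ?\<psi>" by (rule test_function_mol_kernel[OF \<epsilon> D(2)])
    have eq: "y \<bullet> curl_of (\<lambda>v. (?g w \<bullet> v) *\<^sub>R axis k 1) =
        (if k = 1 then y $ 2 * ?g w $ 3 - y $ 3 * ?g w $ 2 else
         if k = 2 then y $ 3 * ?g w $ 1 - y $ 1 * ?g w $ 3 else y $ 1 * ?g w $ 2 - y $ 2 * ?g w $ 1)" for y w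
      using exhaust_3[of k] by (auto simp: curl_of_def inner_vec_def sum_3 vector_3 inner_axis axis_def)
    have "(LINT w|lebesgue_on D. f w \<bullet> curl ?\<psi> w) = (LINT w|lborel. hf w \<bullet> curl_of (\<lambda>v. (?g w \<bullet> v) *\<^sub>R axis k 1))"
      unfolding curl using ii exhaust_3[of k]
      by (intro integral_on_representative(2)[OF Dl f, of "\<lambda>w y. y \<bullet> curl_of (\<lambda>v. (?g w \<bullet> v) *\<^sub>R axis k 1)"])
        (auto simp: eq)
    also have "\<dots> = curl_of (\<lambda>v. mol_partial \<epsilon> v hf z) $ k"
      unfolding eq using exhaust_3[of k] ii by (auto simp: mp curl_of_def)
    finally have 1: "(LINT w|lebesgue_on D. f w \<bullet> curl ?\<psi> w) = curl_of (\<lambda>v. mol_partial \<epsilon> v hf z) $ k" .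
    have "(LINT w|lebesgue_on D. G w \<bullet> ?\<psi> w) = (LINT w|lborel. hG w \<bullet> ?\<psi> w)"
      using integrable_inner_left[OF mol_integrable[OF \<epsilon> representsD(2)[OF G], of z], of "axis k 1"]
      by (intro integral_on_representative(2)[OF Dl G, of "\<lambda>w y. y \<bullet> ?\<psi> w"]) (auto simp: inner_axis mult.commute)
    also have "\<dots> = mol \<epsilon> hG z $ k"
      using integral_inner_left[OF mol_integrable[OF \<epsilon> representsD(2)[OF G], of z], of "axis k 1"]
      by (simp add: mol_def inner_axis mult.commute)
    finally have 2: "(LINT w|lebesgue_on D. G w \<bullet> ?\<psi> w) = mol \<epsilon> hG z $ k" .
    have "(LINT w|lebesgue_on D. f w \<bullet> curl ?\<psi> w) = (LINT w|lebesgue_on D. G w \<bullet> ?\<psi> w)"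
      using w t unfolding has_weak_curl_def by blast
    then show ?thesis unfolding 1 2 .
  qed
  then show ?thesis by (simp add: vec_eq_iff)
qed

subsection \<open>Classical derivatives are weak derivatives\<close>

lemma test_function_support_mono:
  assumes "test_function D \<psi>" "smooth \<psi>'" "\<And>x. \<psi>' x \<noteq> 0 \<Longrightarrow> x \<in> closure {x. \<psi> x \<noteq> 0}"
  shows "test_function D \<psi>'"
proof -
  let ?K = "closure {x. \<psi> x \<noteq> 0}"
  have K: "compact ?K" "?K \<subseteq> D" using assms(1) by (simp_all add: test_function_def)
  have sub: "{x. \<psi>' x \<noteq> 0} \<subseteq> ?K" by (rule subsetI, rule assms(3)) (simp only: mem_Collect_eq not_False_eq_True)
  have "closure {x. \<psi>' x \<noteq> 0} \<subseteq> ?K" by (rule closure_minimal[OF sub closed_closure])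
  moreover have "compact (closure {x. \<psi>' x \<noteq> 0})"
    unfolding compact_closure by (rule bounded_subset[OF compact_imp_bounded[OF K(1)] sub])
  ultimately show ?thesis
    using K(2) assms(2) unfolding test_function_def by (meson order_trans)
qed

lemma test_function_directional:
  assumes "test_function D \<psi>"
  shows "test_function D (\<lambda>x. frechet_derivative \<psi> (at x) v)"
proof (rule test_function_support_mono[OF assms])
  have s: "smooth \<psi>" using assms by (simp add: test_function_def)
  then show "smooth (\<lambda>x. frechet_derivative \<psi> (at x) v)" by (rule smooth_directional)
  fix x assume ne: "frechet_derivative \<psi> (at x) v \<noteq> 0"
  show "x \<in> closure {x. \<psi> x \<noteq> 0}"
  proof (rule ccontr)
    let ?K = "closure {x. \<psi> x \<noteq> 0}"
    assume "x \<notin> ?K"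
    then have "frechet_derivative \<psi> (at x) = (\<lambda>_. 0)"
      using closure_subset[of "{x. \<psi> x \<noteq> 0}"]
      by (intro has_derivative_0_open[OF smooth_has_derivative[OF s], of "- ?K"]) blast+
    with ne show False by simp
  qed
qed

lemma test_function_bounded_linear:
  assumes T: "bounded_linear T" and \<psi>: "test_function D \<psi>"
  shows "test_function D (\<lambda>x. T (\<psi> x))"
proof (rule test_function_support_mono[OF \<psi>])
  show "smooth (\<lambda>x. T (\<psi> x))"
    using \<psi> by (intro smooth_bounded_linear[OF T]) (simp add: test_function_def)
  fix x assume "T (\<psi> x) \<noteq> 0"
  then have "\<psi> x \<noteq> 0" using linear_0[OF bounded_linear.linear[OF T]] by auto
  then show "x \<in> closure {x. \<psi> x \<noteq> 0}"
    using subsetD[OF closure_subset, of x "{x. \<psi> x \<noteq> 0}"] by simp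
qed

lemma test_function_component: "test_function D \<psi> \<Longrightarrow> test_function D (\<lambda>x. \<psi> x $ k)"
  by (rule test_function_bounded_linear[OF bounded_linear_vec_nth])

lemma integration_by_parts_test_function:
  fixes U \<psi> :: "'a::euclidean_space \<Rightarrow> real"
  assumes D: "open D" and U: "\<And>x. x \<in> D \<Longrightarrow> (U has_derivative U' x) (at x)" "continuous_on D (\<lambda>x. U' x v)"
    and \<psi>: "test_function D \<psi>"
  shows "integrable (lebesgue_on D) (\<lambda>x. U x * frechet_derivative \<psi> (at x) v)"
    and "integrable (lebesgue_on D) (\<lambda>x. U' x v * \<psi> x)"
    and "(LINT x|lebesgue_on D. U x * frechet_derivative \<psi> (at x) v) = - (LINT x|lebesgue_on D. U' x v * \<psi> x)"
proof -
  have s: "smooth \<psi>" and K: "compact (closure {x. \<psi> x \<noteq> 0})" "closure {x. \<psi> x \<noteq> 0} \<subseteq> D"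
    using \<psi> by (auto simp: test_function_def)
  note * = integration_by_parts[of D U U' v \<psi> "\<lambda>x. frechet_derivative \<psi> (at x)", OF D U smooth_has_derivative[OF s] smooth_continuous_on[OF smooth_directional[OF s]] K]
  show "integrable (lebesgue_on D) (\<lambda>x. U x * frechet_derivative \<psi> (at x) v)" by (rule *(1))
  show "integrable (lebesgue_on D) (\<lambda>x. U' x v * \<psi> x)" by (rule *(2))
  show "(LINT x|lebesgue_on D. U x * frechet_derivative \<psi> (at x) v) = - (LINT x|lebesgue_on D. U' x v * \<psi> x)"
    by (rule *(3))
qed

lemma has_weak_gradientI:
  fixes f :: "real^'n \<Rightarrow> real"
  assumes D: "open D" and f: "\<And>x. x \<in> D \<Longrightarrow> (f has_derivative (\<lambda>v. G x \<bullet> v)) (at x)" "continuous_on D G"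
    and "locally_integrable D f" "locally_integrable D G"
  shows "has_weak_gradient D f G"
  unfolding has_weak_gradient_def
proof (intro conjI allI impI assms)
  fix \<psi> :: "real^'n \<Rightarrow> real" and i assume \<psi>: "test_function D \<psi>"
  have "continuous_on D (\<lambda>x. G x \<bullet> axis i 1)" using f(2) by (intro continuous_intros)
  from integration_by_parts_test_function(3)[OF D f(1) this \<psi>]
  show "(LINT x|lebesgue_on D. f x * gradient \<psi> x $ i) = - (LINT x|lebesgue_on D. G x $ i * \<psi> x)"
    by (simp add: gradient_def inner_axis)
qed

lemma has_derivative_component:
  "(f has_derivative f') F \<Longrightarrow> ((\<lambda>x. f x $ i) has_derivative (\<lambda>v. f' v $ i)) F"
  by (rule bounded_linear.has_derivative[OF bounded_linear_vec_nth])

lemma has_weak_divI: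
  fixes f :: "real^'n \<Rightarrow> real^'n"
  assumes D: "open D" and f: "\<And>x. x \<in> D \<Longrightarrow> (f has_derivative f' x) (at x)" "\<And>v. continuous_on D (\<lambda>x. f' x v)"
    and h: "\<And>x. x \<in> D \<Longrightarrow> h x = (\<Sum>i\<in>UNIV. f' x (axis i 1) $ i)"
    and "locally_integrable D f" "locally_integrable D h"
  shows "has_weak_div D f h"
  unfolding has_weak_div_def
proof (intro conjI allI impI assms)
  fix \<psi> :: "real^'n \<Rightarrow> real" assume \<psi>: "test_function D \<psi>"
  have c: "continuous_on D (\<lambda>x. f' x (axis i 1) $ i)" for i using f(2) by (intro continuous_intros)
  note ibp = integration_by_parts_test_function[OF D has_derivative_component[OF f(1)] c \<psi>]
  have "(LINT x|lebesgue_on D. f x \<bullet> gradient \<psi> x) = (LINT x|lebesgue_on D. (\<Sum>i\<in>UNIV. f x $ i * frechet_derivative \<psi> (at x) (axis i 1)))"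
    by (simp add: inner_vec_def gradient_def)
  also have "\<dots> = (\<Sum>i\<in>UNIV. LINT x|lebesgue_on D. f x $ i * frechet_derivative \<psi> (at x) (axis i 1))"
    by (rule Bochner_Integration.integral_sum) (rule ibp(1))
  also have "\<dots> = - (\<Sum>i\<in>UNIV. LINT x|lebesgue_on D. f' x (axis i 1) $ i * \<psi> x)"
    by (simp add: ibp(3) sum_negf)
  also have "(\<Sum>i\<in>UNIV. LINT x|lebesgue_on D. f' x (axis i 1) $ i * \<psi> x) = (LINT x|lebesgue_on D. (\<Sum>i\<in>UNIV. f' x (axis i 1) $ i * \<psi> x))"
    by (rule Bochner_Integration.integral_sum[symmetric]) (rule ibp(2))
  also have "\<dots> = (LINT x|lebesgue_on D. h x * \<psi> x)"
    by (rule Bochner_Integration.integral_cong[OF refl]) (simp add: h sum_distrib_right)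
  finally show "(LINT x|lebesgue_on D. f x \<bullet> gradient \<psi> x) = - (LINT x|lebesgue_on D. h x * \<psi> x)" .
qed

text \<open>Spelled out as signed products of components, so that integrals split and each term can
  be integrated by parts.\<close>

lemma curl_of_inner:
  "w \<bullet> curl_of L = w $ 1 * L (axis 2 1) $ 3 - w $ 1 * L (axis 3 1) $ 2 + (w $ 2 * L (axis 3 1) $ 1 - w $ 2 * L (axis 1 1) $ 3)
    + (w $ 3 * L (axis 1 1) $ 2 - w $ 3 * L (axis 2 1) $ 1)"
  by (simp add: curl_of_def inner_vec_def sum_3 vector_3 algebra_simps)

lemma smooth_curl: "smooth \<psi> \<Longrightarrow> curl \<psi> x = curl_of (frechet_derivative \<psi> (at x))"
  by (rule curl_eqI[OF smooth_has_derivative])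

lemma frechet_derivative_component:
  "smooth \<psi> \<Longrightarrow> frechet_derivative (\<lambda>x. \<psi> x $ k) (at x) = (\<lambda>v. frechet_derivative \<psi> (at x) v $ k)"
  by (metis frechet_derivative_at has_derivative_component smooth_has_derivative)

text \<open>Each of the six terms is integrated by parts; the sign this costs is undone by the
  antisymmetry of the curl, which passes from \<psi> to f without a sign.\<close>

lemma has_weak_curlI:
  fixes f :: "real^3 \<Rightarrow> real^3"
  assumes D: "open D" and f: "\<And>x. x \<in> D \<Longrightarrow> (f has_derivative f' x) (at x)" "\<And>v. continuous_on D (\<lambda>x. f' x v)"
    and h: "\<And>x. x \<in> D \<Longrightarrow> h x = curl_of (f' x)"
    and "locally_integrable D f" "locally_integrable D h"
  shows "has_weak_curl D f h"
  unfolding has_weak_curl_def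
proof (intro conjI allI impI assms)
  fix \<psi> :: "real^3 \<Rightarrow> real^3" assume \<psi>: "test_function D \<psi>"
  then have s: "smooth \<psi>" by (simp add: test_function_def)
  have c: "continuous_on D (\<lambda>x. f' x v $ i)" for v i using f(2) by (intro continuous_intros)
  note ibp = integration_by_parts_test_function[OF D has_derivative_component[OF f(1)] c test_function_component[OF \<psi>],
      unfolded frechet_derivative_component[OF s]]
  have "(LINT x|lebesgue_on D. f x \<bullet> curl \<psi> x) = (LINT x|lebesgue_on D. f x \<bullet> curl_of (frechet_derivative \<psi> (at x)))"
    by (simp add: smooth_curl[OF s])
  also have "\<dots> = (LINT x|lebesgue_on D. \<psi> x \<bullet> curl_of (f' x))"
  proof -
    have comm: "\<psi> x $ i * f' x v $ k = f' x v $ k * \<psi> x $ i" for x v i k by simp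
    show ?thesis
      unfolding curl_of_inner comm
      by (simp add: ibp(1,2) ibp(3))
  qed
  also have "\<dots> = (LINT x|lebesgue_on D. h x \<bullet> \<psi> x)"
    by (rule Bochner_Integration.integral_cong[OF refl]) (simp add: h inner_commute)
  finally show "(LINT x|lebesgue_on D. f x \<bullet> curl \<psi> x) = (LINT x|lebesgue_on D. h x \<bullet> \<psi> x)" .
qed

subsection \<open>Linearity and uniqueness of weak derivatives\<close>

lemma locally_integrable_component:
  "locally_integrable D f \<Longrightarrow> locally_integrable D (\<lambda>x. f x $ i)"
  unfolding locally_integrable_def
proof (intro allI impI)
  fix C assume *: "\<forall>C. compact C \<and> C \<subseteq> D \<longrightarrow> integrable (lebesgue_on C) f" and "compact C \<and> C \<subseteq> D"
  then have "integrable (lebesgue_on C) f" by blast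
  then show "integrable (lebesgue_on C) (\<lambda>x. f x $ i)"
    by (rule integrable_bounded_linear[OF bounded_linear_vec_nth])
qed

lemma integrable_inner_test_function:
  fixes f :: "real^'n \<Rightarrow> real^'m"
  assumes D: "open D" and f: "locally_integrable D f" and \<psi>: "\<And>i. test_function D (\<lambda>x. \<psi> x $ i)"
  shows "integrable (lebesgue_on D) (\<lambda>x. f x \<bullet> \<psi> x)"
  unfolding inner_vec_def
  using locally_integrable_test_function[OF D locally_integrable_component[OF f] \<psi>]
  by (intro Bochner_Integration.integrable_sum) simp

lemma test_function_gradient: "test_function D \<psi> \<Longrightarrow> test_function D (\<lambda>x. gradient \<psi> x $ i)"
  unfolding gradient_def by (simp add: test_function_directional)

lemma smooth_diff: "smooth f \<Longrightarrow> smooth g \<Longrightarrow> smooth (\<lambda>x. f x - g x)"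
proof (rule smooth_coinduct[where X = "\<lambda>h. \<exists>f g. smooth f \<and> smooth g \<and> h = (\<lambda>x. f x - g x)"])
  fix h :: "'a \<Rightarrow> 'b" assume "\<exists>f g. smooth f \<and> smooth g \<and> h = (\<lambda>x. f x - g x)"
  then obtain f g where fg: "smooth f" "smooth g" "h = (\<lambda>x. f x - g x)" by blast
  let ?h = "\<lambda>x v. frechet_derivative f (at x) v - frechet_derivative g (at x) v"
  have "(h has_derivative ?h x) (at x)" for x
    unfolding fg(3) by (intro has_derivative_diff smooth_has_derivative fg)
  moreover have "\<exists>f g. smooth f \<and> smooth g \<and> (\<lambda>x. ?h x v) = (\<lambda>x. f x - g x)" for v
    using smooth_directional[OF fg(1)] smooth_directional[OF fg(2)] by blast
  ultimately show "\<exists>h'. (\<forall>x. (h has_derivative h' x) (at x)) \<and>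
      (\<forall>v. \<exists>f g. smooth f \<and> smooth g \<and> (\<lambda>x. h' x v) = (\<lambda>x. f x - g x))"
    by (intro exI[of _ ?h]) blast
qed blast

lemma test_function_diff:
  assumes "test_function D f" "test_function D g"
  shows "test_function D (\<lambda>x. f x - g x)"
proof -
  let ?S = "\<lambda>f. closure {x. f x \<noteq> 0}"
  have fg: "smooth f" "smooth g" "compact (?S f)" "compact (?S g)" "?S f \<subseteq> D" "?S g \<subseteq> D"
    using assms by (auto simp: test_function_def)
  have "{x. f x - g x \<noteq> 0} \<subseteq> {x. f x \<noteq> 0} \<union> {x. g x \<noteq> 0}" by auto
  from closure_mono[OF this] have sub: "?S (\<lambda>x. f x - g x) \<subseteq> ?S f \<union> ?S g" by (simp only: closure_Un)
  have "compact (?S (\<lambda>x. f x - g x))"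
    unfolding compact_eq_bounded_closed
    using bounded_subset[OF _ sub] compact_imp_bounded[OF fg(3)] compact_imp_bounded[OF fg(4)] by simp
  then show ?thesis
    unfolding test_function_def using sub fg(5,6) smooth_diff[OF fg(1,2)] by (meson Un_least order_trans)
qed

lemma test_function_curl:
  assumes \<psi>: "test_function D \<psi>"
  shows "test_function D (\<lambda>x. curl \<psi> x $ i)"
proof -
  have s: "smooth \<psi>" using \<psi> by (simp add: test_function_def)
  note d = test_function_component[OF test_function_directional[OF \<psi>]]
  have "test_function D (\<lambda>x. frechet_derivative \<psi> (at x) u $ k - frechet_derivative \<psi> (at x) v $ l)" for u v k l
    by (rule test_function_diff[OF d d])
  then show ?thesis
    unfolding smooth_curl[OF s] curl_of_def using exhaust_3[of i] by auto
qed

lemma has_weak_gradient_diff: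
  assumes D: "open D" and 1: "has_weak_gradient D f F" and 2: "has_weak_gradient D g G"
  shows "has_weak_gradient D (\<lambda>x. f x - g x) (\<lambda>x. F x - G x)"
proof -
  have li: "locally_integrable D f" "locally_integrable D F" "locally_integrable D g" "locally_integrable D G"
    using 1 2 by (auto simp: has_weak_gradient_def)
  have "(LINT x|lebesgue_on D. (f x - g x) * gradient \<psi> x $ i) = - (LINT x|lebesgue_on D. (F x - G x) $ i * \<psi> x)"
    if \<psi>: "test_function D \<psi>" for \<psi> i
    using locally_integrable_test_function[OF D li(1) test_function_gradient[OF \<psi>, of i]]
      locally_integrable_test_function[OF D li(3) test_function_gradient[OF \<psi>, of i]]
      locally_integrable_test_function[OF D locally_integrable_component[OF li(2), of i] \<psi>]
      locally_integrable_test_function[OF D locally_integrable_component[OF li(4), of i] \<psi>]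
      1 2 \<psi>
    by (simp add: left_diff_distrib has_weak_gradient_def)
  with li show ?thesis by (simp add: has_weak_gradient_def locally_integrable_diff)
qed

lemma has_weak_div_diff:
  assumes D: "open D" and 1: "has_weak_div D f F" and 2: "has_weak_div D g G"
  shows "has_weak_div D (\<lambda>x. f x - g x) (\<lambda>x. F x - G x)"
proof -
  have li: "locally_integrable D f" "locally_integrable D F" "locally_integrable D g" "locally_integrable D G"
    using 1 2 by (auto simp: has_weak_div_def)
  have "(LINT x|lebesgue_on D. (f x - g x) \<bullet> gradient \<psi> x) = - (LINT x|lebesgue_on D. (F x - G x) * \<psi> x)"
    if \<psi>: "test_function D \<psi>" for \<psi>
    using integrable_inner_test_function[OF D li(1) test_function_gradient[OF \<psi>]]
      integrable_inner_test_function[OF D li(3) test_function_gradient[OF \<psi>]]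
      locally_integrable_test_function[OF D li(2) \<psi>] locally_integrable_test_function[OF D li(4) \<psi>]
      1 2 \<psi>
    by (simp add: left_diff_distrib inner_diff_left has_weak_div_def)
  with li show ?thesis by (simp add: has_weak_div_def locally_integrable_diff)
qed

lemma has_weak_curl_diff:
  assumes D: "open D" and 1: "has_weak_curl D f F" and 2: "has_weak_curl D g G"
  shows "has_weak_curl D (\<lambda>x. f x - g x) (\<lambda>x. F x - G x)"
proof -
  have li: "locally_integrable D f" "locally_integrable D F" "locally_integrable D g" "locally_integrable D G"
    using 1 2 by (auto simp: has_weak_curl_def)
  have "(LINT x|lebesgue_on D. (f x - g x) \<bullet> curl \<psi> x) = (LINT x|lebesgue_on D. (F x - G x) \<bullet> \<psi> x)"
    if \<psi>: "test_function D \<psi>" for \<psi>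
    using integrable_inner_test_function[OF D li(1) test_function_curl[OF \<psi>]]
      integrable_inner_test_function[OF D li(3) test_function_curl[OF \<psi>]]
      integrable_inner_test_function[OF D li(2) test_function_component[OF \<psi>]]
      integrable_inner_test_function[OF D li(4) test_function_component[OF \<psi>]]
      1 2 \<psi>
    by (simp add: inner_diff_left has_weak_curl_def)
  with li show ?thesis by (simp add: has_weak_curl_def locally_integrable_diff)
qed

text \<open>By linearity F - G is a weak gradient of 0, so each of its components integrates to 0
  against every test function.\<close>

lemma weak_gradient_unique:
  assumes D: "open D" and 1: "has_weak_gradient D f F" and 2: "has_weak_gradient D f G"
  shows "AE x in lborel. x \<in> D \<longrightarrow> F x = G x"
proof -
  have 3: "has_weak_gradient D (\<lambda>_. 0) (\<lambda>x. F x - G x)"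
    using has_weak_gradient_diff[OF assms] by simp
  have "AE x in lborel. x \<in> D \<longrightarrow> (F x - G x) $ i = 0" for i
    using 3 by (intro fundamental_lemma_calculus_of_variations D locally_integrable_component)
      (auto simp: has_weak_gradient_def)
  then have "AE x in lborel. \<forall>i. x \<in> D \<longrightarrow> (F x - G x) $ i = 0"
    by (subst AE_all_countable) (rule allI)
  then show ?thesis by eventually_elim (simp add: vec_eq_iff)
qed

lemma weak_div_unique:
  assumes D: "open D" and 1: "has_weak_div D f F" and 2: "has_weak_div D f G"
  shows "AE x in lborel. x \<in> D \<longrightarrow> F x = G x"
proof -
  have 3: "has_weak_div D (\<lambda>_. 0) (\<lambda>x. F x - G x)"
    using has_weak_div_diff[OF assms] by simp
  have "AE x in lborel. x \<in> D \<longrightarrow> F x - G x = 0"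
    using 3 by (intro fundamental_lemma_calculus_of_variations D) (auto simp: has_weak_div_def)
  then show ?thesis by simp
qed

lemma weak_curl_unique:
  assumes D: "open D" and 1: "has_weak_curl D f F" and 2: "has_weak_curl D f G"
  shows "AE x in lborel. x \<in> D \<longrightarrow> F x = G x"
proof -
  have 3: "has_weak_curl D (\<lambda>_. 0) (\<lambda>x. F x - G x)"
    using has_weak_curl_diff[OF assms] by simp
  have "AE x in lborel. x \<in> D \<longrightarrow> (F x - G x) $ i = 0" for i
  proof (rule fundamental_lemma_calculus_of_variations[OF D])
    show "locally_integrable D (\<lambda>x. (F x - G x) $ i)"
      using 3 by (intro locally_integrable_component) (simp add: has_weak_curl_def)
    \<comment> \<open>Weak curls are tested with vector fields: \<psi> times the i-th unit vector
      extracts component i.\<close>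
    fix \<psi> :: "real^3 \<Rightarrow> real" assume "test_function D \<psi>"
    then have "test_function D (\<lambda>x. \<psi> x *\<^sub>R (axis i 1 :: real^3))"
      by (rule test_function_bounded_linear[OF bounded_linear_scaleR_left])
    then have "(LINT x|lebesgue_on D. 0 \<bullet> curl (\<lambda>x. \<psi> x *\<^sub>R (axis i 1 :: real^3)) x) =
        (LINT x|lebesgue_on D. (F x - G x) \<bullet> (\<psi> x *\<^sub>R axis i 1))"
      using 3 unfolding has_weak_curl_def by blast
    then show "(LINT x|lebesgue_on D. (F x - G x) $ i * \<psi> x) = 0"
      by (simp add: inner_axis mult.commute)
  qed
  then have "AE x in lborel. \<forall>i. x \<in> D \<longrightarrow> (F x - G x) $ i = 0"
    by (subst AE_all_countable) (rule allI)
  then show ?thesis by eventually_elim (simp add: vec_eq_iff)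
qed

subsection \<open>The limit in \<open>L\<^sup>p\<close>\<close>

text \<open>Non-measurable g are covered as well: a non-integrable function has integral 0, which is
  at most e.\<close>

lemma integral_le_of_nn_integral_le:
  fixes g :: "'a \<Rightarrow> real"
  assumes "\<And>x. g x \<ge> 0" "(\<integral>\<^sup>+x. ennreal (g x) \<partial>M) \<le> ennreal e" "e \<ge> 0"
  shows "(LINT x|M. g x) \<le> e"
proof (cases "integrable M g")
  case True
  then have "ennreal (LINT x|M. g x) = (\<integral>\<^sup>+x. ennreal (g x) \<partial>M)"
    using assms(1) by (intro nn_integral_eq_integral[symmetric]) auto
  with assms(2) have "ennreal (LINT x|M. g x) \<le> ennreal e" by metis
  with assms(3) show ?thesis by (simp add: ennreal_le_iff)
qed (use assms(3) in \<open>simp add: not_integrable_integral_eq\<close>)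

text \<open>The defect of A is at most a|T|, and |T| is at most |T - h| + |h|: the first part tends
  to 0 in L^p with T - h, the second is a small multiple of a fixed L^p function.\<close>

lemma Lp_norm_perturbation_tendsto_0:
  fixes A :: "real \<Rightarrow> 'a::euclidean_space \<Rightarrow> 'b::euclidean_space \<Rightarrow> 'b" and T :: "real \<Rightarrow> 'a \<Rightarrow> 'b"
  assumes p: "p \<ge> 1" and D: "D \<in> sets borel" and h: "h \<in> borel_measurable borel" "integrable lborel (\<lambda>x. norm (h x) powr p)"
    and ae: "AE x in lborel. x \<in> D \<longrightarrow> h x = f x" and T: "\<And>\<delta>. \<delta> > 0 \<Longrightarrow> T \<delta> \<in> borel_measurable borel"
    and lim: "((\<lambda>\<delta>. \<integral>\<^sup>+x. indicator D x * ennreal (norm (T \<delta> x - h x) powr p) \<partial>lborel) \<longlongrightarrow> 0) (at_right 0)"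
    and A: "\<And>\<eta>. \<eta> > 0 \<Longrightarrow> \<forall>\<^sub>F \<delta> in at_right 0. \<forall>x\<in>D. \<forall>v. norm (A \<delta> x v - v) \<le> \<eta> * norm v"
  shows "((\<lambda>\<delta>. Lp_norm p D (\<lambda>x. A \<delta> x (T \<delta> x) - f x)) \<longlongrightarrow> 0) (at_right 0)"
proof -
  note D[measurable] h(1)[measurable]
  define X where "X \<delta> = (LINT x|lebesgue_on D. norm (A \<delta> x (T \<delta> x) - f x) powr p)" for \<delta>
  have "\<forall>\<^sub>F \<delta> in at_right 0. X \<delta> \<le> e" if "e > 0" for e
  proof -
    define c where "c = (2::real) powr p"
    have c: "c > 0" by (simp add: c_def)
    define I where "I = (LINT x|lborel. norm (h x) powr p)"
    have I: "I \<ge> 0" by (simp add: I_def)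
    have nnI: "(\<integral>\<^sup>+x. ennreal (norm (h x) powr p) \<partial>lborel) = ennreal I"
      unfolding I_def by (rule nn_integral_eq_integral[OF h(2)]) simp
    \<comment> \<open>a \<le> 1 absorbs a|T - h| into |T - h|, giving 2|T - h| in total; the other
      bound yields c a^p I \<le> e / 2.\<close>
    define a where "a = min 1 ((e / (2 * c * (I + 1))) powr (1 / p))"
    have q: "e / (2 * c * (I + 1)) > 0" using that c I by simp
    then have a: "a > 0" "a \<le> 1" by (auto simp: a_def)
    have "a powr p \<le> ((e / (2 * c * (I + 1))) powr (1 / p)) powr p"
      using a p by (intro powr_mono2) (auto simp: a_def)
    also have "\<dots> = e / (2 * c * (I + 1))"
      using that c I p by (simp add: powr_powr abs_mult)
    finally have "c * (a powr p * I) \<le> c * (e / (2 * c * (I + 1)) * (I + 1))"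
      using c I less_imp_le[OF q] by (intro mult_left_mono mult_mono) (simp_all del: zero_le_divide_iff)
    also have "\<dots> = e / 2" using c add_nonneg_pos[OF I, of 1] by simp
    finally have ca: "c * (a powr p * I) \<le> e / 2" .
    \<comment> \<open>One factor c comes from \<open>norm_add_powr_le\<close>, the other from the
      p-th power of 2 in 2|T - h|.\<close>
    have "e / (2 * c * c) > 0" using that c by simp
    then have "\<forall>\<^sub>F \<delta> in at_right 0. (\<integral>\<^sup>+x. indicator D x * ennreal (norm (T \<delta> x - h x) powr p) \<partial>lborel) < ennreal (e / (2 * c * c))"
      using lim by (intro order_tendstoD(2)[OF lim]) simp
    with A[OF a(1)] eventually_at_right_less[of 0] show ?thesis
    proof eventually_elim
      case (elim \<delta>)
      note [measurable] = T[OF \<open>0 < \<delta>\<close>]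
      let ?N = "\<lambda>x. norm (T \<delta> x - h x) powr p"
      have pw: "norm (A \<delta> x (T \<delta> x) - h x) powr p \<le> c * (c * ?N x + a powr p * norm (h x) powr p)" if "x \<in> D" for x
      proof -
        have "norm (A \<delta> x (T \<delta> x) - h x) \<le> norm (A \<delta> x (T \<delta> x) - T \<delta> x) + norm (T \<delta> x - h x)"
          using norm_triangle_ineq[of "A \<delta> x (T \<delta> x) - T \<delta> x" "T \<delta> x - h x"] by simp
        also have "norm (A \<delta> x (T \<delta> x) - T \<delta> x) \<le> a * norm (T \<delta> x)" using elim that by blast
        also have "a * norm (T \<delta> x) \<le> a * (norm (T \<delta> x - h x) + norm (h x))"
          using a norm_triangle_ineq[of "T \<delta> x - h x" "h x"] by (intro mult_left_mono) auto
        also have "\<dots> \<le> norm (T \<delta> x - h x) + a * norm (h x)"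
          using mult_right_mono[OF a(2), of "norm (T \<delta> x - h x)"] by (simp add: algebra_simps)
        finally have "norm (A \<delta> x (T \<delta> x) - h x) \<le> norm (2 * norm (T \<delta> x - h x) + a * norm (h x))" using a by simp
        then have "norm (A \<delta> x (T \<delta> x) - h x) powr p \<le> norm (2 * norm (T \<delta> x - h x) + a * norm (h x)) powr p"
          using p by (intro powr_mono2) auto
        also have "\<dots> \<le> c * (norm (2 * norm (T \<delta> x - h x)) powr p + norm (a * norm (h x)) powr p)"
          unfolding c_def by (rule norm_add_powr_le) (use p in simp)
        also have "\<dots> = c * (c * ?N x + a powr p * norm (h x) powr p)"
          using a by (simp add: powr_mult c_def)
        finally show ?thesis .
      qed
      have "(\<integral>\<^sup>+x. ennreal (norm (A \<delta> x (T \<delta> x) - f x) powr p) \<partial>lebesgue_on D) =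
          (\<integral>\<^sup>+x. ennreal (norm (A \<delta> x (T \<delta> x) - f x) powr p) * indicator D x \<partial>lborel)"
        using D by (subst nn_integral_restrict_space) (auto simp: nn_integral_completion)
      also have "\<dots> = (\<integral>\<^sup>+x. ennreal (norm (A \<delta> x (T \<delta> x) - h x) powr p) * indicator D x \<partial>lborel)"
        using ae by (intro nn_integral_cong_AE) (auto elim!: eventually_mono simp: indicator_def)
      also have "\<dots> \<le> (\<integral>\<^sup>+x. ennreal (c * c) * (indicator D x * ennreal (?N x)) + ennreal (c * a powr p) * ennreal (norm (h x) powr p) \<partial>lborel)"
      proof (rule nn_integral_mono)
        fix x
        show "ennreal (norm (A \<delta> x (T \<delta> x) - h x) powr p) * indicator D x \<le>
          ennreal (c * c) * (indicator D x * ennreal (?N x)) + ennreal (c * a powr p) * ennreal (norm (h x) powr p)"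
        proof (cases "x \<in> D")
          case True
          have "ennreal (norm (A \<delta> x (T \<delta> x) - h x) powr p) \<le> ennreal (c * c * ?N x + c * a powr p * norm (h x) powr p)"
            using pw[OF True] by (intro ennreal_leI) (simp add: algebra_simps)
          also have "\<dots> = ennreal (c * c) * ennreal (?N x) + ennreal (c * a powr p) * ennreal (norm (h x) powr p)"
            using c by (simp add: ennreal_mult)
          finally show ?thesis using True by simp
        qed simp
      qed
      also have "\<dots> = ennreal (c * c) * (\<integral>\<^sup>+x. indicator D x * ennreal (?N x) \<partial>lborel) + ennreal (c * a powr p) * ennreal I"
        unfolding nnI[symmetric] by (simp add: nn_integral_add nn_integral_cmult)
      also have "\<dots> \<le> ennreal (c * c) * ennreal (e / (2 * c * c)) + ennreal (c * a powr p) * ennreal I"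
        using elim by (intro add_mono mult_left_mono) auto
      also have "\<dots> = ennreal (c * c * (e / (2 * c * c)) + c * a powr p * I)"
        using c I that by (simp add: ennreal_mult[symmetric] del: times_divide_eq_right)
      also have "\<dots> \<le> ennreal e"
        using ca c by (intro ennreal_leI) (simp add: algebra_simps)
      finally show ?case
        unfolding X_def using that by (intro integral_le_of_nn_integral_le) auto
    qed
  qed
  then have "(X \<longlongrightarrow> 0) (at_right 0)"
  proof (intro order_tendstoI)
    fix e :: real assume *: "\<And>e. e > 0 \<Longrightarrow> \<forall>\<^sub>F \<delta> in at_right 0. X \<delta> \<le> e" and "e > 0"
    from *[of "e / 2"] \<open>e > 0\<close> show "\<forall>\<^sub>F \<delta> in at_right 0. X \<delta> < e"
      by (auto elim!: eventually_mono)
  next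
    fix e :: real assume "e < 0"
    then show "\<forall>\<^sub>F \<delta> in at_right 0. e < X \<delta>"
      by (intro always_eventually) (auto simp: X_def intro: less_le_trans)
  qed
  moreover have "Lp_norm p D (\<lambda>x. A \<delta> x (T \<delta> x) - f x) = X \<delta> powr (1 / p)" for \<delta>
    by (simp add: Lp_norm_def X_def)
  moreover have "X \<delta> \<ge> 0" for \<delta> by (simp add: X_def)
  ultimately show ?thesis
    using p by (simp only:) (rule tendsto_zero_powrI[where b = "1 / p"], auto)
qed

subsection \<open>Derivatives of pull-backs in dimension three\<close>

lemma has_derivative_vecI:
  fixes f :: "'a::real_normed_vector \<Rightarrow> real^'n"
  assumes "\<And>i. ((\<lambda>x. f x $ i) has_derivative (\<lambda>v. f' v $ i)) (at x)"
  shows "(f has_derivative f') (at x)"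
  using assms by (subst has_derivative_componentwise_within) (auto simp: Basis_vec_def inner_axis)

lemma three_arith: "(4::3) = 1" "(5::3) = 2"
  by simp_all

text \<open>Indices are read modulo 3, so that the signs of the cofactors are built in.\<close>

definition adjugate3 :: "real^3^3 \<Rightarrow> real^3^3" where
  "adjugate3 M = (\<chi> i k. M $ (k + 1) $ (i + 1) * M $ (k + 2) $ (i + 2) - M $ (k + 1) $ (i + 2) * M $ (k + 2) $ (i + 1))"

lemma adjugate3_entry: "adjugate3 M $ i $ k =
    M $ (k + 1) $ (i + 1) * M $ (k + 2) $ (i + 2) - M $ (k + 1) $ (i + 2) * M $ (k + 2) $ (i + 1)"
  by (simp add: adjugate3_def)

lemma mult_adjugate3: "M ** adjugate3 M = det M *\<^sub>R mat 1"
proof -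
  have "(M ** adjugate3 M) $ i $ k = (det M *\<^sub>R mat 1) $ i $ k" for i k
    using exhaust_3[of i] exhaust_3[of k]
    by (auto simp: matrix_matrix_mult_def sum_3 det_3 adjugate3_entry three_arith mat_def) (simp_all add: algebra_simps)
  then show ?thesis by (simp add: vec_eq_iff)
qed

lemma adjugate3_invertible:
  assumes "invertible M"
  shows "adjugate3 M = det M *\<^sub>R matrix_inv M"
proof -
  have "adjugate3 M = matrix_inv M ** M ** adjugate3 M"
    using assms by (simp add: matrix_inv_left)
  also have "\<dots> = matrix_inv M ** (det M *\<^sub>R mat 1)"
    by (simp only: matrix_mul_assoc[symmetric] mult_adjugate3)
  also have "\<dots> = det M *\<^sub>R matrix_inv M"
    by (simp add: matrix_scalar_ac)
  finally show ?thesis .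
qed

text \<open>The terms with second derivatives B are symmetric in component and direction and drop
  out of the curl. What remains is the antisymmetric part of J^T DV J, and its axial vector is the
  adjugate of J applied to that of DV.\<close>

lemma pullback_curl:
  fixes \<phi> V :: "real^3 \<Rightarrow> real^3" and J :: "real^3 \<Rightarrow> real^3^3"
  assumes \<phi>: "\<And>x. (\<phi> has_derivative (\<lambda>v. J x *v v)) (at x)"
    and J: "\<And>k l x. ((\<lambda>x. J x $ k $ l) has_derivative B k l x) (at x)"
    and B: "\<And>k l m x. B k l x (axis m 1) = B k m x (axis l 1)" "\<And>k l v. continuous_on UNIV (\<lambda>x. B k l x v)"
    and V: "\<And>z. (V has_derivative (\<lambda>v. \<Sum>l\<in>UNIV. v $ l *\<^sub>R P l z)) (at z)" "\<And>l. continuous_on UNIV (P l)"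
  obtains W' where "\<And>x. ((\<lambda>x. transpose (J x) *v V (\<phi> x)) has_derivative W' x) (at x)"
    "\<And>v. continuous_on UNIV (\<lambda>x. W' x v)"
    "\<And>x. curl_of (W' x) = adjugate3 (J x) *v curl_of (\<lambda>v. \<Sum>l\<in>UNIV. v $ l *\<^sub>R P l (\<phi> x))"
proof -
  define W' where "W' x v = (\<chi> i. \<Sum>k\<in>UNIV. J x $ k $ i * (\<Sum>l\<in>UNIV. (J x *v v) $ l * P l (\<phi> x) $ k) + B k i x v * V (\<phi> x) $ k)" for x v
  have c\<phi>: "continuous_on UNIV \<phi>" and cV: "continuous_on UNIV V" and cJ: "continuous_on UNIV (\<lambda>x. J x $ k $ l)" for k l
    by (intro continuous_at_imp_continuous_on ballI has_derivative_continuous, rule \<phi> V J)+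
  have cP\<phi>: "continuous_on UNIV (\<lambda>x. P l (\<phi> x) $ k)" and cV\<phi>: "continuous_on UNIV (\<lambda>x. V (\<phi> x) $ k)" for l k
    by (intro continuous_on_component continuous_on_compose2[OF V(2) c\<phi>] continuous_on_compose2[OF cV c\<phi>], simp)+
  have "((\<lambda>x. transpose (J x) *v V (\<phi> x)) has_derivative W' x) (at x)" for x
  proof (rule has_derivative_vecI)
    fix i
    have V\<phi>: "((\<lambda>x. V (\<phi> x) $ k) has_derivative (\<lambda>v. \<Sum>l\<in>UNIV. (J x *v v) $ l * P l (\<phi> x) $ k)) (at x)" for k
      using has_derivative_component[OF has_derivative_compose[OF \<phi> V(1)], of k] by (simp add: sum_component)
    have "((\<lambda>x. \<Sum>k\<in>UNIV. J x $ k $ i * V (\<phi> x) $ k) has_derivative (\<lambda>v. W' x v $ i)) (at x)"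
      unfolding W'_def vec_lambda_beta by (intro has_derivative_sum has_derivative_mult J V\<phi>)
    then show "((\<lambda>x. (transpose (J x) *v V (\<phi> x)) $ i) has_derivative (\<lambda>v. W' x v $ i)) (at x)"
      by (simp add: matrix_vector_mult_def transpose_def)
  qed
  moreover have "continuous_on UNIV (\<lambda>x. W' x v)" for v
    unfolding W'_def matrix_vector_mult_def vec_lambda_beta
    by (intro continuous_on_vec_lambda continuous_on_sum continuous_on_add continuous_on_mult cP\<phi> cV\<phi> cJ B(2) continuous_on_const)
  moreover have "curl_of (W' x) = adjugate3 (J x) *v curl_of (\<lambda>v. \<Sum>l\<in>UNIV. v $ l *\<^sub>R P l (\<phi> x))" for x
  proof -
    \<comment> \<open>The symmetry is instantiated in one orientation per pair of indices, so that
      it terminates as a rewrite system.\<close>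
    have s: "B k 2 x (axis 1 1) = B k 1 x (axis 2 1)" "B k 3 x (axis 1 1) = B k 1 x (axis 3 1)"
      "B k 3 x (axis 2 1) = B k 2 x (axis 3 1)" for k by (rule B(1))+
    have e: "W' x (axis m 1) $ i = (\<Sum>k\<in>UNIV. J x $ k $ i * (\<Sum>l\<in>UNIV. J x $ l $ m * P l (\<phi> x) $ k) + B k i x (axis m 1) * V (\<phi> x) $ k)" for i m
      by (simp add: W'_def matrix_vector_mult_basis column_def)
    have e2: "(\<Sum>l\<in>UNIV. axis m 1 $ l *\<^sub>R P l (\<phi> x)) $ i = P m (\<phi> x) $ i" for m i
      by (simp add: axis_def if_distrib[of "\<lambda>t. t *\<^sub>R _"] cong: if_cong)
    have c: "curl_of (\<lambda>v. \<Sum>l\<in>UNIV. v $ l *\<^sub>R P l (\<phi> x)) = vector [P 2 (\<phi> x) $ 3 - P 3 (\<phi> x) $ 2,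
        P 3 (\<phi> x) $ 1 - P 1 (\<phi> x) $ 3, P 1 (\<phi> x) $ 2 - P 2 (\<phi> x) $ 1]"
      by (simp only: curl_of_def e2)
    have "curl_of (W' x) $ m = (adjugate3 (J x) *v curl_of (\<lambda>v. \<Sum>l\<in>UNIV. v $ l *\<^sub>R P l (\<phi> x))) $ m" for m
      unfolding c using exhaust_3[of m]
      by (elim disjE; simp only:)
        (simp_all add: curl_of_def e matrix_vector_mult_def sum_3 adjugate3_entry three_arith s algebra_simps)
    then show ?thesis by (simp add: vec_eq_iff)
  qed
  ultimately show ?thesis using that by blast
qed

text \<open>Differentiating the adjugate contributes its row-wise divergence against V, which
  vanishes (Piola); differentiating V contributes the trace of DV J adj(J), and J adj(J) is det(J)
  times the identity. \<open>C i k x\<close> is the derivative of entry (i, k) of the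
  adjugate.\<close>

lemma pullback_div:
  fixes \<phi> V :: "real^3 \<Rightarrow> real^3" and J :: "real^3 \<Rightarrow> real^3^3"
  assumes \<phi>: "\<And>x. (\<phi> has_derivative (\<lambda>v. J x *v v)) (at x)"
    and J: "\<And>k l x. ((\<lambda>x. J x $ k $ l) has_derivative B k l x) (at x)"
    and B: "\<And>k l m x. B k l x (axis m 1) = B k m x (axis l 1)" "\<And>k l v. continuous_on UNIV (\<lambda>x. B k l x v)"
    and V: "\<And>z. (V has_derivative (\<lambda>v. \<Sum>l\<in>UNIV. v $ l *\<^sub>R P l z)) (at z)" "\<And>l. continuous_on UNIV (P l)"
  obtains W' where "\<And>x. ((\<lambda>x. adjugate3 (J x) *v V (\<phi> x)) has_derivative W' x) (at x)"
    "\<And>v. continuous_on UNIV (\<lambda>x. W' x v)"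
    "\<And>x. (\<Sum>i\<in>UNIV. W' x (axis i 1) $ i) = det (J x) * (\<Sum>l\<in>UNIV. P l (\<phi> x) $ l)"
proof -
  define C where "C i k x v = (J x $ (k + 1) $ (i + 1) * B (k + 2) (i + 2) x v + B (k + 1) (i + 1) x v * J x $ (k + 2) $ (i + 2))
     - (J x $ (k + 1) $ (i + 2) * B (k + 2) (i + 1) x v + B (k + 1) (i + 2) x v * J x $ (k + 2) $ (i + 1))" for i k x v
  define W' where "W' x v = (\<chi> i. \<Sum>k\<in>UNIV. adjugate3 (J x) $ i $ k * (\<Sum>l\<in>UNIV. (J x *v v) $ l * P l (\<phi> x) $ k) + C i k x v * V (\<phi> x) $ k)" for x v
  have c\<phi>: "continuous_on UNIV \<phi>" and cV: "continuous_on UNIV V" and cJ: "continuous_on UNIV (\<lambda>x. J x $ k $ l)" for k l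
    by (intro continuous_at_imp_continuous_on ballI has_derivative_continuous, rule \<phi> V J)+
  have cP\<phi>: "continuous_on UNIV (\<lambda>x. P l (\<phi> x) $ k)" and cV\<phi>: "continuous_on UNIV (\<lambda>x. V (\<phi> x) $ k)" for l k
    by (intro continuous_on_component continuous_on_compose2[OF V(2) c\<phi>] continuous_on_compose2[OF cV c\<phi>], simp)+
  have A: "((\<lambda>x. adjugate3 (J x) $ i $ k) has_derivative C i k x) (at x)" for i k x
    unfolding adjugate3_entry C_def by (intro has_derivative_diff has_derivative_mult J)
  have cC: "continuous_on UNIV (\<lambda>x. C i k x v)" for i k v
    unfolding C_def by (intro continuous_on_diff continuous_on_add continuous_on_mult cJ B(2))
  have cA: "continuous_on UNIV (\<lambda>x. adjugate3 (J x) $ i $ k)" for i k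
    by (intro continuous_at_imp_continuous_on ballI has_derivative_continuous[OF A])
  have "((\<lambda>x. adjugate3 (J x) *v V (\<phi> x)) has_derivative W' x) (at x)" for x
  proof (rule has_derivative_vecI)
    fix i
    have V\<phi>: "((\<lambda>x. V (\<phi> x) $ k) has_derivative (\<lambda>v. \<Sum>l\<in>UNIV. (J x *v v) $ l * P l (\<phi> x) $ k)) (at x)" for k
      using has_derivative_component[OF has_derivative_compose[OF \<phi> V(1)], of k] by (simp add: sum_component)
    have "((\<lambda>x. \<Sum>k\<in>UNIV. adjugate3 (J x) $ i $ k * V (\<phi> x) $ k) has_derivative (\<lambda>v. W' x v $ i)) (at x)"
      unfolding W'_def vec_lambda_beta by (intro has_derivative_sum has_derivative_mult A V\<phi>)
    then show "((\<lambda>x. (adjugate3 (J x) *v V (\<phi> x)) $ i) has_derivative (\<lambda>v. W' x v $ i)) (at x)"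
      by (simp add: matrix_vector_mult_def)
  qed
  moreover have "continuous_on UNIV (\<lambda>x. W' x v)" for v
    unfolding W'_def matrix_vector_mult_def vec_lambda_beta
    by (intro continuous_on_vec_lambda continuous_on_sum continuous_on_add continuous_on_mult cP\<phi> cV\<phi> cJ cA cC continuous_on_const)
  moreover have "(\<Sum>i\<in>UNIV. W' x (axis i 1) $ i) = det (J x) * (\<Sum>l\<in>UNIV. P l (\<phi> x) $ l)" for x
  proof -
    have s: "B k 2 x (axis 1 1) = B k 1 x (axis 2 1)" "B k 3 x (axis 1 1) = B k 1 x (axis 3 1)"
      "B k 3 x (axis 2 1) = B k 2 x (axis 3 1)" for k by (rule B(1))+
    \<comment> \<open>Divergence in the row index i for a fixed column k: the products of J with
      second derivatives cancel in pairs by symmetry.\<close>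
    have piola: "(\<Sum>i\<in>UNIV. C i k x (axis i 1)) = 0" for k
      using exhaust_3[of k]
      by (elim disjE; simp only:) (simp_all add: C_def sum_3 three_arith s algebra_simps)
    have JA: "(\<Sum>i\<in>UNIV. J x $ l $ i * adjugate3 (J x) $ i $ k) = (if l = k then det (J x) else 0)" for l k
    proof -
      have "(J x ** adjugate3 (J x)) $ l $ k = (det (J x) *\<^sub>R mat 1) $ l $ k" by (simp only: mult_adjugate3)
      then show ?thesis by (simp add: matrix_matrix_mult_def mat_def)
    qed
    have "(\<Sum>i\<in>UNIV. W' x (axis i 1) $ i) =
        (\<Sum>i\<in>UNIV. \<Sum>k\<in>UNIV. \<Sum>l\<in>UNIV. (J x $ l $ i * adjugate3 (J x) $ i $ k) * P l (\<phi> x) $ k) +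
        (\<Sum>i\<in>UNIV. \<Sum>k\<in>UNIV. C i k x (axis i 1) * V (\<phi> x) $ k)"
      by (simp add: W'_def matrix_vector_mult_basis column_def sum.distrib sum_distrib_left mult_ac)
    also have "(\<Sum>i\<in>UNIV. \<Sum>k\<in>UNIV. C i k x (axis i 1) * V (\<phi> x) $ k) = (\<Sum>k\<in>UNIV. (\<Sum>i\<in>UNIV. C i k x (axis i 1)) * V (\<phi> x) $ k)"
      by (subst sum.swap) (simp add: sum_distrib_right)
    also have "\<dots> = 0" by (simp add: piola)
    also have "(\<Sum>i\<in>UNIV. \<Sum>k\<in>UNIV. \<Sum>l\<in>UNIV. (J x $ l $ i * adjugate3 (J x) $ i $ k) * P l (\<phi> x) $ k) =
        (\<Sum>k\<in>UNIV. \<Sum>i\<in>UNIV. \<Sum>l\<in>UNIV. (J x $ l $ i * adjugate3 (J x) $ i $ k) * P l (\<phi> x) $ k)"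
      by (rule sum.swap)
    also have "\<dots> = (\<Sum>k\<in>UNIV. \<Sum>l\<in>UNIV. (\<Sum>i\<in>UNIV. J x $ l $ i * adjugate3 (J x) $ i $ k) * P l (\<phi> x) $ k)"
      by (rule sum.cong[OF refl], subst sum.swap) (simp add: sum_distrib_right)
    also have "\<dots> = (\<Sum>k\<in>UNIV. det (J x) * P k (\<phi> x) $ k)"
      unfolding JA by (rule sum.cong[OF refl]) (simp add: if_distrib[of "\<lambda>t. t * _"] cong: if_cong)
    finally show ?thesis by (simp add: sum_distrib_left)
  qed
  ultimately show ?thesis using that by blast
qed

subsection \<open>The maps \<open>\<phi>\<^sub>\<delta>\<close>\<close>

context
  fixes j :: "real^'n \<Rightarrow> real^'n"
  assumes j: "smooth j"
begin

lemma shrink_has_derivative: "(shrink j \<delta> has_derivative (\<lambda>v. v - \<delta> *\<^sub>R frechet_derivative j (at x) v)) (at x)"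
  unfolding shrink_def[abs_def]
  by (intro derivative_intros smooth_has_derivative[OF j])

lemma shrink_has_derivative_jac: "(shrink j \<delta> has_derivative (\<lambda>v. shrink_jac j \<delta> x *v v)) (at x)"
  using shrink_has_derivative[of \<delta> x] unfolding shrink_jac_def
  by (simp add: jacobian_works[symmetric] differentiableI)

lemma shrink_jac_entry:
  "shrink_jac j \<delta> x $ k $ l = (if k = l then 1 else 0) - \<delta> * frechet_derivative j (at x) (axis l 1) $ k"
proof -
  have "shrink_jac j \<delta> x = matrix (\<lambda>v. v - \<delta> *\<^sub>R frechet_derivative j (at x) v)"
    unfolding shrink_jac_def jacobian_def using frechet_derivative_at[OF shrink_has_derivative] by metis
  then show ?thesis by (simp add: matrix_def axis_def)
qed

lemma shrink_continuous: "continuous_on A (shrink j \<delta>)"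
  by (intro continuous_at_imp_continuous_on ballI has_derivative_continuous[OF shrink_has_derivative])

text \<open>Symmetry of the second derivatives of the components of j; the identity part of the
  Jacobian is constant and contributes the 0.\<close>

lemma shrink_jac_derivative:
  obtains B where "\<And>k l x. ((\<lambda>x. shrink_jac j \<delta> x $ k $ l) has_derivative B k l x) (at x)"
    "\<And>k l m x. B k l x (axis m 1) = B k m x (axis l 1)"
    "\<And>k l v. continuous_on UNIV (\<lambda>x. B k l x v)"
proof -
  define H where "H k l x v = frechet_derivative (\<lambda>x. frechet_derivative j (at x) (axis l 1)) (at x) v $ k" for k l x v
  have H: "((\<lambda>x. frechet_derivative j (at x) (axis l 1) $ k) has_derivative H k l x) (at x)" for k l x
    unfolding H_def by (intro has_derivative_component smooth_has_derivative smooth_directional j)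
  have cH: "continuous_on UNIV (\<lambda>x. H k l x v)" for k l v
    unfolding H_def by (intro continuous_on_component smooth_continuous_on smooth_directional j)
  have sym: "H k l x (axis m 1) = H k m x (axis l 1)" for k l m x
    by (rule symmetric_second_derivative[OF has_derivative_component[OF smooth_has_derivative[OF j]] H H cH cH])
  have d: "((\<lambda>x. shrink_jac j \<delta> x $ k $ l) has_derivative (\<lambda>v. 0 - \<delta> * H k l x v)) (at x)" for k l x
    unfolding shrink_jac_entry by (intro has_derivative_diff has_derivative_const has_derivative_mult_right H)
  show ?thesis
    by (rule that[of "\<lambda>k l x v. 0 - \<delta> * H k l x v"], rule d)
      (simp_all only: sym, intro continuous_intros cH)
qed

lemma shrink_jac_continuous: "continuous_on UNIV (\<lambda>z. shrink_jac j (fst z) (snd z) $ k $ l)"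
  unfolding shrink_jac_entry
  by (intro continuous_intros continuous_on_compose2[OF smooth_continuous_on[OF smooth_directional[OF j]] continuous_on_snd]) auto

end

text \<open>q is uniformly continuous on the compact product of [0,1] and the closure of D;
  comparing (\<delta>, x) with (0, x) gives one bound for all x.\<close>

lemma uniformly_small:
  fixes q :: "real \<times> 'a::euclidean_space \<Rightarrow> real"
  assumes q: "continuous_on UNIV q" "\<And>x. q (0, x) = 0" and D: "bounded D" and "\<eta> > 0"
  shows "\<forall>\<^sub>F \<delta> in at_right 0. \<forall>x\<in>D. \<bar>q (\<delta>, x)\<bar> \<le> \<eta>"
proof -
  let ?K = "{0..1::real} \<times> closure D"
  have "compact ?K" using D by (intro compact_Times) (auto simp: compact_closure)
  then have "uniformly_continuous_on ?K q"
    using q(1) by (intro compact_uniformly_continuous) (auto intro: continuous_on_subset)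
  then obtain d where d: "d > 0" "\<And>y z. y \<in> ?K \<Longrightarrow> z \<in> ?K \<Longrightarrow> dist z y < d \<Longrightarrow> dist (q z) (q y) < \<eta>"
    unfolding uniformly_continuous_on_def using \<open>\<eta> > 0\<close> by metis
  have "\<bar>q (\<delta>, x)\<bar> \<le> \<eta>" if "\<delta> > 0" "\<delta> < min d 1" "x \<in> D" for \<delta> x
  proof -
    have "dist (q (\<delta>, x)) (q (0, x)) < \<eta>"
      using that closure_subset[of D] by (intro d(2)) (auto simp: dist_Pair_Pair)
    then show ?thesis using q(2) by (simp add: dist_real_def)
  qed
  then show ?thesis
    using d(1) by (intro eventually_at_rightI[of 0 "min d 1"]) auto
qed

text \<open>The operator norm of M - 1 is at most the sum of the absolute values of its entries,
  which is jointly continuous and 0 at \<delta> = 0.\<close>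

lemma matrix_uniformly_close:
  fixes M :: "real \<Rightarrow> 'a::euclidean_space \<Rightarrow> real^'n^'n"
  assumes M: "\<And>k l. continuous_on UNIV (\<lambda>z. M (fst z) (snd z) $ k $ l)" "\<And>x. M 0 x = mat 1"
    and D: "bounded D" and "\<eta> > 0"
  shows "\<forall>\<^sub>F \<delta> in at_right 0. \<forall>x\<in>D. \<forall>v. norm (M \<delta> x *v v - v) \<le> \<eta> * norm v"
proof -
  define q where "q z = (\<Sum>k\<in>UNIV. \<Sum>l\<in>UNIV. \<bar>(M (fst z) (snd z) - mat 1) $ k $ l\<bar>)" for z
  have "continuous_on UNIV q"
    unfolding q_def vector_minus_component by (intro continuous_intros M(1))
  moreover have "q (0, x) = 0" for x by (simp add: q_def M(2))
  ultimately have "\<forall>\<^sub>F \<delta> in at_right 0. \<forall>x\<in>D. \<bar>q (\<delta>, x)\<bar> \<le> \<eta>"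
    using D \<open>\<eta> > 0\<close> by (rule uniformly_small)
  then show ?thesis
  proof eventually_elim
    case (elim \<delta>)
    show ?case
    proof (intro ballI allI)
      fix x v assume "x \<in> D"
      have "norm (M \<delta> x *v v - v) = norm ((M \<delta> x - mat 1) *v v)"
        by (simp add: matrix_vector_mult_diff_rdistrib)
      also have "\<dots> \<le> onorm ((*v) (M \<delta> x - mat 1)) * norm v"
        by (rule onorm[OF matrix_vector_mul_bounded_linear])
      also have "\<dots> \<le> q (\<delta>, x) * norm v"
        unfolding q_def using onorm_le_matrix_component_sum[of "M \<delta> x - mat 1"]
        by (intro mult_right_mono) auto
      also have "\<dots> \<le> \<eta> * norm v" using elim \<open>x \<in> D\<close> by (intro mult_right_mono) auto
      finally show "norm (M \<delta> x *v v - v) \<le> \<eta> * norm v" .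
    qed
  qed
qed

subsection \<open>Commutation with the differential operators and convergence\<close>

lemma continuous_on_matrix_vector_mult:
  fixes M :: "'a::topological_space \<Rightarrow> real^'n^'m"
  assumes "\<And>k l. continuous_on A (\<lambda>x. M x $ k $ l)" "continuous_on A v"
  shows "continuous_on A (\<lambda>x. M x *v v x)"
  unfolding matrix_vector_mult_def
  by (intro continuous_on_vec_lambda continuous_on_sum continuous_on_mult assms(1) continuous_on_component[OF assms(2)])

section \<open>Geometry of the maps on D and the common limit argument\<close>

locale mollification =
  fixes D :: "(real^3) set" and j :: "real^3 \<Rightarrow> real^3" and r \<delta>\<^sub>0 p :: real
  assumes D: "open D" "bounded D" and j: "smooth j" and r: "r > 0"
    and inside: "\<forall>\<delta>\<in>{0..1}. \<forall>x\<in>D. \<forall>y\<in>ball 0 1. shrink j \<delta> x + (\<delta> * r) *\<^sub>R y \<in> D"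
    and \<delta>\<^sub>0: "0 < \<delta>\<^sub>0" "\<delta>\<^sub>0 \<le> 1"
    and jac: "\<forall>\<delta>\<in>{0..\<delta>\<^sub>0}. \<forall>x\<in>D. matrix_norm (shrink_jac j \<delta> x - mat 1) \<le> 1 / 2"
    and det_inv: "\<forall>\<delta>\<in>{0..\<delta>\<^sub>0}. \<forall>x\<in>D. \<bar>det (matrix_inv (shrink_jac j \<delta> x))\<bar> \<le> 2 ^ 3"
    and p: "1 \<le> p"
begin

abbreviation J :: "real \<Rightarrow> real^3 \<Rightarrow> real^3^3" where
  "J \<equiv> shrink_jac j"

abbreviation smoothed :: "real \<Rightarrow> (real^3 \<Rightarrow> 'b::euclidean_space) \<Rightarrow> real^3 \<Rightarrow> 'b" where
  "smoothed \<delta> h x \<equiv> mol (\<delta> * r) h (shrink j \<delta> x)"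

text \<open>J v = 0 gives |v| = |(J - 1) v| \<le> |v| / 2. This must precede any use of
  \<open>matrix_inv\<close>, a choice that is known to be the inverse only for invertible
  matrices.\<close>

lemma invertible_shrink_jac:
  assumes "\<delta> \<in> {0..\<delta>\<^sub>0}" "x \<in> D"
  shows "invertible (J \<delta> x)"
  unfolding invertible_left_inverse matrix_left_invertible_ker
proof (intro allI impI)
  fix v assume v: "J \<delta> x *v v = 0"
  let ?M = "J \<delta> x - mat 1"
  have "norm v = norm (?M *v v)" using v by (simp add: matrix_vector_mult_diff_rdistrib)
  also have "\<dots> \<le> onorm ((*v) ?M) * norm v" by (rule onorm[OF matrix_vector_mul_bounded_linear])
  also have "\<dots> \<le> (1 / 2) * norm v"
    using jac assms unfolding matrix_norm_def by (intro mult_right_mono) auto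
  finally show "v = 0" by simp
qed

text \<open>The determinants of J and its inverse are reciprocal, so the bound 2^3 for the inverse
  becomes the constant 8 of the change of variables.\<close>

lemma det_shrink_jac_ge:
  assumes "\<delta> \<in> {0..\<delta>\<^sub>0}" "x \<in> D"
  shows "1 \<le> 8 * \<bar>det (J \<delta> x)\<bar>"
proof -
  let ?J = "J \<delta> x"
  have "det ?J * det (matrix_inv ?J) = 1"
    using matrix_inv_right[OF invertible_shrink_jac[OF assms]] by (metis det_I det_mul)
  then have "1 = \<bar>det ?J\<bar> * \<bar>det (matrix_inv ?J)\<bar>" by (metis abs_mult abs_one)
  also have "\<dots> \<le> \<bar>det ?J\<bar> * 2 ^ 3"
    using det_inv assms by (intro mult_left_mono) auto
  finally show ?thesis by simp
qed

lemma ball_shrink_subset: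
  assumes "\<delta> \<in> {0<..\<delta>\<^sub>0}" "x \<in> D"
  shows "ball (shrink j \<delta> x) (\<delta> * r) \<subseteq> D"
proof
  fix w assume w: "w \<in> ball (shrink j \<delta> x) (\<delta> * r)"
  define c where "c = \<delta> * r"
  have c: "c > 0" using assms r by (simp add: c_def)
  have "norm ((w - shrink j \<delta> x) /\<^sub>R c) = dist (shrink j \<delta> x) w / c"
    using c by (simp add: dist_norm norm_minus_commute divide_inverse_commute)
  also have "\<dots> < 1" using w c by (simp add: c_def)
  finally have y: "(w - shrink j \<delta> x) /\<^sub>R c \<in> ball 0 1" by (simp only: mem_ball_0)
  have "\<delta> \<in> {0..1}" using assms \<delta>\<^sub>0 by auto
  from bspec[OF bspec[OF bspec[OF inside this] assms(2)] y]
  have "shrink j \<delta> x + (\<delta> * r) *\<^sub>R ((w - shrink j \<delta> x) /\<^sub>R c) \<in> D" .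
  then show "w \<in> D" using c by (simp add: c_def[symmetric])
qed

text \<open>The hypothesis only concerns open balls; closed balls are covered because \<open>\<phi>\<^sub>\<delta>(D)\<close> is open.\<close>

lemma cball_shrink_subset:
  assumes "\<delta> \<in> {0<..\<delta>\<^sub>0}" "x \<in> D"
  shows "cball (shrink j \<delta> x) (\<delta> * r) \<subseteq> D"
proof (rule cball_subset_of_open_centres)
  show "open (shrink j \<delta> ` D)"
    using D(1) shrink_has_derivative_jac[OF j] invertible_shrink_jac assms
    by (intro open_image_invertible_derivative[where A = "J \<delta>"]) auto
qed (use assms ball_shrink_subset r in auto)

lemma shrink_jac_0: "J 0 x = mat 1"
  by (simp add: vec_eq_iff shrink_jac_entry[OF j] mat_def)

text \<open>The mean value inequality needs a convex set, hence the ball around D; there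
  \<open>shrink j \<delta>\<close> minus the identity is 1/2-Lipschitz once \<delta> is small, so
  two points with the same image satisfy |x - y| \<le> |x - y| / 2.\<close>

lemma eventually_inj_shrink: "\<forall>\<^sub>F \<delta> in at_right 0. inj_on (shrink j \<delta>) D"
proof -
  obtain R where "\<forall>y\<in>D. dist 0 y \<le> R"
    using D(2) unfolding bounded_any_center[where a = 0] by blast
  then have R: "D \<subseteq> cball 0 R" by auto
  have "\<forall>\<^sub>F \<delta> in at_right 0. \<forall>x\<in>cball 0 R. \<forall>v. norm (J \<delta> x *v v - v) \<le> (1 / 2) * norm v"
    by (rule matrix_uniformly_close[OF shrink_jac_continuous[OF j] shrink_jac_0]) auto
  then show ?thesis
  proof eventually_elim
    case (elim \<delta>)
    show ?case
    proof (rule inj_onI)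
      fix x y assume xy: "x \<in> D" "y \<in> D" "shrink j \<delta> x = shrink j \<delta> y"
      have "norm ((\<lambda>x. shrink j \<delta> x - x) x - (\<lambda>x. shrink j \<delta> x - x) y) \<le> (1 / 2) * norm (x - y)"
      proof (rule differentiable_bound[where S = "cball 0 R"])
        fix z :: "real^3" assume z: "z \<in> cball 0 R"
        show "((\<lambda>x. shrink j \<delta> x - x) has_derivative (\<lambda>v. J \<delta> z *v v - v)) (at z within cball 0 R)"
          by (rule has_derivative_at_withinI) (intro has_derivative_diff shrink_has_derivative_jac[OF j] has_derivative_ident)
        show "onorm (\<lambda>v. J \<delta> z *v v - v) \<le> 1 / 2"
          by (rule onorm_bound) (use elim z in auto)
      qed (use xy R in auto)
      then have "norm (x - y) \<le> (1 / 2) * norm (x - y)"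
        using xy(3) by (simp add: norm_minus_commute)
      then show "x = y" by simp
    qed
  qed
qed

lemma eventually_\<delta>: "\<forall>\<^sub>F \<delta> in at_right 0. \<delta> \<in> {0<..\<delta>\<^sub>0}"
  using \<delta>\<^sub>0(1) by (intro eventually_at_rightI[of 0 "\<delta>\<^sub>0"]) auto

text \<open>The common limit for all three operators: S = E = D in
  \<open>mol_compose_tendsto\<close>, while A stands for the matrix or scalar factor in front of the
  mollified derivative.\<close>

lemma Lp_limit:
  fixes f :: "real^3 \<Rightarrow> 'b::euclidean_space" and A :: "real \<Rightarrow> real^3 \<Rightarrow> 'b \<Rightarrow> 'b"
  assumes h: "represents D h f" and hp: "integrable lborel (\<lambda>w. norm (h w) powr p)"
    and A: "\<And>\<eta>. \<eta> > 0 \<Longrightarrow> \<forall>\<^sub>F \<delta> in at_right 0. \<forall>x\<in>D. \<forall>v. norm (A \<delta> x v - v) \<le> \<eta> * norm v"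
  shows "((\<lambda>\<delta>. Lp_norm p D (\<lambda>x. A \<delta> x (smoothed \<delta> h x) - f x)) \<longlongrightarrow> 0) (at 0 within {0<..\<delta>\<^sub>0})"
proof -
  note h' = representsD[OF h]
  have Db: "D \<in> sets borel" and hb: "h \<in> borel_measurable borel" using D h'(2) by auto
  \<comment> \<open>C bounds |j| on D, and \<open>shrink j \<delta>\<close> moves x by \<delta>|j
    x|.\<close>
  have "compact (j ` closure D)"
    using D(2) by (intro compact_continuous_image smooth_continuous_on j) (simp add: compact_closure)
  from compact_imp_bounded[OF this] obtain C where "\<forall>y\<in>j ` closure D. norm y \<le> C"
    unfolding bounded_pos by blast
  then have C: "norm (j x) \<le> C" if "x \<in> D" for x using that closure_subset[of D] by blast
  have lim: "((\<lambda>\<delta>. \<integral>\<^sup>+x. indicator D x * ennreal (norm (smoothed \<delta> h x - h x) powr p) \<partial>lborel) \<longlongrightarrow> 0) (at_right 0)"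
  proof (rule mol_compose_tendsto[OF p r Db D(2) Db order_refl hb h'(3) hp, where C = C and c = 8])
    show "\<forall>\<^sub>F \<delta> in at_right 0. \<forall>x\<in>D. ball (shrink j \<delta> x) (\<delta> * r) \<subseteq> D"
      using eventually_\<delta> by eventually_elim (use ball_shrink_subset in blast)
    show "dist (shrink j \<delta> x) x \<le> C * \<delta>" if "0 < \<delta>" "x \<in> D" for \<delta> x
      using mult_left_mono[OF C[OF that(2)], of \<delta>] that(1) by (simp add: shrink_def dist_norm mult.commute)
    show "\<forall>\<^sub>F \<delta> in at_right 0. \<forall>H :: real^3 \<Rightarrow> real. continuous_on UNIV H \<longrightarrow> (\<forall>x. H x \<ge> 0) \<longrightarrow> integrable lborel H \<longrightarrow>
       (\<integral>\<^sup>+x. indicator D x * ennreal (H (shrink j \<delta> x)) \<partial>lborel) \<le> ennreal 8 * (\<integral>\<^sup>+x. ennreal (H x) \<partial>lborel)"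
      using eventually_\<delta> eventually_inj_shrink
    proof eventually_elim
      case (elim \<delta>)
      show ?case
        using elim det_shrink_jac_ge
        by (intro allI impI nn_integral_compose_le[OF Db shrink_has_derivative_jac[OF j]]) auto
    qed
  qed (use shrink_continuous[OF j] in auto)
  have "((\<lambda>\<delta>. Lp_norm p D (\<lambda>x. A \<delta> x (smoothed \<delta> h x) - f x)) \<longlongrightarrow> 0) (at_right 0)"
  proof (rule Lp_norm_perturbation_tendsto_0[OF p Db hb hp h'(1) _ lim A])
    fix \<delta> :: real assume "\<delta> > 0"
    then have "continuous_on UNIV (\<lambda>x. smoothed \<delta> h x)"
      using r by (intro continuous_on_compose2[OF mol_continuous[OF _ h'(2)] shrink_continuous[OF j]]) auto
    then show "(\<lambda>x. smoothed \<delta> h x) \<in> borel_measurable borel"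
      by (rule borel_measurable_continuous_onI)
  qed
  \<comment> \<open>The interval lies to the right of 0, so its filter is finer than
    \<open>at_right 0\<close>.\<close>
  then show ?thesis
    by (rule tendsto_mono[rotated]) (auto intro: at_le)
qed

section \<open>The smoothing operators and their weak derivatives for one \<delta>\<close>

context
  fixes \<delta> :: real
  assumes \<delta>: "\<delta> \<in> {0<..\<delta>\<^sub>0}"
begin

lemma \<epsilon>_pos: "\<delta> * r > 0" using \<delta> r by simp

lemma Kg_eq_mol:
  assumes h: "represents D h f" and x: "x \<in> D"
  shows "Kg j r \<delta> f x = smoothed \<delta> h x"
  using kernel_integral_eq_mol[OF \<epsilon>_pos representsD(2,1)[OF h] ball_shrink_subset[OF \<delta> x]]
  by (simp add: Kg_def)

lemma Kc_eq_mol: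
  assumes h: "represents D h f" and x: "x \<in> D"
  shows "Kc j r \<delta> f x = transpose (J \<delta> x) *v smoothed \<delta> h x"
proof -
  note b = ball_shrink_subset[OF \<delta> x]
  have "Kc j r \<delta> f x = (LINT y|lebesgue_on (ball 0 1). transpose (J \<delta> x) *v (kernel y *\<^sub>R f (shrink j \<delta> x + (\<delta> * r) *\<^sub>R y)))"
    by (simp add: Kc_def matrix_vector_mult_scaleR)
  also have "\<dots> = transpose (J \<delta> x) *v smoothed \<delta> h x"
    unfolding kernel_integral_eq_mol[OF \<epsilon>_pos representsD(2,1)[OF h] b, symmetric]
    by (rule integral_bounded_linear[OF matrix_vector_mul_bounded_linear kernel_integrable[OF \<epsilon>_pos representsD(2,1)[OF h] b]])
  finally show ?thesis .
qed

text \<open>The adjugate replaces det(J) times the inverse because it is polynomial in the entries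
  of J: the right side is then continuous on the whole space, even where J is singular.\<close>

lemma Kd_eq_mol:
  assumes h: "represents D h f" and x: "x \<in> D"
  shows "Kd j r \<delta> f x = adjugate3 (J \<delta> x) *v smoothed \<delta> h x"
proof -
  note b = ball_shrink_subset[OF \<delta> x]
  have "invertible (J \<delta> x)" using \<delta> x by (intro invertible_shrink_jac) auto
  note adj = adjugate3_invertible[OF this]
  have "Kd j r \<delta> f x = (LINT y|lebesgue_on (ball 0 1). adjugate3 (J \<delta> x) *v (kernel y *\<^sub>R f (shrink j \<delta> x + (\<delta> * r) *\<^sub>R y)))"
    unfolding adj by (simp add: Kd_def matrix_vector_mult_scaleR scaleR_matrix_vector_assoc[symmetric])
  also have "\<dots> = adjugate3 (J \<delta> x) *v smoothed \<delta> h x"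
    unfolding kernel_integral_eq_mol[OF \<epsilon>_pos representsD(2,1)[OF h] b, symmetric]
    by (rule integral_bounded_linear[OF matrix_vector_mul_bounded_linear kernel_integrable[OF \<epsilon>_pos representsD(2,1)[OF h] b]])
  finally show ?thesis .
qed

lemma shrink_jac_entry_continuous: "continuous_on UNIV (\<lambda>x. J \<delta> x $ k $ l)"
  unfolding shrink_jac_entry[OF j]
  by (intro continuous_on_diff continuous_on_const continuous_on_mult continuous_on_component
      smooth_continuous_on[OF smooth_directional[OF j]])

lemma mol_shrink_continuous:
  fixes h :: "real^3 \<Rightarrow> 'b::euclidean_space"
  assumes "integrable lborel h"
  shows "continuous_on UNIV (\<lambda>x. smoothed \<delta> h x)"
  by (rule continuous_on_compose2[OF mol_continuous[OF \<epsilon>_pos assms] shrink_continuous[OF j] subset_UNIV])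

lemma transpose_mol_continuous:
  assumes "integrable lborel h"
  shows "continuous_on UNIV (\<lambda>x. transpose (J \<delta> x) *v smoothed \<delta> h x)"
  by (rule continuous_on_matrix_vector_mult[OF _ mol_shrink_continuous[OF assms]])
    (simp add: transpose_def shrink_jac_entry_continuous)

lemma adjugate3_mol_continuous:
  assumes "integrable lborel h"
  shows "continuous_on UNIV (\<lambda>x. adjugate3 (J \<delta> x) *v smoothed \<delta> h x)"
proof (rule continuous_on_matrix_vector_mult[OF _ mol_shrink_continuous[OF assms]])
  show "continuous_on UNIV (\<lambda>x. adjugate3 (J \<delta> x) $ k $ l)" for k l
    unfolding adjugate3_entry by (intro continuous_on_diff continuous_on_mult shrink_jac_entry_continuous)
qed

lemma det_mol_continuous:
  assumes "integrable lborel h"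
  shows "continuous_on UNIV (\<lambda>x. det (J \<delta> x) * smoothed \<delta> h x)"
  unfolding det_3
  by (intro continuous_on_add continuous_on_diff continuous_on_mult shrink_jac_entry_continuous
      mol_shrink_continuous[OF assms])

lemma in_Lp_of_continuous:
  fixes F :: "real^3 \<Rightarrow> 'b::euclidean_space"
  assumes "continuous_on UNIV F" "\<And>x. x \<in> D \<Longrightarrow> g x = F x"
  shows "g \<in> Lp p D"
  by (rule Lp_bounded_continuous[OF D continuous_on_subset[OF assms(1) subset_UNIV] assms(2) p])

text \<open>Mollification and weak gradient are known to commute only at the points
  \<open>shrink j \<delta> x\<close> with x in D, which is all that the chain rule at x asks
  for.\<close>

lemma has_weak_gradient_Kg:
  assumes w: "has_weak_gradient D f G"
    and f: "represents D hf f" and G: "represents D hG G"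
  defines "F \<equiv> \<lambda>x. transpose (J \<delta> x) *v smoothed \<delta> hG x"
  shows "Kg j r \<delta> f \<in> Lp p D" "F \<in> Lp p D" "has_weak_gradient D (Kg j r \<delta> f) F"
proof -
  have cF: "continuous_on UNIV F" unfolding F_def by (rule transpose_mol_continuous[OF representsD(2)[OF G]])
  show K: "Kg j r \<delta> f \<in> Lp p D"
    by (rule in_Lp_of_continuous[OF mol_shrink_continuous[OF representsD(2)[OF f]] Kg_eq_mol[OF f]])
  show F: "F \<in> Lp p D" by (rule in_Lp_of_continuous[OF cF refl])
  show "has_weak_gradient D (Kg j r \<delta> f) F"
  proof (rule has_weak_gradientI[OF D(1)])
    fix x assume x: "x \<in> D"
    have "((\<lambda>x. smoothed \<delta> hf x) has_derivative
        (\<lambda>v. mol_partial (\<delta> * r) (J \<delta> x *v v) hf (shrink j \<delta> x))) (at x)"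
      by (rule has_derivative_compose[OF shrink_has_derivative_jac[OF j] mol_has_derivative_partial[OF \<epsilon>_pos representsD(2)[OF f]]])
    moreover have "mol_partial (\<delta> * r) (J \<delta> x *v v) hf (shrink j \<delta> x) =
        smoothed \<delta> hG x \<bullet> (J \<delta> x *v v)" for v
      by (rule mol_weak_gradient[OF \<epsilon>_pos D(1) cball_shrink_subset[OF \<delta> x] w f G])
    then have "mol_partial (\<delta> * r) (J \<delta> x *v v) hf (shrink j \<delta> x) = F x \<bullet> v" for v
      by (simp add: F_def transpose_matrix_vector dot_lmul_matrix)
    ultimately have "((\<lambda>x. smoothed \<delta> hf x) has_derivative (\<lambda>v. F x \<bullet> v)) (at x)" by simp
    then show "(Kg j r \<delta> f has_derivative (\<lambda>v. F x \<bullet> v)) (at x)"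
      by (rule has_derivative_transform_within_open[OF _ D(1) x]) (rule Kg_eq_mol[OF f, symmetric])
  qed (rule continuous_on_subset[OF cF subset_UNIV] Lp_locally_integrable[OF K D p] Lp_locally_integrable[OF F D p])+
qed

lemma mol_has_derivative_sum:
  fixes h :: "real^3 \<Rightarrow> real^3"
  assumes "integrable lborel h"
  shows "(mol (\<delta> * r) h has_derivative (\<lambda>v. \<Sum>l\<in>UNIV. v $ l *\<^sub>R mol_partial (\<delta> * r) (axis l 1) h z)) (at z)"
  by (rule has_derivative_eq_rhs[OF mol_has_derivative_partial[OF \<epsilon>_pos assms]], rule ext)
    (rule mol_partial_expand[OF \<epsilon>_pos assms])

text \<open>The pull-back formula holds on the whole space for the mollified field; the weak curl of
  f enters pointwise, at images of points of D.\<close>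

lemma has_weak_curl_Kc:
  assumes w: "has_weak_curl D f G"
    and f: "represents D hf f" and G: "represents D hG G"
  defines "F \<equiv> \<lambda>x. adjugate3 (J \<delta> x) *v smoothed \<delta> hG x"
  shows "Kc j r \<delta> f \<in> Lp p D" "F \<in> Lp p D" "has_weak_curl D (Kc j r \<delta> f) F"
proof -
  have cF: "continuous_on UNIV F" unfolding F_def by (rule adjugate3_mol_continuous[OF representsD(2)[OF G]])
  show K: "Kc j r \<delta> f \<in> Lp p D"
    by (rule in_Lp_of_continuous[OF transpose_mol_continuous[OF representsD(2)[OF f]] Kc_eq_mol[OF f]])
  show F: "F \<in> Lp p D" by (rule in_Lp_of_continuous[OF cF refl])
  obtain B where B: "\<And>k l x. ((\<lambda>x. J \<delta> x $ k $ l) has_derivative B k l x) (at x)"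
    "\<And>k l m x. B k l x (axis m 1) = B k m x (axis l 1)" "\<And>k l v. continuous_on UNIV (\<lambda>x. B k l x v)"
    by (rule shrink_jac_derivative[OF j, of \<delta>]) (rule that)
  obtain W' where W': "\<And>x. ((\<lambda>x. transpose (J \<delta> x) *v smoothed \<delta> hf x) has_derivative W' x) (at x)"
    "\<And>v. continuous_on UNIV (\<lambda>x. W' x v)"
    "\<And>x. curl_of (W' x) = adjugate3 (J \<delta> x) *v
      curl_of (\<lambda>v. \<Sum>l\<in>UNIV. v $ l *\<^sub>R mol_partial (\<delta> * r) (axis l 1) hf (shrink j \<delta> x))"
    by (rule pullback_curl[OF shrink_has_derivative_jac[OF j] B mol_has_derivative_sum[OF representsD(2)[OF f]] mol_partial_continuous[OF \<epsilon>_pos representsD(2)[OF f]]])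
      (rule that)
  show "has_weak_curl D (Kc j r \<delta> f) F"
  proof (rule has_weak_curlI[OF D(1)])
    fix x assume x: "x \<in> D"
    show "(Kc j r \<delta> f has_derivative W' x) (at x)"
      by (rule has_derivative_transform_within_open[OF W'(1) D(1) x]) (rule Kc_eq_mol[OF f, symmetric])
    have "curl_of (\<lambda>v. mol_partial (\<delta> * r) v hf (shrink j \<delta> x)) = smoothed \<delta> hG x"
      by (rule mol_weak_curl[OF \<epsilon>_pos D(1) cball_shrink_subset[OF \<delta> x] w f G])
    then show "F x = curl_of (W' x)"
      unfolding W'(3) F_def mol_partial_expand[OF \<epsilon>_pos representsD(2)[OF f], symmetric] by simp
  qed (rule continuous_on_subset[OF W'(2) subset_UNIV] Lp_locally_integrable[OF K D p] Lp_locally_integrable[OF F D p])+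
qed

lemma has_weak_div_Kd:
  assumes w: "has_weak_div D f G"
    and f: "represents D hf f" and G: "represents D hG G"
  defines "F \<equiv> \<lambda>x. det (J \<delta> x) * smoothed \<delta> hG x"
  shows "Kd j r \<delta> f \<in> Lp p D" "F \<in> Lp p D" "has_weak_div D (Kd j r \<delta> f) F"
proof -
  have cF: "continuous_on UNIV F" unfolding F_def by (rule det_mol_continuous[OF representsD(2)[OF G]])
  show K: "Kd j r \<delta> f \<in> Lp p D"
    by (rule in_Lp_of_continuous[OF adjugate3_mol_continuous[OF representsD(2)[OF f]] Kd_eq_mol[OF f]])
  show F: "F \<in> Lp p D" by (rule in_Lp_of_continuous[OF cF refl])
  obtain B where B: "\<And>k l x. ((\<lambda>x. J \<delta> x $ k $ l) has_derivative B k l x) (at x)"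
    "\<And>k l m x. B k l x (axis m 1) = B k m x (axis l 1)" "\<And>k l v. continuous_on UNIV (\<lambda>x. B k l x v)"
    by (rule shrink_jac_derivative[OF j, of \<delta>]) (rule that)
  obtain W' where W': "\<And>x. ((\<lambda>x. adjugate3 (J \<delta> x) *v smoothed \<delta> hf x) has_derivative W' x) (at x)"
    "\<And>v. continuous_on UNIV (\<lambda>x. W' x v)"
    "\<And>x. (\<Sum>i\<in>UNIV. W' x (axis i 1) $ i) = det (J \<delta> x) *
      (\<Sum>l\<in>UNIV. mol_partial (\<delta> * r) (axis l 1) hf (shrink j \<delta> x) $ l)"
    by (rule pullback_div[OF shrink_has_derivative_jac[OF j] B mol_has_derivative_sum[OF representsD(2)[OF f]] mol_partial_continuous[OF \<epsilon>_pos representsD(2)[OF f]]])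
      (rule that)
  show "has_weak_div D (Kd j r \<delta> f) F"
  proof (rule has_weak_divI[OF D(1)])
    fix x assume x: "x \<in> D"
    show "(Kd j r \<delta> f has_derivative W' x) (at x)"
      by (rule has_derivative_transform_within_open[OF W'(1) D(1) x]) (rule Kd_eq_mol[OF f, symmetric])
    have "(\<Sum>l\<in>UNIV. mol_partial (\<delta> * r) (axis l 1) hf (shrink j \<delta> x) $ l) = smoothed \<delta> hG x"
      by (rule mol_weak_div[OF \<epsilon>_pos D(1) cball_shrink_subset[OF \<delta> x] w f G])
    then show "F x = (\<Sum>i\<in>UNIV. W' x (axis i 1) $ i)"
      unfolding W'(3) F_def by simp
  qed (rule continuous_on_subset[OF W'(2) subset_UNIV] Lp_locally_integrable[OF K D p] Lp_locally_integrable[OF F D p])+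
qed

end

text \<open>W abstracts the three weak derivative relations. The derivative picked by
  \<open>SOME\<close> agrees almost everywhere with F - G by uniqueness, so the two norms coincide
  for every admissible \<delta>.\<close>

lemma smoothed_converges:
  fixes W :: "(real^3 \<Rightarrow> 'a::euclidean_space) \<Rightarrow> (real^3 \<Rightarrow> 'b::euclidean_space) \<Rightarrow> bool"
  assumes diff: "\<And>u U v V. W u U \<Longrightarrow> W v V \<Longrightarrow> W (\<lambda>x. u x - v x) (\<lambda>x. U x - V x)"
    and unique: "\<And>u U V. W u U \<Longrightarrow> W u V \<Longrightarrow> AE x in lborel. x \<in> D \<longrightarrow> U x = V x"
    and f: "f \<in> Lp p D" "G \<in> Lp p D" "W f G"
    and K: "\<And>\<delta>. \<delta> \<in> {0<..\<delta>\<^sub>0} \<Longrightarrow> K \<delta> \<in> Lp p D" "\<And>\<delta>. \<delta> \<in> {0<..\<delta>\<^sub>0} \<Longrightarrow> F \<delta> \<in> Lp p D"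
      "\<And>\<delta>. \<delta> \<in> {0<..\<delta>\<^sub>0} \<Longrightarrow> W (K \<delta>) (F \<delta>)"
    and lim: "((\<lambda>\<delta>. Lp_norm p D (\<lambda>x. F \<delta> x - G x)) \<longlongrightarrow> 0) (at 0 within {0<..\<delta>\<^sub>0})"
  shows "(\<forall>\<delta>\<in>{0<..\<delta>\<^sub>0}. (\<lambda>x. K \<delta> x - f x) \<in> {v \<in> Lp p D. \<exists>c \<in> Lp p D. W v c}) \<and>
    ((\<lambda>\<delta>. Lp_norm p D (SOME c. W (\<lambda>x. K \<delta> x - f x) c)) \<longlongrightarrow> 0) (at 0 within {0<..\<delta>\<^sub>0})"
proof
  have FL: "(\<lambda>x. F \<delta> x - G x) \<in> Lp p D" if "\<delta> \<in> {0<..\<delta>\<^sub>0}" for \<delta>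
    by (rule Lp_diff[OF K(2)[OF that] f(2) p])
  have W: "W (\<lambda>x. K \<delta> x - f x) (\<lambda>x. F \<delta> x - G x)" if "\<delta> \<in> {0<..\<delta>\<^sub>0}" for \<delta>
    by (rule diff[OF K(3)[OF that] f(3)])
  show "\<forall>\<delta>\<in>{0<..\<delta>\<^sub>0}. (\<lambda>x. K \<delta> x - f x) \<in> {v \<in> Lp p D. \<exists>c \<in> Lp p D. W v c}"
    using W FL Lp_diff[OF K(1) f(1) p] by blast
  show "((\<lambda>\<delta>. Lp_norm p D (SOME c. W (\<lambda>x. K \<delta> x - f x) c)) \<longlongrightarrow> 0) (at 0 within {0<..\<delta>\<^sub>0})"
  proof (rule Lim_transform_eventually[OF lim])
    show "\<forall>\<^sub>F \<delta> in at 0 within {0<..\<delta>\<^sub>0}.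
        Lp_norm p D (\<lambda>x. F \<delta> x - G x) = Lp_norm p D (SOME c. W (\<lambda>x. K \<delta> x - f x) c)"
      unfolding eventually_at_filter
    proof (intro always_eventually allI impI)
      fix \<delta> assume "\<delta> \<in> {0<..\<delta>\<^sub>0}"
      note FL = FL[OF this] and W = W[OF this]
      show "Lp_norm p D (\<lambda>x. F \<delta> x - G x) = Lp_norm p D (SOME c. W (\<lambda>x. K \<delta> x - f x) c)"
        by (rule Lp_norm_cong_AE[OF D(1) FL unique[OF W someI[of "W _", OF W]]])
    qed
  qed
qed

section \<open>The three limits\<close>

lemma Kg_converges:
  assumes "f \<in> Zg p D"
  shows "(\<forall>\<delta>\<in>{0<..\<delta>\<^sub>0}. (\<lambda>x. Kg j r \<delta> f x - f x) \<in> Zg p D) \<and>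
    ((\<lambda>\<delta>. Lp_norm p D (weak_gradient D (\<lambda>x. Kg j r \<delta> f x - f x))) \<longlongrightarrow> 0) (at 0 within {0<..\<delta>\<^sub>0})"
proof -
  obtain G where f: "f \<in> Lp p D" and G: "G \<in> Lp p D" and w: "has_weak_gradient D f G"
    using assms by (auto simp: Zg_def)
  obtain hf where hf: "represents D hf f"
    by (rule Lp_representative[OF f D p]) (rule that)
  obtain hG where hG: "represents D hG G" "integrable lborel (\<lambda>w. norm (hG w) powr p)"
    by (rule Lp_representative[OF G D p]) (rule that)
  have close: "\<forall>\<^sub>F \<delta> in at_right 0. \<forall>x\<in>D. \<forall>v. norm (transpose (J \<delta> x) *v v - v) \<le> \<eta> * norm v" if "\<eta> > 0" for \<eta>
    using that D(2) shrink_jac_continuous[OF j]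
    by (intro matrix_uniformly_close) (auto simp: transpose_def shrink_jac_0 mat_def vec_eq_iff)
  show ?thesis
    unfolding Zg_def weak_gradient_def
    by (rule smoothed_converges[where W = "has_weak_gradient D",
          OF has_weak_gradient_diff[OF D(1)] weak_gradient_unique[OF D(1)] f G w
            has_weak_gradient_Kg[OF _ w hf hG(1)] Lp_limit[OF hG close]])
qed

lemma Kc_converges:
  assumes "f \<in> Zc p D"
  shows "(\<forall>\<delta>\<in>{0<..\<delta>\<^sub>0}. (\<lambda>x. Kc j r \<delta> f x - f x) \<in> Zc p D) \<and>
    ((\<lambda>\<delta>. Lp_norm p D (weak_curl D (\<lambda>x. Kc j r \<delta> f x - f x))) \<longlongrightarrow> 0) (at 0 within {0<..\<delta>\<^sub>0})"
proof -
  obtain G where f: "f \<in> Lp p D" and G: "G \<in> Lp p D" and w: "has_weak_curl D f G"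
    using assms by (auto simp: Zc_def)
  obtain hf where hf: "represents D hf f"
    by (rule Lp_representative[OF f D p]) (rule that)
  obtain hG where hG: "represents D hG G" "integrable lborel (\<lambda>w. norm (hG w) powr p)"
    by (rule Lp_representative[OF G D p]) (rule that)
  have close: "\<forall>\<^sub>F \<delta> in at_right 0. \<forall>x\<in>D. \<forall>v. norm (adjugate3 (J \<delta> x) *v v - v) \<le> \<eta> * norm v" if "\<eta> > 0" for \<eta>
  proof (rule matrix_uniformly_close[OF _ _ D(2) that])
    show "continuous_on UNIV (\<lambda>z. adjugate3 (J (fst z) (snd z)) $ k $ l)" for k l
      unfolding adjugate3_entry by (intro continuous_on_diff continuous_on_mult shrink_jac_continuous[OF j])
    \<comment> \<open>At M = 1 the identity M adj(M) = det(M) 1 reads adj(1) = 1.\<close>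
    show "adjugate3 (J 0 x) = mat 1" for x
      using mult_adjugate3[of "mat 1"] by (simp add: shrink_jac_0)
  qed
  show ?thesis
    unfolding Zc_def weak_curl_def
    by (rule smoothed_converges[where W = "has_weak_curl D",
          OF has_weak_curl_diff[OF D(1)] weak_curl_unique[OF D(1)] f G w
            has_weak_curl_Kc[OF _ w hf hG(1)] Lp_limit[OF hG close]])
qed

lemma Kd_converges:
  assumes "f \<in> Zd p D"
  shows "(\<forall>\<delta>\<in>{0<..\<delta>\<^sub>0}. (\<lambda>x. Kd j r \<delta> f x - f x) \<in> Zd p D) \<and>
    ((\<lambda>\<delta>. Lp_norm p D (weak_div D (\<lambda>x. Kd j r \<delta> f x - f x))) \<longlongrightarrow> 0) (at 0 within {0<..\<delta>\<^sub>0})"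
proof -
  obtain G where f: "f \<in> Lp p D" and G: "G \<in> Lp p D" and w: "has_weak_div D f G"
    using assms by (auto simp: Zd_def)
  obtain hf where hf: "represents D hf f"
    by (rule Lp_representative[OF f D p]) (rule that)
  obtain hG where hG: "represents D hG G" "integrable lborel (\<lambda>w. norm (hG w) powr p)"
    by (rule Lp_representative[OF G D p]) (rule that)
  have close: "\<forall>\<^sub>F \<delta> in at_right 0. \<forall>x\<in>D. \<forall>v. norm (det (J \<delta> x) * v - v) \<le> \<eta> * norm v" if "\<eta> > 0" for \<eta>
  proof -
    have "\<forall>\<^sub>F \<delta> in at_right 0. \<forall>x\<in>D. \<bar>(\<lambda>z. det (J (fst z) (snd z)) - 1) (\<delta>, x)\<bar> \<le> \<eta>"
    proof (rule uniformly_small[OF _ _ D(2) that])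
      show "continuous_on UNIV (\<lambda>z. det (J (fst z) (snd z)) - 1)"
        unfolding det_3
        by (intro continuous_on_add continuous_on_diff continuous_on_mult continuous_on_const shrink_jac_continuous[OF j])
    qed (simp add: shrink_jac_0)
    then show ?thesis
    proof eventually_elim
      case (elim \<delta>)
      show ?case
      proof (intro ballI allI)
        fix x v assume "x \<in> D"
        have "norm (det (J \<delta> x) * v - v) = \<bar>det (J \<delta> x) - 1\<bar> * norm v"
          by (simp add: abs_mult[symmetric] left_diff_distrib)
        also have "\<dots> \<le> \<eta> * norm v" using elim \<open>x \<in> D\<close> by (intro mult_right_mono) auto
        finally show "norm (det (J \<delta> x) * v - v) \<le> \<eta> * norm v" .
      qed
    qed
  qed
  show ?thesis
    unfolding Zd_def weak_div_def
    by (rule smoothed_converges[where W = "has_weak_div D",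
          OF has_weak_div_diff[OF D(1)] weak_div_unique[OF D(1)] f G w
            has_weak_div_Kd[OF _ w hf hG(1)] Lp_limit[OF hG close]])
qed

end

text \<open>Membership of the differences in the spaces is asserted along with the limits: it
  guarantees that a weak derivative exists, so that the chosen one in the norm is
  meaningful.\<close>

theorem corollary3p4:
  fixes D :: "(real^3) set" and j :: "real^3 \<Rightarrow> real^3" and r \<delta>\<^sub>0 p :: real
  assumes "open D" and "bounded D" and "connected D" and "strongly_lipschitz D"
    and "smooth j"
    and "\<forall>x\<in>frontier D. norm (j x) = 1"
    and "globally_transversal D j"
    and "r > 0"
    and "\<forall>\<delta>\<in>{0..1}. \<forall>x\<in>D. \<forall>y\<in>ball 0 1. shrink j \<delta> x + (\<delta> * r) *\<^sub>R y \<in> D"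
    and "0 < \<delta>\<^sub>0" and "\<delta>\<^sub>0 \<le> 1"
    and "\<forall>\<delta>\<in>{0..\<delta>\<^sub>0}. \<forall>x\<in>D. matrix_norm (shrink_jac j \<delta> x - mat 1) \<le> 1 / 2"
    and "\<forall>\<delta>\<in>{0..\<delta>\<^sub>0}. \<forall>x\<in>D. matrix_norm (matrix_inv (shrink_jac j \<delta> x)) \<le> 2"
    and "\<forall>\<delta>\<in>{0..\<delta>\<^sub>0}. \<forall>x\<in>D. \<bar>det (matrix_inv (shrink_jac j \<delta> x))\<bar> \<le> 2 ^ 3"
    and "1 \<le> p"
  shows "(\<forall>f \<in> Zg p D.
            (\<forall>\<delta>\<in>{0<..\<delta>\<^sub>0}. (\<lambda>x. Kg j r \<delta> f x - f x) \<in> Zg p D) \<and>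
            ((\<lambda>\<delta>. Lp_norm p D (weak_gradient D (\<lambda>x. Kg j r \<delta> f x - f x))) \<longlongrightarrow> 0)
              (at 0 within {0<..\<delta>\<^sub>0})) \<and>
         (\<forall>g \<in> Zc p D.
            (\<forall>\<delta>\<in>{0<..\<delta>\<^sub>0}. (\<lambda>x. Kc j r \<delta> g x - g x) \<in> Zc p D) \<and>
            ((\<lambda>\<delta>. Lp_norm p D (weak_curl D (\<lambda>x. Kc j r \<delta> g x - g x))) \<longlongrightarrow> 0)
              (at 0 within {0<..\<delta>\<^sub>0})) \<and>
         (\<forall>g \<in> Zd p D.
            (\<forall>\<delta>\<in>{0<..\<delta>\<^sub>0}. (\<lambda>x. Kd j r \<delta> g x - g x) \<in> Zd p D) \<and>
            ((\<lambda>\<delta>. Lp_norm p D (weak_div D (\<lambda>x. Kd j r \<delta> g x - g x))) \<longlongrightarrow> 0)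
              (at 0 within {0<..\<delta>\<^sub>0}))"
proof -
  interpret mollification D j r \<delta>\<^sub>0 p
    using assms by unfold_locales auto
  show ?thesis
    using Kg_converges Kc_converges Kd_converges by blast
qed

end
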